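(* Let $N\ge3$ and $1<p<\frac{N}{N-2}$. Then (i) if $\overline M\le M\le0$ there exists no ground state of (E); (ii) if $\overline M\le M<-\mu^*$ there exists a positive singular solution $u$ of (E) on $(0,\infty)$, unique up to the scalings $u\mapsto k^{\frac{2}{p-1}}u(k\,\cdot)$, $k>0$, such that $u(r)\sim U_{2,M}(r)$ as $r\to0$, $u(r)\sim U_{1,M}(r)$ as $r\to\infty$, and $u(r)>U_{1,M}(r)$ for all $r>0$.
   Context: (E) denotes the ODE $-u_{rr}-\frac{N-1}{r}u_r=|u|^{p-1}u+M|u_r|^{\frac{2p}{p+1}}$ for $r>0$. A ground state is a nonnegative $u\in C^2([0,\infty))$ with $u_r(0)=0$ solving (E) on $(0,\infty)$. Let $K=\frac{(N-2)p-N}{p-1}$ (negative here), $\mu^*=(p+1)\left(\frac{N-(N-2)p}{2p}\right)^{\frac{p}{p+1}}$, and $\overline M=\frac{(p+1)((N-2)p-N-2)}{(4p)^{\frac{p}{p+1}}((N-2)(p-1)^2+4)^{\frac{1}{p+1}}}$ (one has $\overline M<-\mu^*$). For $M<-\mu^*$ the equation $X^{p-1}+M\left(\frac{2}{p-1}\right)^{\frac{2p}{p+1}}X^{\frac{p-1}{p+1}}-\frac{2K}{p-1}=0$ has exactly two positive roots $X_{1,M}<X_{2,M}$; set $U_{j,M}(r)=X_{j,M}r^{-\frac{2}{p-1}}$. $f\sim g$ means $f/g\to1$. A singular solution is one that does not extend as a $C^2$ solution with $u_r(0)=0$ at $r=0$.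
   Formalization: A ground state is additionally required to be not identically zero; otherwise u = 0, which is nonnegative, C², has u_r(0) = 0 and solves (E), would be a ground state and part (i) would be false. *)

theory Defs
  imports "HOL-Analysis.Analysis" "HOL-Library.Landau_Symbols"
begin

definition E_rhs :: "real \<Rightarrow> real \<Rightarrow> real \<Rightarrow> real \<Rightarrow> real" where
  "E_rhs p M v dv = \<bar>v\<bar> powr (p - 1) * v + M * \<bar>dv\<bar> powr (2 * p / (p + 1))"

definition solves_E :: "nat \<Rightarrow> real \<Rightarrow> real \<Rightarrow> (real \<Rightarrow> real) \<Rightarrow> bool" where
  "solves_E N p M u \<longleftrightarrow>
     (\<exists>u' u''. continuous_on {0<..} u'' \<and>
        (\<forall>r>0. (u has_real_derivative u' r) (at r) \<and>
               (u' has_real_derivative u'' r) (at r) \<and>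
               - u'' r - (real N - 1) / r * u' r = E_rhs p M (u r) (u' r)))"

definition regular_solution_E :: "nat \<Rightarrow> real \<Rightarrow> real \<Rightarrow> (real \<Rightarrow> real) \<Rightarrow> bool" where
  "regular_solution_E N p M v \<longleftrightarrow>
     (\<exists>v' v''. continuous_on {0..} v'' \<and> v' 0 = 0 \<and>
        (\<forall>r\<ge>0. (v has_real_derivative v' r) (at r within {0..}) \<and>
               (v' has_real_derivative v'' r) (at r within {0..})) \<and>
        (\<forall>r>0. - v'' r - (real N - 1) / r * v' r = E_rhs p M (v r) (v' r)))"

definition ground_state :: "nat \<Rightarrow> real \<Rightarrow> real \<Rightarrow> (real \<Rightarrow> real) \<Rightarrow> bool" where
  "ground_state N p M u \<longleftrightarrow> regular_solution_E N p M u \<and> (\<forall>r\<ge>0. u r \<ge> 0) \<and> (\<exists>r\<ge>0. u r \<noteq> 0)"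

definition singular_solution_E :: "nat \<Rightarrow> real \<Rightarrow> real \<Rightarrow> (real \<Rightarrow> real) \<Rightarrow> bool" where
  "singular_solution_E N p M u \<longleftrightarrow> solves_E N p M u \<and>
     \<not> (\<exists>v. regular_solution_E N p M v \<and> (\<forall>r>0. v r = u r))"

definition K_const :: "nat \<Rightarrow> real \<Rightarrow> real" where
  "K_const N p = ((real N - 2) * p - real N) / (p - 1)"

definition mu_star :: "nat \<Rightarrow> real \<Rightarrow> real" where
  "mu_star N p = (p + 1) * ((real N - (real N - 2) * p) / (2 * p)) powr (p / (p + 1))"

definition M_bar :: "nat \<Rightarrow> real \<Rightarrow> real" where
  "M_bar N p = (p + 1) * ((real N - 2) * p - real N - 2) /
      ((4 * p) powr (p / (p + 1)) * ((real N - 2) * (p - 1)^2 + 4) powr (1 / (p + 1)))"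

definition X_roots :: "nat \<Rightarrow> real \<Rightarrow> real \<Rightarrow> real set" where
  "X_roots N p M = {X. X > 0 \<and>
     X powr (p - 1) + M * (2 / (p - 1)) powr (2 * p / (p + 1)) * X powr ((p - 1) / (p + 1))
       - 2 * K_const N p / (p - 1) = 0}"

definition X1 :: "nat \<Rightarrow> real \<Rightarrow> real \<Rightarrow> real" where
  "X1 N p M = Min (X_roots N p M)"

definition X2 :: "nat \<Rightarrow> real \<Rightarrow> real \<Rightarrow> real" where
  "X2 N p M = Max (X_roots N p M)"

definition U1 :: "nat \<Rightarrow> real \<Rightarrow> real \<Rightarrow> real \<Rightarrow> real" where
  "U1 N p M r = X1 N p M * r powr (- 2 / (p - 1))"

definition U2 :: "nat \<Rightarrow> real \<Rightarrow> real \<Rightarrow> real \<Rightarrow> real" where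
  "U2 N p M r = X2 N p M * r powr (- 2 / (p - 1))"

end

theory Submission
  imports Defs
begin

text \<open>
  In the variables \<open>\<xi> = ln (r\<^sup>a u)\<close>, \<open>S = - r u' / u\<close> with \<open>a = 2 / (p - 1)\<close> and \<open>t = ln r\<close>, the scaling
  invariant equation is an autonomous planar system with \<open>\<xi>' = a - S\<close>, and \<open>U\<^sub>1\<close>, \<open>U\<^sub>2\<close> are its saddle and
  its source. The condition \<open>M_bar \<le> M\<close> is, by weighted AM-GM, exactly what gives a Dulac
  factor \<open>S\<^sup>\<beta> exp (c \<xi>)\<close> of nonnegative divergence. Since \<open>\<xi>' = a - S\<close> depends on \<open>S\<close> only, integrating
  the factor in \<open>S\<close> turns it into a strictly increasing energy, whose potential has a local maximum at
  the saddle and a local minimum at the source; this replaces Poincare-Bendixson theory.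

  A ground state would start below a barrier \<open>(u')\<^sup>2 = k u powr (p + 1)\<close>, hence pass over the saddle, turn
  back with more energy than the saddle has, and reach \<open>u = 0\<close> at a finite radius. For the singular
  solution, orbits issuing backwards from points \<open>(\<xi>, a)\<close> just to the right of the saddle stay in a
  compact sublevel set and converge to the source; a limit of them is the stable branch of the saddle.
  Two such branches agree, because the energy difference of two graphs over \<open>\<xi>\<close> is monotone.
\<close>

section \<open>Ordinary differential equations\<close>

text \<open>The factor comes from killing one term of the divergence and balancing the rest. The
  choice of \<open>c\<close> removes the term in \<open>S powr \<beta>\<close>. Divided by
  \<open>S powr (\<beta> - 1)\<close>, what remains is a combination of \<open>S\<^sup>2\<close>,
  \<open>Z = exp ((p - 1) * \<xi>)\<close> and \<open>S powr q * Z powr (1 / (p + 1))\<close>. As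
  \<open>q = 2 * p / (p + 1)\<close>, the third is a weighted geometric mean of the first two, which
  can therefore absorb its negative coefficient. At the extreme value of \<open>M\<close> equality
  occurs for a single \<open>S\<close> over each \<xi>, so the energy stays strictly monotone off
  \<open>S = a\<close>.

  The obstacle is the saddle. Energy alone does not forbid a regular solution from running into it
  from the left: the energy could rise exactly to the level of the saddle. The barrier excludes
  this. When both equilibria merge, the barrier passes through the equilibrium itself, and a
  comparison based on the double zero of \<open>f\<close> takes over.\<close>

lemma has_vector_derivative_reflect:
  fixes x :: "real \<Rightarrow> 'a::real_normed_vector"
  assumes "(x has_vector_derivative d) (at (- s))"
  shows "((\<lambda>s. x (- s)) has_vector_derivative - d) (at s)"
proof -
  have "DERIV (\<lambda>s. - s) s :> - 1"
    by (auto intro!: derivative_eq_intros)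
  then have "((\<lambda>s. - s) has_vector_derivative - 1) (at s)"
    by (simp add: has_real_derivative_iff_has_vector_derivative)
  from vector_diff_chain_at[OF this assms] show ?thesis by (simp add: o_def)
qed

text \<open>For negative \<open>t\<close> the interval \<open>{0..t}\<close> is empty and its
  integral 0; the second branch restores the oriented integral, so that one primitive serves both
  time directions.\<close>

definition signed_integral :: "(real \<Rightarrow> 'a::banach) \<Rightarrow> real \<Rightarrow> 'a" where
  "signed_integral g t = (if 0 \<le> t then integral {0..t} g else - integral {t..0} g)"

lemma signed_integral_has_vector_derivative:
  fixes g :: "real \<Rightarrow> 'a::banach"
  assumes "continuous_on UNIV g"
  shows "(signed_integral g has_vector_derivative g t) (at t)"
proof -
  \<comment> \<open>The base point is moved from 0 to \<open>-c\<close>, left of both 0 and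
    \<open>t\<close>; near \<open>t\<close> the two primitives differ by a constant.\<close>
  define c where "c = \<bar>t\<bar> + 1"
  have int: "g integrable_on {u..v}" for u v
    using assms by (intro integrable_continuous_real) (auto intro: continuous_on_subset)
  have eq: "signed_integral g s = integral {-c..s} g - integral {-c..0} g" if "s \<in> {-c<..<c}" for s
  proof (cases "0 \<le> s")
    case True
    then show ?thesis
      using Henstock_Kurzweil_Integration.integral_combine[of "-c" 0 s g] int that
      by (auto simp: signed_integral_def c_def algebra_simps)
  next
    case False
    then show ?thesis
      using Henstock_Kurzweil_Integration.integral_combine[of "-c" s 0 g] int that
      by (auto simp: signed_integral_def c_def algebra_simps)
  qed
  have "((\<lambda>s. integral {-c..s} g) has_vector_derivative g t) (at t within {-c..c})"
    using assms by (intro integral_has_vector_derivative) (auto simp: c_def intro: continuous_on_subset)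
  then have "((\<lambda>s. integral {-c..s} g) has_vector_derivative g t) (at t)"
    by (subst (asm) at_within_interior) (auto simp: c_def)
  then have "((\<lambda>s. integral {-c..s} g - integral {-c..0} g) has_vector_derivative g t) (at t)"
    by (auto intro!: derivative_eq_intros)
  then show ?thesis
    by (rule has_vector_derivative_transform_within_open[where S="{-c<..<c}"])
       (use eq in \<open>auto simp: c_def\<close>)
qed

text \<open>Integrating the exponential gains the factor \<open>1 / k\<close>. This gain makes the
  Picard map a contraction in a weighted norm.\<close>

lemma norm_le_exp_of_derivative_le_exp:
  fixes J :: "real \<Rightarrow> 'a::real_normed_vector"
  assumes J: "\<And>t. (J has_vector_derivative j t) (at t)" and J0: "J 0 = 0"
    and bd: "\<And>t. norm (j t) \<le> B * exp (k * \<bar>t\<bar>)" and k: "0 < k"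
  shows "norm (J t) \<le> B / k * exp (k * \<bar>t\<bar>)"
proof -
  have main: "norm (J t) \<le> B / k * exp (k * t)"
    if J: "\<And>t. (J has_vector_derivative j t) (at t)" and J0: "J 0 = 0"
      and bd: "\<And>t. norm (j t) \<le> B * exp (k * \<bar>t\<bar>)" and t: "0 < t"
    for J j :: "real \<Rightarrow> 'a" and t
  proof -
    have B0: "0 \<le> B" using order.trans[OF norm_ge_zero bd[of 0]] by simp
    have "norm (J t - J 0) \<le> B / k * exp (k * t) - B / k * exp (k * 0)"
    proof (rule differentiable_bound_general[of 0 t J "\<lambda>t. B / k * exp (k * t)" j "\<lambda>t. B * exp (k * t)"])
      show "continuous_on {0..t} J"
        using J by (meson continuous_at_imp_continuous_on has_vector_derivative_continuous)
      show "continuous_on {0..t} (\<lambda>t. B / k * exp (k * t))"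
        by (intro continuous_intros)
      show "((\<lambda>t. B / k * exp (k * t)) has_vector_derivative B * exp (k * x)) (at x)" for x
        unfolding has_real_derivative_iff_has_vector_derivative[symmetric]
        using k by (auto intro!: derivative_eq_intros)
      show "norm (j x) \<le> B * exp (k * x)" if "0 < x" "x < t" for x
        using bd[of x] that by simp
    qed (use t J in auto)
    moreover have "0 \<le> B / k" using B0 k by simp
    ultimately show ?thesis using J0 by simp
  qed
  consider "t = 0" | "0 < t" | "t < 0" by linarith
  then show ?thesis
  proof cases
    case 1
    have "0 \<le> B" using order.trans[OF norm_ge_zero bd[of 0]] by simp
    then show ?thesis using 1 J0 k by simp
  next
    case 2
    then show ?thesis using main[OF J J0 bd 2] by simp
  next
    case 3
    have d: "((\<lambda>t. J (- t)) has_vector_derivative - j (- t)) (at t)" for t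
      by (intro has_vector_derivative_reflect J)
    have "norm (J (- (- t))) \<le> B / k * exp (k * (- t))"
      by (rule main[OF d]) (use 3 J0 bd[of "- x" for x] in auto)
    then show ?thesis using 3 by simp
  qed
qed

text \<open>Picard iteration in a norm weighted by \<open>exp (- k * \<bar>t\<bar>)\<close>.
  Unknowns are written as \<open>z0\<close> plus the weight's inverse times a bounded continuous
  function, so the iteration contracts on the whole line at once and no local solutions have to be
  glued.\<close>

lemma lipschitz_ode_solution:
  fixes V :: "'a::euclidean_space \<Rightarrow> 'a"
  assumes V: "L-lipschitz_on UNIV V"
  obtains z where "z 0 = z0" and "\<And>t. (z has_vector_derivative V (z t)) (at t)"
proof -
  have L: "0 \<le> L" using V by (rule lipschitz_on_nonneg)
  \<comment> \<open>This makes the contraction ratio \<open>L / k\<close> at most 1/2 and keeps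
    \<open>k\<close> positive when \<open>L = 0\<close>.\<close>
  define k where "k = 2 * L + 1"
  have k: "0 < k" "L / k \<le> 1 / 2" using L by (auto simp: k_def field_simps)
  have cV: "continuous_on X V" for X
    using lipschitz_on_continuous_on[OF V] by (rule continuous_on_subset) simp
  define w where "w b s = z0 + exp (k * \<bar>s\<bar>) *\<^sub>R apply_bcontfun b s" for b and s :: real
  have cw: "continuous_on UNIV (\<lambda>s. V (w b s))" for b
    unfolding w_def by (intro continuous_on_compose2[OF cV[of UNIV]] continuous_intros) auto
  define J where "J b = signed_integral (\<lambda>s. V (w b s))" for b
  have dJ: "(J b has_vector_derivative V (w b t)) (at t)" for b t
    unfolding J_def by (rule signed_integral_has_vector_derivative[OF cw])
  have J0: "J b 0 = 0" for b by (simp add: J_def signed_integral_def)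
  have e1: "1 \<le> exp (k * \<bar>t\<bar>)" for t :: real using k by simp
  have Vb: "norm (V (w b t)) \<le> (norm (V z0) + L * norm b) * exp (k * \<bar>t\<bar>)" for b t
  proof -
    have "norm (V (w b t) - V z0) \<le> L * norm (w b t - z0)"
      using lipschitz_on_normD[OF V] by auto
    also have "\<dots> \<le> L * (exp (k * \<bar>t\<bar>) * norm b)"
      using L by (intro mult_left_mono) (auto simp: w_def norm_bounded)
    finally have "norm (V (w b t) - V z0) \<le> L * norm b * exp (k * \<bar>t\<bar>)"
      by (simp add: mult_ac)
    moreover have "norm (V z0) \<le> norm (V z0) * exp (k * \<bar>t\<bar>)"
      using mult_left_mono[OF e1[of t] norm_ge_zero[of "V z0"]] by simp
    ultimately show ?thesis
      using norm_triangle_ineq2[of "V (w b t)" "V z0"] by (simp add: algebra_simps)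
  qed
  define T where "T b = Bcontfun (\<lambda>t. exp (- k * \<bar>t\<bar>) *\<^sub>R J b t)" for b
  have Tin: "(\<lambda>t. exp (- k * \<bar>t\<bar>) *\<^sub>R J b t) \<in> bcontfun" for b
  proof (rule bcontfun_normI)
    have "continuous_on UNIV (J b)"
      using dJ by (meson continuous_at_imp_continuous_on has_vector_derivative_continuous)
    then show "continuous_on UNIV (\<lambda>t. exp (- k * \<bar>t\<bar>) *\<^sub>R J b t)"
      by (intro continuous_intros)
    fix t
    show "norm (exp (- k * \<bar>t\<bar>) *\<^sub>R J b t) \<le> (norm (V z0) + L * norm b) / k"
      using norm_le_exp_of_derivative_le_exp[OF dJ J0 Vb k(1), of b t]
      by (simp add: exp_minus field_simps)
  qed
  have Tapp: "apply_bcontfun (T b) t = exp (- k * \<bar>t\<bar>) *\<^sub>R J b t" for b t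
    using Tin by (simp add: T_def Bcontfun_inverse)
  have contr: "dist (T b) (T b') \<le> 1 / 2 * dist b b'" for b b'
  proof (rule dist_bound)
    fix t
    have d: "((\<lambda>t. J b t - J b' t) has_vector_derivative V (w b t) - V (w b' t)) (at t)" for t
      by (intro derivative_intros dJ)
    have "norm (J b t - J b' t) \<le> (L * dist b b') / k * exp (k * \<bar>t\<bar>)"
    proof (rule norm_le_exp_of_derivative_le_exp[OF d])
      fix t
      have "norm (V (w b t) - V (w b' t)) \<le> L * norm (w b t - w b' t)"
        using lipschitz_on_normD[OF V] by auto
      also have "\<dots> \<le> L * (exp (k * \<bar>t\<bar>) * dist b b')"
      proof (intro mult_left_mono L)
        have "w b t - w b' t = exp (k * \<bar>t\<bar>) *\<^sub>R (apply_bcontfun b t - apply_bcontfun b' t)"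
          by (simp add: w_def scaleR_diff_right)
        then show "norm (w b t - w b' t) \<le> exp (k * \<bar>t\<bar>) * dist b b'"
          using dist_bounded[of b t b'] by (simp add: dist_norm)
      qed
      finally show "norm (V (w b t) - V (w b' t)) \<le> (L * dist b b') * exp (k * \<bar>t\<bar>)"
        by (simp add: mult_ac)
    qed (use J0 k in auto)
    also have "\<dots> \<le> 1 / 2 * dist b b' * exp (k * \<bar>t\<bar>)"
      using mult_right_mono[OF k(2), of "dist b b' * exp (k * \<bar>t\<bar>)"] by (simp add: mult_ac)
    finally have "exp (- k * \<bar>t\<bar>) * norm (J b t - J b' t)
        \<le> exp (- k * \<bar>t\<bar>) * (1 / 2 * dist b b' * exp (k * \<bar>t\<bar>))"
      by (rule mult_left_mono) simp
    also have "\<dots> = 1 / 2 * dist b b'"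
      by (simp add: exp_minus)
    finally show "dist (apply_bcontfun (T b) t) (apply_bcontfun (T b') t) \<le> 1 / 2 * dist b b'"
      by (simp add: Tapp dist_norm flip: scaleR_diff_right)
  qed
  obtain b where b: "T b = b"
    using banach_fix_type[of "1/2" T] contr by auto
  have "w b t = z0 + J b t" for t
  proof -
    have "apply_bcontfun b t = exp (- k * \<bar>t\<bar>) *\<^sub>R J b t" using Tapp[of b t] b by simp
    then show ?thesis by (simp add: w_def flip: exp_add)
  qed
  then have weq: "w b = (\<lambda>t. z0 + J b t)" by auto
  show ?thesis
  proof (rule that[of "w b"])
    show "w b 0 = z0" by (simp add: weq J0)
    show "(w b has_vector_derivative V (w b t)) (at t)" for t
      using dJ[of b t] by (subst weq) (auto intro!: derivative_eq_intros)
  qed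
qed

lemma has_real_derivative_inner_self:
  fixes e :: "real \<Rightarrow> 'a::real_inner"
  assumes "(e has_vector_derivative d) (at s)"
  shows "DERIV (\<lambda>s. e s \<bullet> e s) s :> 2 * (e s \<bullet> d)"
proof -
  have "((\<lambda>s. e s \<bullet> e s) has_derivative (\<lambda>x. e s \<bullet> (x *\<^sub>R d) + (x *\<^sub>R d) \<bullet> e s)) (at s)"
    using assms unfolding has_vector_derivative_def by (intro has_derivative_inner)
  moreover have "(\<lambda>x. e s \<bullet> (x *\<^sub>R d) + (x *\<^sub>R d) \<bullet> e s) = (*) (2 * (e s \<bullet> d))"
    by (auto simp: inner_commute)
  ultimately show ?thesis by (simp add: has_field_derivative_def)
qed

text \<open>By Cauchy-Schwarz the squared distance times \<open>exp (- 2 * L * s)\<close> is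
  nonincreasing. The Lipschitz bound is asked only on a set containing both curves, so that locally
  Lipschitz fields are covered.\<close>

lemma lipschitz_ode_dependence_forward:
  fixes V :: "'a::euclidean_space \<Rightarrow> 'a"
  assumes V: "L-lipschitz_on X V" and t: "0 \<le> t"
    and y: "\<And>s. s \<in> {0..t} \<Longrightarrow> (y has_vector_derivative V (y s)) (at s)" "\<And>s. s \<in> {0..t} \<Longrightarrow> y s \<in> X"
    and z: "\<And>s. s \<in> {0..t} \<Longrightarrow> (z has_vector_derivative V (z s)) (at s)" "\<And>s. s \<in> {0..t} \<Longrightarrow> z s \<in> X"
  shows "norm (y t - z t) \<le> exp (L * t) * norm (y 0 - z 0)"
proof -
  define n where "n s = (y s - z s) \<bullet> (y s - z s) * exp (- 2 * L * s)" for s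
  have dn: "\<exists>d. DERIV n s :> d \<and> d \<le> 0" if s: "0 \<le> s" "s \<le> t" for s
  proof -
    have "((\<lambda>s. y s - z s) has_vector_derivative V (y s) - V (z s)) (at s)"
      using s by (intro derivative_intros y z) auto
    then have dd: "DERIV (\<lambda>s. (y s - z s) \<bullet> (y s - z s)) s :>
        2 * ((y s - z s) \<bullet> (V (y s) - V (z s)))"
      by (rule has_real_derivative_inner_self)
    have "DERIV (\<lambda>s. exp (- 2 * L * s)) s :> - 2 * L * exp (- 2 * L * s)"
      by (auto intro!: derivative_eq_intros)
    from DERIV_mult[OF dd this] have d: "DERIV n s :> (2 * ((y s - z s) \<bullet> (V (y s) - V (z s)))
        - 2 * L * ((y s - z s) \<bullet> (y s - z s))) * exp (- 2 * L * s)"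
      unfolding n_def by (rule DERIV_cong) (simp add: algebra_simps)
    have "(y s - z s) \<bullet> (V (y s) - V (z s)) \<le> norm (y s - z s) * norm (V (y s) - V (z s))"
      by (rule norm_cauchy_schwarz)
    also have "\<dots> \<le> norm (y s - z s) * (L * norm (y s - z s))"
      using lipschitz_on_normD[OF V] y(2) z(2) s by (intro mult_left_mono) auto
    finally have "(y s - z s) \<bullet> (V (y s) - V (z s)) \<le> L * ((y s - z s) \<bullet> (y s - z s))"
      by (simp add: dot_square_norm power2_eq_square mult_ac)
    then have "2 * ((y s - z s) \<bullet> (V (y s) - V (z s))) - 2 * L * ((y s - z s) \<bullet> (y s - z s)) \<le> 0"
      by simp
    with d show ?thesis by (meson mult_nonpos_nonneg exp_ge_zero)
  qed
  have "n t \<le> n 0" using DERIV_nonpos_imp_nonincreasing[of 0 t n] dn t by blast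
  then have "(norm (y t - z t))\<^sup>2 * exp (- 2 * L * t) \<le> (norm (y 0 - z 0))\<^sup>2"
    by (simp add: n_def dot_square_norm)
  then have "(norm (y t - z t))\<^sup>2 \<le> (norm (y 0 - z 0))\<^sup>2 * exp (2 * L * t)"
    by (simp add: exp_minus field_simps)
  also have "exp (2 * L * t) = (exp (L * t))\<^sup>2" by (simp add: power2_eq_square flip: exp_add)
  finally have "(norm (y t - z t))\<^sup>2 \<le> (exp (L * t) * norm (y 0 - z 0))\<^sup>2"
    by (simp add: power_mult_distrib mult_ac)
  then show ?thesis by (rule power2_le_imp_le) simp
qed

lemma lipschitz_ode_dependence:
  fixes V :: "'a::euclidean_space \<Rightarrow> 'a"
  assumes V: "L-lipschitz_on X V"
    and y: "\<And>s. \<bar>s\<bar> \<le> \<bar>t\<bar> \<Longrightarrow> (y has_vector_derivative V (y s)) (at s)" "\<And>s. \<bar>s\<bar> \<le> \<bar>t\<bar> \<Longrightarrow> y s \<in> X"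
    and z: "\<And>s. \<bar>s\<bar> \<le> \<bar>t\<bar> \<Longrightarrow> (z has_vector_derivative V (z s)) (at s)" "\<And>s. \<bar>s\<bar> \<le> \<bar>t\<bar> \<Longrightarrow> z s \<in> X"
  shows "norm (y t - z t) \<le> exp (L * \<bar>t\<bar>) * norm (y 0 - z 0)"
proof (cases "0 \<le> t")
  case True
  then show ?thesis using lipschitz_ode_dependence_forward[OF V True, of y z] y z by auto
next
  case False
  have V': "L-lipschitz_on X (\<lambda>x. - V x)" using V by simp
  have "norm (y (- (- t)) - z (- (- t))) \<le> exp (L * (- t)) * norm (y (- 0) - z (- 0))"
    by (rule lipschitz_ode_dependence_forward[OF V']) (use False y z in \<open>auto intro!: has_vector_derivative_reflect\<close>)
  then show ?thesis using False by simp
qed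

text \<open>On windows of fixed length \<open>h\<close> the increment of \<open>g\<close> tends to
  0, so by the mean value theorem \<open>g'\<close> is small somewhere in each window; uniform
  continuity carries this to the left end of the window.\<close>

lemma barbalat:
  fixes g g' :: "real \<Rightarrow> real"
  assumes d: "\<And>t. t \<ge> t0 \<Longrightarrow> DERIV g t :> g' t"
    and lim: "(g \<longlongrightarrow> l) at_top" and uc: "uniformly_continuous_on {t0..} g'"
  shows "(g' \<longlongrightarrow> 0) at_top"
proof (rule tendstoI)
  fix e :: real assume e: "0 < e"
  obtain \<delta> where \<delta>: "\<delta> > 0" "\<And>s t. s \<ge> t0 \<Longrightarrow> t \<ge> t0 \<Longrightarrow> dist s t < \<delta> \<Longrightarrow> dist (g' s) (g' t) < e / 2"
    using uc e unfolding uniformly_continuous_on_def by (metis atLeast_iff half_gt_zero)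
  define h where "h = \<delta> / 2"
  have h: "0 < h" "h < \<delta>" using \<delta>(1) by (auto simp: h_def)
  have "((\<lambda>t. g (t + h) - g t) \<longlongrightarrow> l - l) at_top"
    by (intro tendsto_diff lim filterlim_compose[OF lim] filterlim_at_top_mono[OF filterlim_ident])
       (use h in auto)
  then have "\<forall>\<^sub>F t in at_top. dist (g (t + h) - g t) 0 < e / 2 * h"
    using tendstoD[of "\<lambda>t. g (t + h) - g t" "l - l" at_top "e / 2 * h"] e h by simp
  with eventually_ge_at_top[of t0] show "\<forall>\<^sub>F t in at_top. dist (g' t) 0 < e"
  proof eventually_elim
    case (elim t)
    obtain s where s: "t < s" "s < t + h" "g (t + h) - g t = (t + h - t) * g' s"
      using MVT2[of t "t + h" g g'] d elim h by auto
    then have "\<bar>g' s\<bar> * h < e / 2 * h" using elim h by (simp add: abs_mult mult.commute)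
    then have "\<bar>g' s\<bar> < e / 2" using h by simp
    moreover have "dist (g' s) (g' t) < e / 2"
      using \<delta>(2)[of s t] s elim h by (auto simp: dist_real_def)
    ultimately show ?case unfolding dist_real_def by linarith
  qed
qed

text \<open>Stands in for an invariance principle: away from the zeros of \<open>h\<close>,
  compactness gives \<open>\<bar>g\<bar>\<close> a positive minimum, so a curve along which
  \<open>g\<close> tends to 0 must leave that set.\<close>

lemma tendsto_zero_of_compact:
  fixes z :: "'b \<Rightarrow> 'a::metric_space" and g h :: "'a \<Rightarrow> real"
  assumes K: "compact K" and cont: "continuous_on K g" "continuous_on K h"
    and zero: "\<And>x. x \<in> K \<Longrightarrow> g x = 0 \<Longrightarrow> h x = 0"
    and zK: "\<forall>\<^sub>F t in F. z t \<in> K" and lim: "((\<lambda>t. g (z t)) \<longlongrightarrow> 0) F"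
  shows "((\<lambda>t. h (z t)) \<longlongrightarrow> 0) F"
proof (rule tendstoI)
  fix e :: real assume e: "0 < e"
  define C where "C = {x \<in> K. e \<le> \<bar>h x\<bar>}"
  have "compact C"
  proof -
    have "closedin (top_of_set K) (K \<inter> (\<lambda>x. \<bar>h x\<bar>) -` {e..})"
      by (intro continuous_closedin_preimage continuous_intros cont)
    moreover have "K \<inter> (\<lambda>x. \<bar>h x\<bar>) -` {e..} = C" by (auto simp: C_def)
    ultimately show ?thesis using K closedin_compact by metis
  qed
  show "\<forall>\<^sub>F t in F. dist (h (z t)) 0 < e"
  proof (cases "C = {}")
    case True
    then show ?thesis using zK by (auto simp: C_def not_le elim!: eventually_mono)
  next
    case False
    have "continuous_on C (\<lambda>x. \<bar>g x\<bar>)"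
      by (intro continuous_intros continuous_on_subset[OF cont(1)]) (auto simp: C_def)
    then obtain m where m: "m \<in> C" "\<And>x. x \<in> C \<Longrightarrow> \<bar>g m\<bar> \<le> \<bar>g x\<bar>"
      using continuous_attains_inf[OF \<open>compact C\<close> False] by blast
    have "g m \<noteq> 0" using m(1) zero e by (auto simp: C_def)
    then have "\<forall>\<^sub>F t in F. dist (g (z t)) 0 < \<bar>g m\<bar>"
      using lim by (intro tendstoD) auto
    with zK show ?thesis
    proof eventually_elim
      case (elim t)
      then have "z t \<notin> C" using m(2)[of "z t"] by auto
      with elim show ?case by (auto simp: C_def)
    qed
  qed
qed

section \<open>The energy\<close>

text \<open>The bound \<open>ln y \<le> y - 1\<close> is applied to the quotients of
  \<open>x\<close> and \<open>y\<close> by their geometric mean; it is strict for at least one of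
  them, as they are not both 1.\<close>

lemma strict_weighted_AM_GM:
  fixes x y \<alpha> \<beta> :: real
  assumes ab: "0 < \<alpha>" "0 < \<beta>" "\<alpha> + \<beta> = 1" and xy: "0 < x" "0 < y" "x \<noteq> y"
  shows "x powr \<alpha> * y powr \<beta> < \<alpha> * x + \<beta> * y"
proof -
  define g where "g = x powr \<alpha> * y powr \<beta>"
  have g: "0 < g" using xy by (simp add: g_def)
  have lng: "ln g = \<alpha> * ln x + \<beta> * ln y"
    using xy by (simp add: g_def ln_mult ln_powr)
  have lnx: "ln (x / g) = ln x - ln g" and lny: "ln (y / g) = ln y - ln g"
    using xy g by (simp_all add: ln_div)
  have sum0: "\<alpha> * ln (x / g) + \<beta> * ln (y / g) = 0"
  proof -
    have "\<alpha> * ln (x / g) + \<beta> * ln (y / g) = ln g - (\<alpha> + \<beta>) * ln g"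
      unfolding lnx lny lng by (simp add: algebra_simps)
    then show ?thesis using ab by simp
  qed
  have le: "ln (x / g) \<le> x / g - 1" "ln (y / g) \<le> y / g - 1"
    using xy g by (auto intro!: ln_le_minus_one)
  have "x / g \<noteq> 1 \<or> y / g \<noteq> 1" using xy by auto
  then have "ln (x / g) < x / g - 1 \<or> ln (y / g) < y / g - 1"
    using ln_eq_minus_one[of "x / g"] ln_eq_minus_one[of "y / g"] le xy g
    by (meson divide_pos_pos order_le_less)
  then have "\<alpha> * ln (x / g) + \<beta> * ln (y / g) < \<alpha> * (x / g - 1) + \<beta> * (y / g - 1)"
    using ab le
    by (metis add_le_less_mono add_less_le_mono mult_le_cancel_left_pos mult_less_cancel_left_pos)
  then have "\<alpha> + \<beta> < (\<alpha> * x + \<beta> * y) / g"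
    using sum0 by (simp add: algebra_simps add_divide_distrib)
  then show ?thesis using ab g by (simp add: g_def field_simps)
qed

lemma continuous_on_powr_pos:
  fixes e :: real
  assumes "\<And>x. x \<in> X \<Longrightarrow> 0 \<le> x" "0 < e"
  shows "continuous_on X (\<lambda>x. x powr e)"
  by (rule continuous_on_powr'[OF continuous_on_id continuous_on_const]) (use assms in auto)

section \<open>Parameters and the Dulac inequality\<close>

locale emden_fowler =
  fixes n p M :: real
  assumes p: "1 < p" and n: "2 < n" and np: "(n - 2) * (p - 1) < 2" and M_nonpos: "M \<le> 0"
    and M_ge: "(p + 1) * ((n - 2) * p - n - 2) /
      ((4 * p) powr (p / (p + 1)) * ((n - 2) * (p - 1)\<^sup>2 + 4) powr (1 / (p + 1))) \<le> M"
begin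

definition "a = 2 / (p - 1)"
definition "q = 2 * p / (p + 1)"
definition "\<kappa> = a + 2 - n"
text \<open>A normalised exponent: \<theta> < 1 means \<open>p < n / (n - 2)\<close>, whereas
  \<theta> < 2 would be the Sobolev range \<open>p < (n + 2) / (n - 2)\<close>.\<close>

definition "\<theta> = (n - 2) * (p - 1) / 2"
text \<open>This weight maximises the constant in \<open>damping\<close>, which is then exactly the bound on \<open>M\<close> above.\<close>
definition "\<beta> = 2 * (2 - \<theta>) / ((p + 1) * \<theta>)"
text \<open>The value for which the terms in \<open>S powr \<beta>\<close> of the divergence cancel,
  that is \<open>c * a = (\<beta> + 1) * (n - 2)\<close>; \<open>A\<close> is then the coefficient
  left at \<open>S powr (\<beta> + 1)\<close>.\<close>

definition "c = (\<beta> + 1) * \<theta>"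
definition "A = \<beta> + 2 - c"

lemma theta: "0 < \<theta>" "\<theta> < 1"
  using p n np by (auto simp: \<theta>_def)

lemma a_pos: "0 < a" using p by (simp add: a_def)

lemma n_eq: "n - 2 = a * \<theta>"
  using p by (simp add: a_def \<theta>_def field_simps)

lemma kappa_eq: "\<kappa> = a * (1 - \<theta>)"
  using n_eq by (simp add: \<kappa>_def algebra_simps)

lemma kappa_pos: "0 < \<kappa>"
  using a_pos theta by (simp add: kappa_eq)

lemma q_bounds: "1 < q" "q < 2" "0 < q - 1"
  using p by (auto simp: q_def field_simps)

lemma q_minus_1: "q - 1 = (p - 1) / (p + 1)"
  using p by (simp add: q_def field_simps)

lemma a_p: "a * (p - 1) = 2"
  using p by (simp add: a_def field_simps)

lemma a_q: "a * (q - 1) + q = 2"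
proof -
  have "a * (q - 1) = 2 / (p + 1)"
    using p unfolding q_minus_1 a_def by (auto simp: divide_simps)
  moreover have "2 / (p + 1) + 2 * p / (p + 1) = (2 + 2 * p) / (p + 1)"
    by (simp add: add_divide_distrib)
  moreover have "\<dots> = 2" using p by (simp add: field_simps)
  ultimately show ?thesis by (simp add: q_def)
qed

lemma beta_pos: "0 < \<beta>"
  using theta p by (simp add: \<beta>_def)

lemma c_pos: "0 < c"
  using theta beta_pos by (simp add: c_def)

lemma ca: "c * a = (\<beta> + 1) * (n - 2)"
  by (simp add: c_def n_eq)

text \<open>Both coefficients of the damping inequality turn out to be multiples of
  \<open>q + \<beta>\<close>, which is also the coefficient of the mixed term. The common factor
  then drops out and leaves a bound on \<open>M\<close> in terms of \<open>p\<close> and \<theta>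
  alone. Multiplying by \<open>(p + 1) * \<theta>\<close> clears the denominator of \<beta>.\<close>

lemma
  shows A_ratio: "A = (2 - \<theta>) / 2 * (q + \<beta>)"
    and beta_ratio: "\<beta> = (2 - \<theta>) / (2 + (p - 1) * \<theta>) * (q + \<beta>)"
proof -
  define m where "m = (p + 1) * \<theta>"
  have m: "m \<noteq> 0" using theta p by (simp add: m_def)
  have bm: "\<beta> * m = 2 * (2 - \<theta>)" using m by (simp add: \<beta>_def m_def)
  have qm: "q * m = 2 * p * \<theta>" using p by (simp add: q_def m_def)
  have qbm: "(q + \<beta>) * m = 2 * (2 + (p - 1) * \<theta>)"
    unfolding distrib_right bm qm by (simp add: algebra_simps)
  have "A * m = \<beta> * m + 2 * m - (\<beta> * m + m) * \<theta>"
    by (simp add: A_def c_def algebra_simps)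
  also have "\<dots> = (2 - \<theta>) * (2 + (p - 1) * \<theta>)"
    unfolding bm by (simp add: m_def algebra_simps)
  also have "\<dots> = (2 - \<theta>) / 2 * ((q + \<beta>) * m)"
    unfolding qbm by simp
  finally have "A * m = ((2 - \<theta>) / 2 * (q + \<beta>)) * m" by (simp only: mult.assoc)
  then show "A = (2 - \<theta>) / 2 * (q + \<beta>)" using m by (simp only: mult_cancel_right) simp
  define X where "X = 2 + (p - 1) * \<theta>"
  have "0 < X" using theta p by (simp add: add_pos_pos X_def)
  then have "\<beta> * m = (2 - \<theta>) / X * ((q + \<beta>) * m)"
    unfolding bm qbm X_def[symmetric] by simp
  then have "\<beta> * m = (2 - \<theta>) / (2 + (p - 1) * \<theta>) * ((q + \<beta>) * m)"
    unfolding X_def .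
  then have "\<beta> * m = ((2 - \<theta>) / (2 + (p - 1) * \<theta>) * (q + \<beta>)) * m" by (simp only: mult.assoc)
  then show "\<beta> = (2 - \<theta>) / (2 + (p - 1) * \<theta>) * (q + \<beta>)"
    using m by (simp only: mult_cancel_right) simp
qed

lemma A_pos: "0 < A"
  using theta q_bounds beta_pos by (simp add: A_ratio)

text \<open>This is minus \<open>M_bar\<close>. Its two bases are the AM-GM coefficients after
  division by \<open>(p + 1) * (q + \<beta>)\<close>.\<close>

definition "crit = (p + 1) * ((2 - \<theta>) / (2 * p)) powr (p / (p + 1)) *
    ((2 - \<theta>) / (2 + (p - 1) * \<theta>)) powr (1 / (p + 1))"

lemma M_ge_crit: "- crit \<le> M"
proof -
  have e: "p / (p + 1) + 1 / (p + 1) = 1" using p by (simp add: field_simps)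
  have pos: "0 < 2 - \<theta>" "0 < 2 + (p - 1) * \<theta>" "0 < p"
    using theta p by (auto simp: add_pos_pos)
  have 1: "(n - 2) * p - n - 2 = - (2 * (2 - \<theta>))"
  proof -
    have "(n - 2) * p - n - 2 = (n - 2) * (p - 1) - 4" by (simp add: algebra_simps)
    also have "(n - 2) * (p - 1) = 2 * \<theta>" by (simp add: \<theta>_def)
    finally show ?thesis by simp
  qed
  have 2: "(n - 2) * (p - 1)\<^sup>2 + 4 = 2 * (2 + (p - 1) * \<theta>)"
    by (simp add: \<theta>_def power2_eq_square)
  have 3: "(2 * (2 - \<theta>)) powr (p / (p + 1)) * (2 * (2 - \<theta>)) powr (1 / (p + 1)) = 2 * (2 - \<theta>)"
    using pos by (simp add: powr_add[symmetric] e)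
  have 4: "((2 - \<theta>) / (2 * p)) = (2 * (2 - \<theta>)) / (4 * p)"
    "(2 - \<theta>) / (2 + (p - 1) * \<theta>) = (2 * (2 - \<theta>)) / (2 * (2 + (p - 1) * \<theta>))"
    by (subst mult_divide_mult_cancel_left[of 2, symmetric]; simp)+
  have c: "crit = (p + 1) * (2 * (2 - \<theta>)) /
    ((4 * p) powr (p / (p + 1)) * (2 * (2 + (p - 1) * \<theta>)) powr (1 / (p + 1)))"
    unfolding crit_def 4 using pos by (subst 3[symmetric]) (simp add: powr_divide)
  show ?thesis using M_ge unfolding 1 2 c by (simp only: mult_minus_right minus_divide_left)
qed

text \<open>Weighted AM-GM with weights \<open>p / (p + 1)\<close> and \<open>1 / (p + 1)\<close>:
  the geometric mean of \<open>X\<close> and \<open>Y\<close> is \<open>crit * (q + \<beta>)\<close>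
  times the mixed term, so \<open>- crit \<le> M\<close> lets the first two terms absorb it.
  Equality would need \<open>X = Y\<close>, which is
  \<open>A * s\<^sup>2 = p * \<beta> * Z\<close>.\<close>

lemma damping:
  assumes s: "0 < s" and Z: "0 < Z"
  shows "0 \<le> A * s\<^sup>2 + \<beta> * Z + M * (q + \<beta>) * (s powr q * Z powr (1 / (p + 1)))" (is ?ge)
    and "A * s\<^sup>2 \<noteq> p * \<beta> * Z \<Longrightarrow>
      0 < A * s\<^sup>2 + \<beta> * Z + M * (q + \<beta>) * (s powr q * Z powr (1 / (p + 1)))" (is "_ \<Longrightarrow> ?gt")
proof -
  define X where "X = (p + 1) * A * s\<^sup>2 / p"
  define Y where "Y = (p + 1) * \<beta> * Z"
  have pp: "0 < p" "0 < p + 1" using p by auto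
  have XY: "0 < X" "0 < Y" using s Z A_pos beta_pos pp by (auto simp: X_def Y_def)
  have e: "p / (p + 1) + 1 / (p + 1) = 1" using p by (simp add: field_simps)
  have lin: "p / (p + 1) * X + 1 / (p + 1) * Y = A * s\<^sup>2 + \<beta> * Z"
  proof -
    have "p / (p + 1) * X = A * s\<^sup>2" "1 / (p + 1) * Y = \<beta> * Z"
      using pp by (simp_all add: X_def Y_def)
    then show ?thesis by simp
  qed
  have q\<beta>: "0 < q + \<beta>" using q_bounds beta_pos by simp
  have pos: "0 < 2 - \<theta>" "0 < 2 + (p - 1) * \<theta>"
    using theta p by (auto simp: add_pos_pos)
  have X': "X = ((p + 1) * (q + \<beta>)) * ((2 - \<theta>) / (2 * p)) * s\<^sup>2"
    unfolding X_def A_ratio by simp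
  have Y': "Y = ((p + 1) * (q + \<beta>)) * ((2 - \<theta>) / (2 + (p - 1) * \<theta>)) * Z"
  proof -
    have "Y = (p + 1) * ((2 - \<theta>) / (2 + (p - 1) * \<theta>) * (q + \<beta>)) * Z"
      unfolding Y_def by (subst beta_ratio) (rule refl)
    then show ?thesis by simp
  qed
  have sq: "(s\<^sup>2) powr (p / (p + 1)) = s powr q"
    using s by (simp add: q_def powr_powr flip: powr_numeral)
  have g: "X powr (p / (p + 1)) * Y powr (1 / (p + 1)) =
      ((p + 1) * (q + \<beta>)) powr (p / (p + 1)) * ((p + 1) * (q + \<beta>)) powr (1 / (p + 1)) *
      (((2 - \<theta>) / (2 * p)) powr (p / (p + 1)) *
      ((2 - \<theta>) / (2 + (p - 1) * \<theta>)) powr (1 / (p + 1))) * (s powr q * Z powr (1 / (p + 1)))"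
  proof -
    have split: "(u * v * w) powr r = u powr r * v powr r * w powr r"
      if "0 < u" "0 < v" "0 < w" for u v w r :: real
      using that by (simp add: powr_mult)
    have pos': "0 < (p + 1) * (q + \<beta>)" "0 < (2 - \<theta>) / (2 * p)" "0 < (2 - \<theta>) / (2 + (p - 1) * \<theta>)" "0 < s\<^sup>2"
      using pp q\<beta> pos s by auto
    show ?thesis
      unfolding X' Y' split[OF pos'(1,2,4)] split[OF pos'(1,3) Z] sq by (simp only: mult_ac)
  qed
  have "((p + 1) * (q + \<beta>)) powr (p / (p + 1)) * ((p + 1) * (q + \<beta>)) powr (1 / (p + 1))
      = (p + 1) * (q + \<beta>)"
    using pp q\<beta> by (simp add: powr_add[symmetric] e)
  then have g: "X powr (p / (p + 1)) * Y powr (1 / (p + 1))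
      = crit * (q + \<beta>) * (s powr q * Z powr (1 / (p + 1)))"
    unfolding g crit_def by (simp add: mult_ac)
  have "- crit * ((q + \<beta>) * (s powr q * Z powr (1 / (p + 1))))
      \<le> M * ((q + \<beta>) * (s powr q * Z powr (1 / (p + 1))))"
    using M_ge_crit q\<beta> by (intro mult_right_mono) auto
  then have low: "- (X powr (p / (p + 1)) * Y powr (1 / (p + 1)))
      \<le> M * (q + \<beta>) * (s powr q * Z powr (1 / (p + 1)))"
    unfolding g by (simp add: mult_ac)
  have "X powr (p / (p + 1)) * Y powr (1 / (p + 1)) \<le> A * s\<^sup>2 + \<beta> * Z"
    using Youngs_inequality_0[of "p / (p + 1)" "1 / (p + 1)" X Y] XY e pp unfolding lin by simp
  with low show ?ge by linarith
  show ?gt if "A * s\<^sup>2 \<noteq> p * \<beta> * Z"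
  proof -
    have "X / (p + 1) = A * s\<^sup>2 / p" "Y / (p + 1) = \<beta> * Z" using pp by (simp_all add: X_def Y_def)
    moreover have "A * s\<^sup>2 / p \<noteq> \<beta> * Z" using that pp by (simp add: divide_eq_eq mult_ac)
    ultimately have "X \<noteq> Y" by auto
    then have "X powr (p / (p + 1)) * Y powr (1 / (p + 1)) < A * s\<^sup>2 + \<beta> * Z"
      using strict_weighted_AM_GM[of "p / (p + 1)" "1 / (p + 1)" X Y] XY e pp unfolding lin by simp
    with low show ?thesis by linarith
  qed
qed

text \<open>With \<open>t = ln r\<close>, \<open>\<xi> = ln (r\<^sup>a u)\<close> and \<open>S = - r u' / u\<close> the radial equation becomes the autonomous
  system \<open>\<xi>' = a - S\<close>, \<open>S' = R \<xi> S\<close>, whose equilibria are the points \<open>(\<xi>, a)\<close> with \<open>f \<xi> = 0\<close>.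
  The energy \<open>E\<close> comes from multiplying this system by the Dulac factor \<open>S\<^sup>\<beta> exp (c \<xi>)\<close>: \<open>h\<close> is the
  kinetic part, \<open>\<Psi>\<close> the potential, and \<open>(S - a) exp (c \<xi>) D\<close> is the rate of change of \<open>E\<close>.\<close>

definition "R \<xi> S = S\<^sup>2 - (n - 2) * S + exp ((p - 1) * \<xi>) + M * \<bar>S\<bar> powr q * exp ((q - 1) * \<xi>)"
definition "f \<xi> = R \<xi> a"
definition "D \<xi> S = A / (\<beta> + 2) * (S powr (\<beta> + 2) - a powr (\<beta> + 2))
    + (S powr \<beta> - a powr \<beta>) * exp ((p - 1) * \<xi>)
    + M * (S powr (\<beta> + q) - a powr (\<beta> + q)) * exp ((q - 1) * \<xi>)"
definition "h S = S powr (\<beta> + 2) / (\<beta> + 2) - a * S powr (\<beta> + 1) / (\<beta> + 1)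
    + a powr (\<beta> + 2) / ((\<beta> + 1) * (\<beta> + 2))"
definition "\<Psi> \<xi> = a powr \<beta> * (a * \<kappa> * exp (c * \<xi>) / c + exp ((c + (p - 1)) * \<xi>) / (c + (p - 1))
    + M * a powr q * exp ((c + (q - 1)) * \<xi>) / (c + (q - 1)))"
definition "E \<xi> S = exp (c * \<xi>) * h S + \<Psi> \<xi>"

section \<open>The energy, its kinetic part and its potential\<close>

lemma f_eq: "f \<xi> = a * \<kappa> + exp ((p - 1) * \<xi>) + M * a powr q * exp ((q - 1) * \<xi>)"
  using a_pos by (simp add: f_def R_def \<kappa>_def power2_eq_square algebra_simps)

lemma exp_q: "exp ((p - 1) * \<xi>) powr (1 / (p + 1)) = exp ((q - 1) * \<xi>)"
  by (simp add: powr_def q_minus_1)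

text \<open>This derivative is the divergence of the field weighted by the Dulac factor, apart from
  \<open>exp (c * \<xi>)\<close>; the bracket is the expression bounded in \<open>damping\<close>.
  So \<open>D\<close> is the divergence integrated in \<open>S\<close> from
  \<open>a\<close>.\<close>

lemma D_has_derivative:
  assumes "0 < S"
  shows "(D \<xi> has_real_derivative S powr (\<beta> - 1) * (A * S\<^sup>2 + \<beta> * exp ((p - 1) * \<xi>)
      + M * (q + \<beta>) * (S powr q * exp ((p - 1) * \<xi>) powr (1 / (p + 1))))) (at S)"
proof -
  have e: "S powr (\<beta> + 2 - 1) = S powr (\<beta> - 1) * S\<^sup>2"
    "S powr (\<beta> + q - 1) = S powr (\<beta> - 1) * S powr q"
    using assms powr_add[of S "\<beta> - 1" 2] powr_add[of S "\<beta> - 1" q] by (simp_all add: algebra_simps)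
  have b: "0 < \<beta> + 2" using beta_pos by simp
  have d: "DERIV (\<lambda>S. S powr r - a powr r) S :> r * S powr (r - 1)" for r
    using assms by (auto intro!: derivative_eq_intros)
  have "(D \<xi> has_real_derivative A / (\<beta> + 2) * ((\<beta> + 2) * S powr (\<beta> + 2 - 1))
      + \<beta> * S powr (\<beta> - 1) * exp ((p - 1) * \<xi>)
      + M * ((\<beta> + q) * S powr (\<beta> + q - 1)) * exp ((q - 1) * \<xi>)) (at S)"
    unfolding D_def by (intro DERIV_add DERIV_cmult DERIV_cmult_right d)
  moreover have k: "A / (\<beta> + 2) * ((\<beta> + 2) * w) = A * w" for w using b by simp
  ultimately show ?thesis
    unfolding exp_q e k by (elim DERIV_cong) (simp add: algebra_simps)
qed

text \<open>For fixed \<xi> the derivative can vanish only at \<open>r\<close>, the equality case of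
  \<open>damping\<close>; splitting the interval there keeps the monotonicity strict even in the
  extreme case of \<open>M\<close>.\<close>

lemma D_strict_mono:
  assumes "0 \<le> s" "s < t"
  shows "D \<xi> s < D \<xi> t"
proof -
  define Z where "Z = exp ((p - 1) * \<xi>)"
  define r where "r = sqrt (p * \<beta> * Z / A)"
  have cont: "continuous_on {u..v} (D \<xi>)" if "0 \<le> u" for u v
  proof -
    have c: "continuous_on {u..v} (\<lambda>S. S powr e)" if "0 < e" for e
      using that \<open>0 \<le> u\<close> by (intro continuous_on_powr_pos) auto
    have "0 < \<beta> + 2" "0 < \<beta> + q" using beta_pos q_bounds by auto
    then show ?thesis unfolding D_def
      by (intro continuous_on_add continuous_on_mult continuous_on_diff continuous_on_const c beta_pos)
  qed
  have strict: "D \<xi> u < D \<xi> v" if uv: "0 \<le> u" "u < v" and r: "r \<notin> {u<..<v}" for u v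
  proof (rule DERIV_pos_imp_increasing_open[OF uv(2) _ cont[OF uv(1)]])
    fix x assume x: "u < x" "x < v"
    have "x \<noteq> r" using x r by auto
    then have "x\<^sup>2 \<noteq> p * \<beta> * Z / A"
      using x uv by (metis dual_order.strict_trans1 less_eq_real_def r_def real_sqrt_unique)
    then have "A * x\<^sup>2 \<noteq> p * \<beta> * Z" using A_pos by (auto simp: field_simps)
    moreover have "0 < x" "0 < Z" using x uv by (auto simp: Z_def)
    ultimately have "0 < x powr (\<beta> - 1) * (A * x\<^sup>2 + \<beta> * Z + M * (q + \<beta>) * (x powr q * Z powr (1 / (p + 1))))"
      using damping(2)[of x Z] by simp
    then show "\<exists>y. (D \<xi> has_real_derivative y) (at x) \<and> 0 < y"
      using D_has_derivative[OF \<open>0 < x\<close>, of \<xi>] unfolding Z_def by blast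
  qed
  show ?thesis
  proof (cases "r \<in> {s<..<t}")
    case True
    then show ?thesis using strict[of s r] strict[of r t] assms by auto
  qed (use strict assms in auto)
qed

lemma D_a: "D \<xi> a = 0"
  by (simp add: D_def)

lemma D_sign: "0 \<le> S \<Longrightarrow> S \<noteq> a \<Longrightarrow> 0 < (S - a) * D \<xi> S"
  using D_strict_mono[of S a \<xi>] D_strict_mono[of a S \<xi>] a_pos D_a[of \<xi>]
  by (cases "S < a") (auto simp: mult_neg_neg)

text \<open>Joins two descriptions of \<open>D\<close>: the divergence integrated in
  \<open>S\<close>, and the cofactor that appears when \<open>E\<close> is differentiated along a
  trajectory. The terms match because of \<open>ca\<close>.\<close>

lemma D_eq:
  assumes "0 \<le> S"
  shows "D \<xi> S = S powr \<beta> * R \<xi> S - a powr \<beta> * f \<xi> - c * h S"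
proof -
  have e: "S powr (\<beta> + 2) = S powr \<beta> * S\<^sup>2" "S powr (\<beta> + 1) = S powr \<beta> * S" "S powr (\<beta> + q) = S powr \<beta> * S powr q"
    if "0 \<le> S" for S using that by (cases "S = 0"; simp add: powr_add)+
  have b: "\<beta> + 2 \<noteq> 0" "\<beta> + 1 \<noteq> 0" using beta_pos by auto
  have n: "n - 2 = c * a / (\<beta> + 1)" using ca b by simp
  have c: "c = \<beta> + 2 - A" by (simp add: A_def)
  have "c * h S = (\<beta> + 2 - A) / (\<beta> + 2) * (S powr (\<beta> + 2)) - (n - 2) * S powr (\<beta> + 1)
     + c * a / (\<beta> + 1) * (a powr (\<beta> + 1)) / (\<beta> + 2)"
  proof -
    have "a powr (\<beta> + 2) = a * a powr (\<beta> + 1)" using e[of a] a_pos by (simp add: power2_eq_square)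
    moreover have "c * (S powr (\<beta> + 2) / (\<beta> + 2)) = (\<beta> + 2 - A) / (\<beta> + 2) * (S powr (\<beta> + 2))"
      using c by simp
    ultimately show ?thesis unfolding n h_def by (simp add: algebra_simps)
  qed
  also have "c * a / (\<beta> + 1) * (a powr (\<beta> + 1)) / (\<beta> + 2)
      = (n - 2) * a powr (\<beta> + 1) - (\<beta> + 2 - A) / (\<beta> + 2) * a powr (\<beta> + 2)"
  proof -
    have g1: "(\<beta> + 2 - A) / (\<beta> + 2) * a powr (\<beta> + 2) = c * a * a powr (\<beta> + 1) / (\<beta> + 2)"
    proof -
      have "a powr (\<beta> + 2) = a * a powr (\<beta> + 1)" using e[of a] a_pos by (simp add: power2_eq_square)
      moreover have "\<beta> + 2 - A = c" by (simp add: A_def)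
      ultimately show ?thesis by simp
    qed
    have g2: "(n - 2) * a powr (\<beta> + 1) = c * a * a powr (\<beta> + 1) / (\<beta> + 1)"
      unfolding n by simp
    have "x / (\<beta> + 1) / (\<beta> + 2) = x / (\<beta> + 1) - x / (\<beta> + 2)" for x
      using b by (simp add: divide_simps) (simp add: algebra_simps)
    from this[of "c * a * a powr (\<beta> + 1)"] show ?thesis unfolding g1 g2 by simp
  qed
  finally have ch: "c * h S = (1 - A / (\<beta> + 2)) * (S powr (\<beta> + 2) - a powr (\<beta> + 2))
      - (n - 2) * (S powr (\<beta> + 1) - a powr (\<beta> + 1))"
    using b by (simp add: diff_divide_distrib algebra_simps)
  have R: "s powr \<beta> * R \<xi> s = s powr (\<beta> + 2) - (n - 2) * s powr (\<beta> + 1) + s powr \<beta> * exp ((p - 1) * \<xi>)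
      + M * s powr (\<beta> + q) * exp ((q - 1) * \<xi>)" if "0 \<le> s" for s
    unfolding R_def e[OF that] using that by (simp add: algebra_simps)
  show ?thesis
    unfolding ch f_def R[OF assms] R[OF less_imp_le[OF a_pos]] D_def by (simp add: algebra_simps)
qed

lemma h_has_derivative:
  assumes "0 < S"
  shows "DERIV h S :> S powr \<beta> * (S - a)"
proof -
  have b: "\<beta> + 2 \<noteq> 0" "\<beta> + 1 \<noteq> 0" using beta_pos by auto
  have d: "DERIV (\<lambda>S. S powr r) S :> r * S powr (r - 1)" for r
    using assms by (auto intro!: derivative_eq_intros)
  have "DERIV h S :> (\<beta> + 2) * S powr (\<beta> + 2 - 1) / (\<beta> + 2)
      - a * ((\<beta> + 1) * S powr (\<beta> + 1 - 1)) / (\<beta> + 1) + 0"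
    unfolding h_def
    by (intro DERIV_add DERIV_diff DERIV_cdivide DERIV_cmult d DERIV_const)
  moreover have k: "(\<beta> + 2) * w / (\<beta> + 2) = w" "a * ((\<beta> + 1) * w) / (\<beta> + 1) = a * w" for w
    using b by simp_all
  moreover have e: "S powr (\<beta> + 2 - 1) = S * S powr \<beta>" "\<beta> + 1 - 1 = \<beta>"
    using assms powr_add[of S 1 \<beta>] by (simp_all add: add.commute)
  ultimately show ?thesis unfolding k e by (elim DERIV_cong) (simp add: algebra_simps)
qed

lemma continuous_on_h:
  assumes "\<And>x. x \<in> X \<Longrightarrow> 0 \<le> x"
  shows "continuous_on X h"
proof -
  have c: "continuous_on X (\<lambda>S. S powr e)" if "0 < e" for e
    by (intro continuous_on_powr_pos assms that)
  have "0 < \<beta> + 2" "0 < \<beta> + 1" using beta_pos by auto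
  then show ?thesis unfolding h_def
    by (intro continuous_on_add continuous_on_mult continuous_on_diff continuous_on_divide
        continuous_on_const c) auto
qed

lemma h_a: "h a = 0"
proof -
  have "a * a powr (\<beta> + 1) = a powr (\<beta> + 2)"
    using a_pos powr_add[of a 1 "\<beta> + 1"] by (simp add: algebra_simps)
  then have "h a = a powr (\<beta> + 2) * (1 / (\<beta> + 2) - 1 / (\<beta> + 1) + 1 / ((\<beta> + 1) * (\<beta> + 2)))"
    by (simp add: h_def algebra_simps)
  also have "1 / (\<beta> + 2) - 1 / (\<beta> + 1) + 1 / ((\<beta> + 1) * (\<beta> + 2)) = 0"
    using beta_pos by (simp add: field_simps)
  finally show ?thesis by simp
qed

lemma h_increasing:
  assumes "a \<le> s" "s < t"
  shows "h s < h t"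
proof (rule DERIV_pos_imp_increasing_open[OF assms(2)])
  fix x assume "s < x" "x < t"
  then show "\<exists>y. DERIV h x :> y \<and> 0 < y"
    using h_has_derivative[of x] a_pos assms by (intro exI[of _ "x powr \<beta> * (x - a)"]) auto
qed (use assms a_pos in \<open>auto intro!: continuous_on_h\<close>)

lemma h_decreasing:
  assumes "0 \<le> s" "s < t" "t \<le> a"
  shows "h t < h s"
proof (rule DERIV_neg_imp_decreasing_open[OF assms(2)])
  fix x assume "s < x" "x < t"
  then show "\<exists>y. DERIV h x :> y \<and> y < 0"
    using h_has_derivative[of x] a_pos assms
    by (intro exI[of _ "x powr \<beta> * (x - a)"]) (auto intro!: mult_pos_neg)
qed (use assms a_pos in \<open>auto intro!: continuous_on_h\<close>)

lemma h_pos: "0 \<le> S \<Longrightarrow> S \<noteq> a \<Longrightarrow> 0 < h S"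
  using h_increasing[of a S] h_decreasing[of S a] h_a by (cases "S < a") auto

lemma h_nonneg: "0 \<le> S \<Longrightarrow> 0 \<le> h S"
  using h_pos[of S] h_a by (cases "S = a") auto

text \<open>Coercivity of the kinetic part, which bounds \<open>S\<close> on sublevel sets of
  \<open>E\<close>: past \<open>a + 1\<close> the slope \<open>S powr \<beta> * (S - a)\<close> is
  at least 1.\<close>

lemma h_ge_linear:
  assumes "a + 1 \<le> S"
  shows "S - (a + 1) \<le> h S"
proof -
  have "h (a + 1) - (a + 1) \<le> h S - S"
  proof (rule DERIV_nonneg_imp_nondecreasing[OF assms, of "\<lambda>S. h S - S"])
    fix x assume x: "a + 1 \<le> x" "x \<le> S"
    then have "1 \<le> x powr \<beta>" using a_pos beta_pos by (intro ge_one_powr_ge_zero) auto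
    then have "1 * 1 \<le> x powr \<beta> * (x - a)" using x by (intro mult_mono) auto
    moreover have "DERIV (\<lambda>S. h S - S) x :> x powr \<beta> * (x - a) - 1"
      using h_has_derivative[of x] x a_pos by (auto intro!: derivative_eq_intros)
    ultimately show "\<exists>y. DERIV (\<lambda>S. h S - S) x :> y \<and> 0 \<le> y"
      by (metis diff_ge_0_iff_ge mult_1)
  qed
  then show ?thesis using h_nonneg[of "a + 1"] a_pos by simp
qed

text \<open>Converts a lower bound on the kinetic part into one on \<open>S\<close>; the constant
  term of \<open>h\<close> is dominated by the negative middle term.\<close>

lemma h_le_powr:
  assumes "a \<le> S"
  shows "h S \<le> S powr (\<beta> + 2)"
proof -
  have S: "0 < S" using assms a_pos by simp
  have "a powr (\<beta> + 2) = a * a powr (\<beta> + 1)"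
    using a_pos powr_add[of a 1 "\<beta> + 1"] by (simp add: algebra_simps)
  also have "\<dots> \<le> a * S powr (\<beta> + 1)"
    using assms a_pos beta_pos by (intro mult_left_mono powr_mono2) auto
  finally have "a powr (\<beta> + 2) / ((\<beta> + 1) * (\<beta> + 2)) \<le> a * S powr (\<beta> + 1) / ((\<beta> + 1) * (\<beta> + 2))"
    using beta_pos by (intro divide_right_mono) auto
  also have "\<dots> \<le> a * S powr (\<beta> + 1) / (\<beta> + 1)"
    using beta_pos a_pos S by (intro divide_left_mono) auto
  finally have "h S \<le> S powr (\<beta> + 2) / (\<beta> + 2)" by (simp add: h_def)
  also have "\<dots> \<le> S powr (\<beta> + 2) / 1"
    using beta_pos S by (intro divide_left_mono) auto
  finally show ?thesis by simp
qed

lemma Psi_has_derivative: "DERIV \<Psi> \<xi> :> a powr \<beta> * exp (c * \<xi>) * f \<xi>"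
proof -
  have e: "exp ((c + (p - 1)) * \<xi>) = exp (c * \<xi>) * exp ((p - 1) * \<xi>)"
    "exp ((c + (q - 1)) * \<xi>) = exp (c * \<xi>) * exp ((q - 1) * \<xi>)"
    by (simp_all add: algebra_simps flip: exp_add)
  have "c \<noteq> 0" "c + (p - 1) \<noteq> 0" "c + (q - 1) \<noteq> 0" using c_pos p q_bounds by auto
  then have "DERIV \<Psi> \<xi> :> a powr \<beta> * (a * \<kappa> * exp (c * \<xi>) + exp ((c + (p - 1)) * \<xi>)
      + M * a powr q * exp ((c + (q - 1)) * \<xi>))"
    unfolding \<Psi>_def by (auto intro!: derivative_eq_intros)
  then show ?thesis unfolding e f_eq by (simp add: algebra_simps)
qed

lemma E_a: "E \<xi> a = \<Psi> \<xi>"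
  by (simp add: E_def h_a)

lemma E_ge_Psi: "0 \<le> S \<Longrightarrow> \<Psi> \<xi> \<le> E \<xi> S"
  using h_nonneg[of S] by (simp add: E_def)

lemma E_gt_Psi: "0 \<le> S \<Longrightarrow> S \<noteq> a \<Longrightarrow> \<Psi> \<xi> < E \<xi> S"
  using h_pos[of S] by (simp add: E_def)

text \<open>At \<open>S = 0\<close> the weight \<open>S powr \<beta>\<close> vanishes, so by
  \<open>D_eq\<close> the slope is \<open>- exp (c * x) * D x 0\<close>, positive because
  \<open>D\<close> increases to 0 at \<open>S = a\<close>. This is what keeps sublevel regions of
  \<open>E\<close> away from the axis \<open>S = 0\<close>.\<close>

lemma E_at_0_increasing:
  assumes "\<xi> \<le> \<xi>'"
  shows "E \<xi> 0 \<le> E \<xi>' 0"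
proof (rule DERIV_nonneg_imp_nondecreasing[OF assms, of "\<lambda>\<xi>. E \<xi> 0"])
  fix x
  have "DERIV (\<lambda>\<xi>. E \<xi> 0) x :> - exp (c * x) * D x 0"
    unfolding E_def
    by (auto intro!: derivative_eq_intros Psi_has_derivative simp: D_eq algebra_simps)
  moreover have "D x 0 < 0" using D_strict_mono[of 0 a x] a_pos D_a[of x] by simp
  moreover from this have "0 \<le> - exp (c * x) * D x 0" by (simp add: mult_nonneg_nonpos)
  ultimately show "\<exists>y. DERIV (\<lambda>\<xi>. E \<xi> 0) x :> y \<and> 0 \<le> y" by blast
qed

definition "trajectory_at \<xi> S t \<longleftrightarrow> DERIV \<xi> t :> a - S t \<and>
    DERIV S t :> R (\<xi> t) (S t)"

text \<open>The speed of \<xi> is \<open>a - S\<close>, and \<open>S - a\<close> is also a factor of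
  the derivative of \<open>h\<close>; hence it comes out of the whole expression, and
  \<open>D_eq\<close> identifies the cofactor.\<close>

lemma E_along:
  assumes "trajectory_at \<xi> S t" and "0 < S t"
  shows "DERIV (\<lambda>t. E (\<xi> t) (S t)) t :> (S t - a) * (exp (c * \<xi> t) * D (\<xi> t) (S t))"
proof -
  have d: "DERIV \<xi> t :> a - S t" "DERIV S t :> R (\<xi> t) (S t)"
    using assms by (auto simp: trajectory_at_def)
  have dh: "DERIV (\<lambda>t. h (S t)) t :> S t powr \<beta> * (S t - a) * R (\<xi> t) (S t)"
    by (rule DERIV_chain2[OF h_has_derivative[OF assms(2)] d(2)])
  have dP: "DERIV (\<lambda>t. \<Psi> (\<xi> t)) t :> a powr \<beta> * exp (c * \<xi> t) * f (\<xi> t) * (a - S t)"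
    by (rule DERIV_chain2[OF Psi_has_derivative d(1)])
  show ?thesis unfolding E_def
    by (rule derivative_eq_intros d dh dP refl)+ (use assms in \<open>simp add: D_eq algebra_simps\<close>)
qed

lemma E_along_pos:
  "0 \<le> S \<Longrightarrow> S \<noteq> a \<Longrightarrow> 0 < (S - a) * (exp (c * \<xi>) * D \<xi> S)"
  using D_sign[of S \<xi>] by (simp add: zero_less_mult_iff mult_less_0_iff)

lemma E_along_nonneg:
  "0 \<le> S \<Longrightarrow> 0 \<le> (S - a) * (exp (c * \<xi>) * D \<xi> S)"
  using E_along_pos[of S \<xi>] by (cases "S = a") auto

lemma E_mono:
  assumes "s \<le> t" and tr: "\<And>r. s \<le> r \<Longrightarrow> r \<le> t \<Longrightarrow> trajectory_at \<xi> S r"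
    and pos: "\<And>r. s \<le> r \<Longrightarrow> r \<le> t \<Longrightarrow> 0 < S r"
  shows "E (\<xi> s) (S s) \<le> E (\<xi> t) (S t)"
  by (rule DERIV_nonneg_imp_nondecreasing[OF assms(1), of "\<lambda>t. E (\<xi> t) (S t)"])
     (use E_along tr pos E_along_nonneg less_imp_le in blast)

end

section \<open>Lipschitz bounds for the planar field and uniqueness of trajectories\<close>

lemma lipschitz_on_mult_compact:
  fixes g g' :: "'a::metric_space \<Rightarrow> real"
  assumes X: "compact X" and g: "L-lipschitz_on X g" and g': "L'-lipschitz_on X g'"
  obtains C where "C-lipschitz_on X (\<lambda>x. g x * g' x)"
proof -
  have "bounded (g ` X)" "bounded (g' ` X)"
    using g g' X lipschitz_on_continuous_on compact_continuous_image compact_imp_bounded by metis+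
  then obtain b b' where b: "\<And>x. x \<in> X \<Longrightarrow> \<bar>g x\<bar> \<le> b" "0 < b" and b': "\<And>x. x \<in> X \<Longrightarrow> \<bar>g' x\<bar> \<le> b'" "0 < b'"
    unfolding bounded_pos by auto
  have L: "0 \<le> L" "0 \<le> L'" using g g' lipschitz_on_nonneg by auto
  have "(b * L' + L * b')-lipschitz_on X (\<lambda>x. g x * g' x)"
  proof (rule lipschitz_onI)
    fix x y assume xy: "x \<in> X" "y \<in> X"
    have "g x * g' x - g y * g' y = g x * (g' x - g' y) + (g x - g y) * g' y"
      by (simp add: algebra_simps)
    also have "\<bar>\<dots>\<bar> \<le> \<bar>g x\<bar> * \<bar>g' x - g' y\<bar> + \<bar>g x - g y\<bar> * \<bar>g' y\<bar>"
      by (metis abs_mult abs_triangle_ineq)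
    also have "\<dots> \<le> b * (L' * dist x y) + (L * dist x y) * b'"
      using lipschitz_onD[OF g xy] lipschitz_onD[OF g' xy] b b' xy L
      by (intro add_mono mult_mono) (auto simp: dist_real_def)
    finally show "dist (g x * g' x) (g y * g' y) \<le> (b * L' + L * b') * dist x y"
      by (simp add: dist_real_def algebra_simps)
  qed (use L b(2) b'(2) in auto)
  then show ?thesis by (rule that)
qed

lemma lipschitz_on_exp:
  fixes k B :: real
  shows "(\<bar>k\<bar> * exp (\<bar>k\<bar> * B))-lipschitz_on {-B..B} (\<lambda>x. exp (k * x))"
proof (rule lipschitz_onI)
  fix x y :: real assume xy: "x \<in> {-B..B}" "y \<in> {-B..B}"
  have "norm (exp (k * x) - exp (k * y)) \<le> (\<bar>k\<bar> * exp (\<bar>k\<bar> * B)) * norm (x - y)"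
  proof (rule field_differentiable_bound[OF convex_real_interval(5)[of "-B" B]])
    fix z assume z: "z \<in> {-B..B}"
    show "((\<lambda>x. exp (k * x)) has_field_derivative k * exp (k * z)) (at z within {-B..B})"
      by (auto intro!: derivative_eq_intros)
    have "k * z \<le> \<bar>k\<bar> * \<bar>z\<bar>" by (metis abs_ge_self abs_mult)
    also have "\<dots> \<le> \<bar>k\<bar> * B" using z by (intro mult_left_mono) auto
    finally show "norm (k * exp (k * z)) \<le> \<bar>k\<bar> * exp (\<bar>k\<bar> * B)"
      by (simp add: abs_mult mult_left_mono)
  qed (use xy in auto)
  then show "dist (exp (k * x)) (exp (k * y)) \<le> (\<bar>k\<bar> * exp (\<bar>k\<bar> * B)) * dist x y"
    by (simp add: dist_real_def)
qed simp

text \<open>Since \<open>q\<close> exceeds 1, the slope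
  \<open>q * \<bar>x\<bar> powr (q - 1)\<close> is bounded on bounded intervals, the origin
  included.\<close>

lemma lipschitz_on_abs_powr:
  fixes q B :: real
  assumes q: "1 < q"
  shows "(q * B powr (q - 1))-lipschitz_on {-B..B} (\<lambda>x. \<bar>x\<bar> powr q)"
proof (rule lipschitz_onI)
  define C where "C = q * B powr (q - 1)"
  have C: "0 \<le> C" using q by (simp add: C_def)
  have main: "\<bar>t powr q - s powr q\<bar> \<le> C * (t - s)" if st: "0 \<le> s" "s \<le> t" "t \<le> B" for s t
  proof -
    have "C * s - s powr q \<le> C * t - t powr q"
    proof (rule DERIV_nonneg_imp_increasing_open[OF st(2)])
      fix x assume x: "s < x" "x < t"
      have "DERIV (\<lambda>x. C * x - x powr q) x :> C - q * x powr (q - 1)"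
        using x st by (auto intro!: derivative_eq_intros)
      moreover have "q * x powr (q - 1) \<le> C"
        unfolding C_def using x st q by (intro mult_left_mono powr_mono2) auto
      ultimately show "\<exists>y. DERIV (\<lambda>x. C * x - x powr q) x :> y \<and> 0 \<le> y"
        by (intro exI[of _ "C - q * x powr (q - 1)"]) auto
    next
      have "continuous_on {s..t} (\<lambda>x. x powr q)"
        using st q by (intro continuous_on_powr_pos) auto
      then show "continuous_on {s..t} (\<lambda>x. C * x - x powr q)"
        by (intro continuous_on_diff continuous_on_mult continuous_on_const continuous_on_id)
    qed
    moreover have "s powr q \<le> t powr q" using st q by (intro powr_mono2) auto
    ultimately show ?thesis by (simp add: algebra_simps)
  qed
  fix x y :: real assume xy: "x \<in> {-B..B}" "y \<in> {-B..B}"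
  have "\<bar>\<bar>x\<bar> powr q - \<bar>y\<bar> powr q\<bar> \<le> C * \<bar>\<bar>x\<bar> - \<bar>y\<bar>\<bar>"
    using main[of "\<bar>x\<bar>" "\<bar>y\<bar>"] main[of "\<bar>y\<bar>" "\<bar>x\<bar>"] xy by (cases "\<bar>x\<bar> \<le> \<bar>y\<bar>") (auto simp: abs_minus_commute)
  also have "\<dots> \<le> C * \<bar>x - y\<bar>" using C by (intro mult_left_mono abs_triangle_ineq3)
  finally show "dist (\<bar>x\<bar> powr q) (\<bar>y\<bar> powr q) \<le> q * B powr (q - 1) * dist x y"
    by (simp add: dist_real_def C_def)
qed (use q in simp)

lemma
  assumes "L-lipschitz_on A g"
  shows lipschitz_on_of_fst: "fst ` X \<subseteq> A \<Longrightarrow> L-lipschitz_on X (\<lambda>z. g (fst z))"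
    and lipschitz_on_of_snd: "snd ` X \<subseteq> A \<Longrightarrow> L-lipschitz_on X (\<lambda>z. g (snd z))"
proof -
  have "1-lipschitz_on X fst" "1-lipschitz_on X snd"
    by (rule lipschitz_onI; simp add: dist_fst_le dist_snd_le)+
  from this[THEN lipschitz_on_compose2]
  show "fst ` X \<subseteq> A \<Longrightarrow> L-lipschitz_on X (\<lambda>z. g (fst z))"
    and "snd ` X \<subseteq> A \<Longrightarrow> L-lipschitz_on X (\<lambda>z. g (snd z))"
    using lipschitz_on_subset[OF assms] by (metis mult_1_right)+
qed

context emden_fowler
begin

definition "field z = (a - snd z, R (fst z) (snd z))"

definition "square B = {-B..B} \<times> {-B..B :: real}"

lemma square_lipschitz:
  obtains L where "L-lipschitz_on (square B) field"
proof -
  let ?X = "square B"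
  have X: "compact ?X" by (simp add: square_def compact_Times)
  have sub: "fst ` ?X \<subseteq> {-B..B}" "snd ` ?X \<subseteq> {-B..B}" by (auto simp: square_def)
  have s: "1-lipschitz_on ?X snd"
    using lipschitz_on_of_snd[OF lipschitz_on_id sub(2)] by simp
  obtain L1 where L1: "L1-lipschitz_on ?X (\<lambda>z. snd z * snd z)"
    using lipschitz_on_mult_compact[OF X s s] .
  note e1 = lipschitz_on_of_fst[OF lipschitz_on_exp[of "p - 1" B] sub(1)]
  note e2 = lipschitz_on_of_fst[OF lipschitz_on_exp[of "q - 1" B] sub(1)]
  note e3 = lipschitz_on_of_snd[OF lipschitz_on_abs_powr[OF q_bounds(1), of B] sub(2)]
  obtain L2 where L2: "L2-lipschitz_on ?X (\<lambda>z. \<bar>snd z\<bar> powr q * exp ((q - 1) * fst z))"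
    using lipschitz_on_mult_compact[OF X e3 e2] .
  have eq: "field = (\<lambda>z. (a - snd z, snd z * snd z - (n - 2) * snd z + exp ((p - 1) * fst z)
      + M * (\<bar>snd z\<bar> powr q * exp ((q - 1) * fst z))))"
    by (simp add: field_def R_def power2_eq_square fun_eq_iff)
  note T = lipschitz_on_Pair[OF lipschitz_on_diff[OF lipschitz_on_constant s]
      lipschitz_on_add[OF lipschitz_on_add[OF lipschitz_on_diff[OF L1 lipschitz_on_cmult_real[OF s]] e1]
        lipschitz_on_cmult_real[OF L2]]]
  show ?thesis by (rule that, subst eq, rule T)
qed

lemma trajectory_field:
  "trajectory_at \<xi> S t \<longleftrightarrow> ((\<lambda>t. (\<xi> t, S t)) has_vector_derivative field (\<xi> t, S t)) (at t)"
proof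
  assume "trajectory_at \<xi> S t"
  then show "((\<lambda>t. (\<xi> t, S t)) has_vector_derivative field (\<xi> t, S t)) (at t)"
    by (auto simp: trajectory_at_def field_def has_real_derivative_iff_has_vector_derivative
        intro: has_vector_derivative_Pair)
next
  assume d: "((\<lambda>t. (\<xi> t, S t)) has_vector_derivative field (\<xi> t, S t)) (at t)"
  show "trajectory_at \<xi> S t"
    using bounded_linear.has_vector_derivative[OF bounded_linear_fst d]
      bounded_linear.has_vector_derivative[OF bounded_linear_snd d]
    by (simp add: trajectory_at_def field_def has_real_derivative_iff_has_vector_derivative)
qed

text \<open>Between \<open>t0\<close> and \<open>t\<close> both curves are bounded, hence lie in one
  square, where the field is Lipschitz and the dependence estimate applies with equal initial
  data.\<close>

lemma trajectory_unique:
  assumes y: "\<And>t. trajectory_at \<xi> S t" and z: "\<And>t. trajectory_at \<xi>' S' t"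
    and eq: "\<xi> t0 = \<xi>' t0" "S t0 = S' t0"
  shows "\<xi> t = \<xi>' t \<and> S t = S' t"
proof -
  define s where "s = t - t0"
  define Y where "Y r = (\<xi> (r + t0), S (r + t0))" for r
  define Z where "Z r = (\<xi>' (r + t0), S' (r + t0))" for r
  have shift: "((\<lambda>r. x (r + t0)) has_vector_derivative d) (at r)"
    if "(x has_vector_derivative d) (at (r + t0))" for x :: "real \<Rightarrow> real \<times> real" and d r
  proof -
    have "((\<lambda>r. r + t0) has_vector_derivative 1) (at r)"
      by (auto intro!: derivative_eq_intros simp: has_vector_derivative_def)
    from vector_diff_chain_at[OF this that] show ?thesis by (simp add: o_def)
  qed
  have dY: "(Y has_vector_derivative field (Y r)) (at r)" for r
    unfolding Y_def using shift[of "\<lambda>t. (\<xi> t, S t)"] y trajectory_field by blast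
  have dZ: "(Z has_vector_derivative field (Z r)) (at r)" for r
    unfolding Z_def using shift[of "\<lambda>t. (\<xi>' t, S' t)"] z trajectory_field by blast
  have "bounded (Y ` {-\<bar>s\<bar>..\<bar>s\<bar>})" "bounded (Z ` {-\<bar>s\<bar>..\<bar>s\<bar>})"
    using dY dZ by (auto intro!: compact_imp_bounded compact_continuous_image continuous_at_imp_continuous_on
        has_vector_derivative_continuous)
  then obtain b b' where b: "\<forall>r\<in>{-\<bar>s\<bar>..\<bar>s\<bar>}. norm (Y r) \<le> b" "\<forall>r\<in>{-\<bar>s\<bar>..\<bar>s\<bar>}. norm (Z r) \<le> b'"
    unfolding bounded_iff by (meson imageI)
  have insq: "x \<in> square (max b b')" if "norm x \<le> max b b'" for x :: "real \<times> real"
  proof -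
    have "\<bar>fst x\<bar> \<le> norm x" "\<bar>snd x\<bar> \<le> norm x"
      by (metis norm_fst_le prod.collapse real_norm_def, metis norm_snd_le prod.collapse real_norm_def)
    then show ?thesis using that unfolding square_def mem_Times_iff by auto
  qed
  obtain L where L: "L-lipschitz_on (square (max b b')) field" using square_lipschitz .
  have "norm (Y s - Z s) \<le> exp (L * \<bar>s\<bar>) * norm (Y 0 - Z 0)"
  proof (rule lipschitz_ode_dependence[OF L])
    fix r :: real assume "\<bar>r\<bar> \<le> \<bar>s\<bar>"
    then have "r \<in> {-\<bar>s\<bar>..\<bar>s\<bar>}" by auto
    from bspec[OF b(1) this] bspec[OF b(2) this] show "Y r \<in> square (max b b')" "Z r \<in> square (max b b')"
      by (auto intro!: insq)
  qed (use dY dZ in auto)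
  moreover have "Y 0 = Z 0" using eq by (simp add: Y_def Z_def)
  ultimately have "Y s = Z s" by simp
  then show ?thesis by (simp add: Y_def Z_def s_def)
qed

section \<open>Shape and zeros of \<open>f\<close>\<close>

lemma p_minus_q: "0 < p - q" "p - 1 = (p + 1) * (q - 1)" "p - 1 = (p - q) * ((p + 1) / p)"
proof -
  have "q * (p + 1) = 2 * p" using p by (simp add: q_def)
  then have "(p - q) * (p + 1) = (p * (q - 1)) * (p + 1)"
    by algebra
  then have "p - q = p * (q - 1)" using p by simp
  then show "0 < p - q" using p q_bounds by simp
  show k: "p - 1 = (p + 1) * (q - 1)" using p by (simp add: q_minus_1)
  show "p - 1 = (p - q) * ((p + 1) / p)"
    unfolding \<open>p - q = p * (q - 1)\<close> k using p by (simp only: times_divide_eq_right) simp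
qed

definition "\<mu> = (p + 1) * ((1 - \<theta>) / p) powr (p / (p + 1))"

text \<open>The zero of the derivative of \<open>f\<close>, hence its minimum point. The formula is
  meaningful for \<open>M < 0\<close>; at \<open>M = 0\<close> it involves the default value
  \<open>ln 0\<close>.\<close>

definition "\<xi>m = ln (- M * a powr q / (p + 1)) / (p - q)"

lemma f_has_derivative:
  "DERIV f \<xi> :> (q - 1) * exp ((q - 1) * \<xi>) * ((p + 1) * exp ((p - q) * \<xi>) + M * a powr q)"
proof -
  have "exp ((p - 1) * \<xi>) = exp ((q - 1) * \<xi>) * exp ((p - q) * \<xi>)"
    by (simp add: algebra_simps flip: exp_add)
  moreover have "DERIV f \<xi> :> (p - 1) * exp ((p - 1) * \<xi>) + M * a powr q * ((q - 1) * exp ((q - 1) * \<xi>))"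
    unfolding f_eq[abs_def] by (auto intro!: derivative_eq_intros)
  ultimately show ?thesis
    unfolding p_minus_q(2) by (elim DERIV_cong) (simp add: algebra_simps)
qed

lemma exp_xi_m:
  assumes "M < 0"
  shows "(p + 1) * exp ((p - q) * \<xi>m) = - M * a powr q"
proof -
  have "0 < - M * a powr q / (p + 1)" using assms p a_pos by (intro divide_pos_pos mult_pos_pos) auto
  then have "exp ((p - q) * \<xi>m) = - M * a powr q / (p + 1)" using p_minus_q(1) by (simp add: \<xi>m_def)
  then show ?thesis using p by simp
qed

lemma f_decreasing:
  assumes "M < 0" "x < y" "y \<le> \<xi>m"
  shows "f y < f x"
proof (rule DERIV_neg_imp_decreasing_open[OF assms(2)])
  fix z assume z: "x < z" "z < y"
  then have "exp ((p - q) * z) < exp ((p - q) * \<xi>m)" using assms p_minus_q(1) by simp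
  then have "(p + 1) * exp ((p - q) * z) < (p + 1) * exp ((p - q) * \<xi>m)"
    using p by (intro mult_strict_left_mono) auto
  then have "(p + 1) * exp ((p - q) * z) + M * a powr q < 0"
    unfolding exp_xi_m[OF assms(1)] by simp
  then show "\<exists>y. DERIV f z :> y \<and> y < 0"
    using f_has_derivative[of z] q_bounds by (meson exp_gt_zero mult_pos_neg mult_pos_pos)
qed (meson f_has_derivative DERIV_continuous continuous_at_imp_continuous_on)

lemma f_increasing:
  assumes "M < 0" "x < y" "\<xi>m \<le> x"
  shows "f x < f y"
proof (rule DERIV_pos_imp_increasing_open[OF assms(2)])
  fix z assume z: "x < z" "z < y"
  then have "exp ((p - q) * \<xi>m) < exp ((p - q) * z)" using assms p_minus_q(1) by simp
  then have "(p + 1) * exp ((p - q) * \<xi>m) < (p + 1) * exp ((p - q) * z)"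
    using p by (intro mult_strict_left_mono) auto
  then have "0 < (p + 1) * exp ((p - q) * z) + M * a powr q"
    unfolding exp_xi_m[OF assms(1)] by simp
  then show "\<exists>y. DERIV f z :> y \<and> 0 < y"
    using f_has_derivative[of z] q_bounds by (meson exp_gt_zero mult_pos_pos)
qed (meson f_has_derivative DERIV_continuous continuous_at_imp_continuous_on)

lemma f_ge_f_xi_m: "M < 0 \<Longrightarrow> f \<xi>m \<le> f \<xi>" "M < 0 \<Longrightarrow> \<xi> \<noteq> \<xi>m \<Longrightarrow> f \<xi>m < f \<xi>"
proof -
  show "f \<xi>m < f \<xi>" if "M < 0" "\<xi> \<noteq> \<xi>m" for \<xi>
    using f_increasing[of "\<xi>m" \<xi>] f_decreasing[of \<xi> "\<xi>m"] that by (cases "\<xi> < \<xi>m") auto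
  then show "M < 0 \<Longrightarrow> f \<xi>m \<le> f \<xi>" by (cases "\<xi> = \<xi>m") (auto intro: less_imp_le)
qed

text \<open>At the minimum the vanishing derivative turns the \<open>M\<close> term into
  \<open>- (p + 1) * exp ((p - 1) * \<xi>m)\<close>, leaving
  \<open>a * \<kappa> - p * exp ((p - 1) * \<xi>m)\<close>; that exponential is a power of
  \<open>- M / (p + 1)\<close> because \<open>p - 1 = (p - q) * ((p + 1) / p)\<close>.\<close>

lemma f_xi_m:
  assumes "M < 0"
  shows "f \<xi>m = a * a * ((1 - \<theta>) - p * (- M / (p + 1)) powr ((p + 1) / p))"
proof -
  have "exp ((p - 1) * \<xi>m) = exp ((p - q) * \<xi>m) powr ((p + 1) / p)"
    using p_minus_q(3) by (simp add: powr_def mult_ac)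
  also have "exp ((p - q) * \<xi>m) = (- M / (p + 1)) * a powr q"
    using exp_xi_m[OF assms] p by (simp add: field_simps)
  also have "\<dots> powr ((p + 1) / p) = (- M / (p + 1)) powr ((p + 1) / p) * (a * a)"
  proof -
    have "(a powr q) powr ((p + 1) / p) = a * a"
      using p a_pos by (simp add: powr_powr q_def power2_eq_square)
    moreover have "0 < - M / (p + 1)" using assms p by (simp add: divide_less_0_iff)
    ultimately show ?thesis by (subst powr_mult) auto
  qed
  finally have 1: "exp ((p - 1) * \<xi>m) = (- M / (p + 1)) powr ((p + 1) / p) * (a * a)" .
  have "exp ((p - 1) * \<xi>m) = exp ((q - 1) * \<xi>m) * exp ((p - q) * \<xi>m)"
    by (simp add: algebra_simps flip: exp_add)
  moreover have "M * a powr q = - ((p + 1) * exp ((p - q) * \<xi>m))"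
    using exp_xi_m[OF assms] by simp
  ultimately have "M * a powr q * exp ((q - 1) * \<xi>m) = - (p + 1) * exp ((p - 1) * \<xi>m)"
    by (simp only: mult_minus_left mult_minus_right mult_ac)
  then have "f \<xi>m = a * \<kappa> - p * exp ((p - 1) * \<xi>m)"
    unfolding f_eq by (simp add: algebra_simps)
  then show ?thesis unfolding 1 kappa_eq by (simp add: algebra_simps)
qed

lemma mu_threshold:
  assumes "M < 0"
  shows "M < - \<mu> \<Longrightarrow> f \<xi>m < 0" "- \<mu> \<le> M \<Longrightarrow> 0 \<le> f \<xi>m"
proof -
  define w where "w = - M / (p + 1)"
  define v where "v = ((1 - \<theta>) / p) powr (p / (p + 1))"
  have w: "0 < w" "M = - ((p + 1) * w)" using assms p by (auto simp: w_def divide_less_0_iff)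
  have v: "0 < v" "\<mu> = (p + 1) * v" "v powr ((p + 1) / p) = (1 - \<theta>) / p"
    using theta p by (auto simp: v_def \<mu>_def powr_powr)
  have r: "0 < (p + 1) / p" using p by simp
  have fm: "f \<xi>m = a * a * p * (v powr ((p + 1) / p) - w powr ((p + 1) / p))"
  proof -
    have "1 - \<theta> = p * v powr ((p + 1) / p)" using p by (simp add: v(3))
    then show ?thesis unfolding f_xi_m[OF assms] w_def[symmetric] by (simp only: right_diff_distrib mult.assoc)
  qed
  have ap: "0 < a * a * p" using a_pos p by simp
  have p1: "0 < p + 1" using p by simp
  have c: "M < - \<mu> \<longleftrightarrow> v < w" "- \<mu> \<le> M \<longleftrightarrow> w \<le> v"
    unfolding w(2) v(2) using p1 by auto
  show "M < - \<mu> \<Longrightarrow> f \<xi>m < 0"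
    unfolding fm c using ap powr_less_mono2[OF r] v(1) w(1) by (auto intro!: mult_pos_neg)
  show "- \<mu> \<le> M \<Longrightarrow> 0 \<le> f \<xi>m"
    unfolding fm c using ap powr_mono2[of "(p + 1) / p"] r v(1) w(1) by auto
qed

text \<open>Past the threshold \<open>exp ((p - q) * \<xi>)\<close>, being at least
  \<open>(p - q) * \<xi>\<close>, outweighs the \<open>M\<close> term by \<open>C\<close>. The
  margin is left free: 0 serves for positivity, \<open>a\<^sup>2 + 1\<close> for a guaranteed speed
  of \<open>S\<close>.\<close>

lemma f_large:
  assumes "0 \<le> C" "(C - M * a powr q) / (p - q) \<le> \<xi>"
  shows "a * \<kappa> + C \<le> f \<xi>"
proof -
  have "0 \<le> - M * a powr q" using M_nonpos by (intro mult_nonneg_nonneg) auto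
  then have "0 \<le> \<xi>" using assms p_minus_q(1) by (smt (verit) divide_nonneg_pos mult_minus_left)
  then have e: "1 \<le> exp ((q - 1) * \<xi>)" using q_bounds by simp
  have "C - M * a powr q \<le> (p - q) * \<xi>" using assms p_minus_q(1) by (simp add: field_simps)
  also have "\<dots> \<le> exp ((p - q) * \<xi>)" using exp_ge_add_one_self[of "(p - q) * \<xi>"] by linarith
  finally have "1 * C \<le> exp ((q - 1) * \<xi>) * (exp ((p - q) * \<xi>) + M * a powr q)"
    using e assms(1) by (intro mult_mono) auto
  moreover have "exp ((p - 1) * \<xi>) = exp ((q - 1) * \<xi>) * exp ((p - q) * \<xi>)"
    by (simp add: algebra_simps flip: exp_add)
  ultimately show ?thesis unfolding f_eq by (simp add: algebra_simps)
qed

lemma Psi_unbounded: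
  obtains \<xi>b where "\<And>\<xi>. \<xi>b \<le> \<xi> \<Longrightarrow> B < \<Psi> \<xi>"
proof -
  define x where "x = - M * a powr q / (p - q)"
  define k where "k = a powr \<beta> * (a * \<kappa>)"
  have x: "0 \<le> x" using M_nonpos p_minus_q(1) by (simp add: x_def divide_nonpos_pos mult_nonpos_nonneg)
  have k: "0 < k" using a_pos kappa_pos by (simp add: k_def)
  have lin: "\<Psi> x - k * x \<le> \<Psi> \<xi> - k * \<xi>" if "x \<le> \<xi>" for \<xi>
  proof (rule DERIV_nonneg_imp_nondecreasing[OF that, of "\<lambda>\<xi>. \<Psi> \<xi> - k * \<xi>"])
    fix y assume y: "x \<le> y" "y \<le> \<xi>"
    have "DERIV (\<lambda>\<xi>. \<Psi> \<xi> - k * \<xi>) y :> a powr \<beta> * exp (c * y) * f y - k"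
      by (auto intro!: derivative_eq_intros Psi_has_derivative)
    moreover have "1 * (a * \<kappa>) \<le> exp (c * y) * f y"
      using f_large[of 0 y] x y c_pos a_pos kappa_pos by (intro mult_mono) (auto simp: x_def)
    then have "k \<le> a powr \<beta> * (exp (c * y) * f y)"
      unfolding k_def by (intro mult_left_mono) auto
    then have "0 \<le> a powr \<beta> * exp (c * y) * f y - k" by (simp add: mult.assoc)
    ultimately show "\<exists>z. DERIV (\<lambda>\<xi>. \<Psi> \<xi> - k * \<xi>) y :> z \<and> 0 \<le> z"
      by blast
  qed
  show ?thesis
  proof (rule that[of "max x (x + (B - \<Psi> x) / k + 1)"])
    fix \<xi> assume \<xi>: "max x (x + (B - \<Psi> x) / k + 1) \<le> \<xi>"
    then have "(B - \<Psi> x) / k < \<xi> - x" by simp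
    then have "B - \<Psi> x < k * (\<xi> - x)" using k by (simp add: field_simps)
    with lin[of \<xi>] \<xi> show "B < \<Psi> \<xi>" by (simp add: algebra_simps)
  qed
qed

lemma f_two_roots:
  assumes "M < - \<mu>"
  obtains \<xi>1 \<xi>2 where "\<xi>1 < \<xi>m" "\<xi>m < \<xi>2" "f \<xi>1 = 0" "f \<xi>2 = 0"
    "\<And>\<xi>. \<xi> < \<xi>1 \<Longrightarrow> 0 < f \<xi>" "\<And>\<xi>. \<xi>1 < \<xi> \<Longrightarrow> \<xi> < \<xi>2 \<Longrightarrow> f \<xi> < 0" "\<And>\<xi>. \<xi>2 < \<xi> \<Longrightarrow> 0 < f \<xi>"
proof -
  have "0 \<le> \<mu>" using p theta by (simp add: \<mu>_def)
  then have M: "M < 0" using assms by simp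
  have fm: "f \<xi>m < 0" using mu_threshold(1)[OF M assms] .
  have contf: "continuous_on X f" for X
    by (meson f_has_derivative DERIV_continuous continuous_at_imp_continuous_on)
  define y where "y = max \<xi>m (- M * a powr q / (p - q))"
  have fy: "0 < f y" using f_large[of 0 y] mult_pos_pos[OF a_pos kappa_pos] by (simp add: y_def)
  obtain x2 where x2: "\<xi>m \<le> x2" "x2 \<le> y" "f x2 = 0"
    using IVT'[of f "\<xi>m" 0 y] fm fy contf[of "{\<xi>m..y}"] max.cobounded1[of "\<xi>m"]
    unfolding y_def[symmetric] by (metis less_eq_real_def y_def)
  \<comment> \<open>At \<open>w\<close> the constant and the \<open>M\<close> term of
    \<open>f\<close> cancel and only a positive exponential is left. Were \<open>w\<close> not to
    the left of \<open>\<xi>m\<close>, the same comparison would make \<open>f \<xi>m\<close>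
    positive.\<close>
  define w where "w = ln (a * \<kappa> / (- M * a powr q)) / (q - 1)"
  have "0 < a * \<kappa> / (- M * a powr q)" using M a_pos kappa_pos by (simp add: divide_less_0_iff mult_neg_pos)
  then have "exp ((q - 1) * w) = a * \<kappa> / (- M * a powr q)" using q_bounds by (simp add: w_def)
  then have "a * \<kappa> + M * a powr q * exp ((q - 1) * w) = 0" using M a_pos by simp
  then have fw: "0 < f w" unfolding f_eq using exp_gt_zero[of "(p - 1) * w"] by linarith
  have "0 < f (min w \<xi>m)"
  proof (cases "w < \<xi>m")
    case False
    have "exp ((q - 1) * \<xi>m) \<le> exp ((q - 1) * w)" using False q_bounds by simp
    then have "M * a powr q * exp ((q - 1) * w) \<le> M * a powr q * exp ((q - 1) * \<xi>m)"
      using M by (intro mult_left_mono_neg) (auto simp: mult_nonpos_nonneg)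
    with \<open>a * \<kappa> + M * a powr q * exp ((q - 1) * w) = 0\<close> have "0 < f \<xi>m"
      unfolding f_eq using exp_gt_zero[of "(p - 1) * \<xi>m"] by linarith
    with fm show ?thesis by simp
  qed (use fw in auto)
  then obtain x1 where x1: "x1 \<le> \<xi>m" "f x1 = 0"
    using IVT2'[OF less_imp_le[OF fm] less_imp_le min.cobounded2 contf] by blast
  have lt: "x1 < \<xi>m" "\<xi>m < x2" using x1 x2 fm by (auto simp: less_le)
  show ?thesis
  proof (rule that[OF lt x1(2) x2(3)])
    show "0 < f \<xi>" if "\<xi> < x1" for \<xi> using f_decreasing[OF M that] x1 by auto
    show "0 < f \<xi>" if "x2 < \<xi>" for \<xi> using f_increasing[OF M that] x2 by auto
    show "f \<xi> < 0" if "x1 < \<xi>" "\<xi> < x2" for \<xi>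
      using f_decreasing[OF M that(1)] f_increasing[OF M that(2)] x1 x2 by (cases "\<xi> \<le> \<xi>m") auto
  qed
qed

end

section \<open>Non-existence of regular trajectories\<close>

lemma first_hit_from_above:
  fixes g :: "real \<Rightarrow> real"
  assumes "continuous_on {s..t} g" "s \<le> t" "c < g s" "g t \<le> c"
  obtains r where "s < r" "r \<le> t" "g r = c" "\<And>x. s \<le> x \<Longrightarrow> x < r \<Longrightarrow> c < g x"
proof -
  define Z where "Z = {x \<in> {s..t}. g x = c}"
  have "closed Z" unfolding Z_def using assms(1) by (intro continuous_closed_preimage_constant) auto
  then have "compact ({s..t} \<inter> Z)" by (intro compact_Int_closed) auto
  moreover have "{s..t} \<inter> Z = Z" unfolding Z_def by blast
  ultimately have cZ: "compact Z" by simp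
  obtain x where "s \<le> x" "x \<le> t" "g x = c"
    using IVT2'[OF assms(4) less_imp_le[OF assms(3)] assms(2,1)] by blast
  then have "Z \<noteq> {}" unfolding Z_def by auto
  then obtain r where r: "r \<in> Z" "\<And>x. x \<in> Z \<Longrightarrow> r \<le> x"
    using compact_attains_inf[OF cZ] by metis
  show ?thesis
  proof (rule that[of r])
    show "s < r" "r \<le> t" "g r = c" using r(1) assms(3) by (auto simp: Z_def less_le)
    show "c < g x" if x: "s \<le> x" "x < r" for x
    proof (rule ccontr)
      assume "\<not> c < g x"
      moreover have "continuous_on {s..x} g"
        using x \<open>r \<le> t\<close> by (intro continuous_on_subset[OF assms(1)]) auto
      ultimately obtain y where "s \<le> y" "y \<le> x" "g y = c"
        using IVT2'[of g x c s] assms(3) x by (metis less_imp_le not_less)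
      then show False using r(2)[of y] x \<open>r \<le> t\<close> by (auto simp: Z_def)
    qed
  qed
qed

lemma first_hit_from_below:
  fixes g :: "real \<Rightarrow> real"
  assumes "continuous_on {s..t} g" "s \<le> t" "g s < c" "c \<le> g t"
  obtains r where "s < r" "r \<le> t" "g r = c" "\<And>x. s \<le> x \<Longrightarrow> x < r \<Longrightarrow> g x < c"
  using first_hit_from_above[of s t "\<lambda>x. - g x" "- c"] assms
  by (metis continuous_on_minus neg_less_iff_less neg_le_iff_le neg_equal_iff_equal)

lemma growth_le_of_derivative_le:
  fixes g :: "real \<Rightarrow> real"
  assumes "s \<le> t" "\<And>x. s \<le> x \<Longrightarrow> x \<le> t \<Longrightarrow> DERIV g x :> g' x"
    "\<And>x. s \<le> x \<Longrightarrow> x \<le> t \<Longrightarrow> g' x \<le> k"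
  shows "g t - g s \<le> k * (t - s)"
proof -
  have "k * s - g s \<le> k * t - g t"
  proof (rule DERIV_nonneg_imp_nondecreasing[OF assms(1), of "\<lambda>x. k * x - g x"])
    fix x assume x: "s \<le> x" "x \<le> t"
    have "DERIV (\<lambda>x. k * x - g x) x :> k - g' x"
      by (auto intro!: derivative_eq_intros assms(2) x)
    then show "\<exists>y. DERIV (\<lambda>x. k * x - g x) x :> y \<and> 0 \<le> y"
      using assms(3)[OF x] by (metis diff_ge_0_iff_ge)
  qed
  then show ?thesis by (simp add: algebra_simps)
qed

lemma mono_bounded_tendsto_at_top:
  fixes g :: "real \<Rightarrow> real"
  assumes mono: "\<And>s t. t0 \<le> s \<Longrightarrow> s \<le> t \<Longrightarrow> g s \<le> g t" and bd: "\<And>t. t0 \<le> t \<Longrightarrow> g t \<le> B"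
  obtains l where "(g \<longlongrightarrow> l) at_top" "\<And>t. t0 \<le> t \<Longrightarrow> g t \<le> l" "l \<le> B"
proof -
  define l where "l = Sup (g ` {t0..})"
  have bdd: "bdd_above (g ` {t0..})" using bd by (auto simp: bdd_above_def)
  have le: "g t \<le> l" if "t0 \<le> t" for t
    unfolding l_def using that bdd by (intro cSup_upper) auto
  have "(g \<longlongrightarrow> l) at_top"
  proof (rule increasing_tendsto)
    show "\<forall>\<^sub>F t in at_top. g t \<le> l" using eventually_ge_at_top[of t0] by eventually_elim (rule le)
    fix x assume "x < l"
    then obtain s where s: "t0 \<le> s" "x < g s"
      unfolding l_def using less_cSup_iff[OF _ bdd] by auto
    show "\<forall>\<^sub>F t in at_top. x < g t"
      using eventually_ge_at_top[of s] by eventually_elim (use mono s in force)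
  qed
  moreover have "l \<le> B" unfolding l_def using bd by (intro cSup_least) auto
  ultimately show ?thesis using le that by blast
qed

context emden_fowler
begin

lemma continuous_on_R: "continuous_on X (\<lambda>z. R (fst z) (snd z))"
proof -
  have "continuous_on X (\<lambda>z. \<bar>snd z\<bar> powr q)"
    by (rule continuous_on_powr') (use q_bounds in \<open>auto intro!: continuous_intros\<close>)
  then have "continuous_on X (\<lambda>z. M * \<bar>snd z\<bar> powr q * exp ((q - 1) * fst z))"
    by (rule continuous_on_mult[OF continuous_on_mult_left]) (intro continuous_intros)
  moreover have "continuous_on X (\<lambda>z. (snd z)\<^sup>2 - (n - 2) * snd z + exp ((p - 1) * fst z))"
    by (intro continuous_intros)
  ultimately show ?thesis unfolding R_def by (rule continuous_on_add[rotated])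
qed

lemma continuous_on_Psi: "continuous_on X \<Psi>"
  by (meson Psi_has_derivative DERIV_continuous continuous_at_imp_continuous_on)

lemma continuous_on_E:
  assumes "\<And>z. z \<in> X \<Longrightarrow> 0 \<le> snd z"
  shows "continuous_on X (\<lambda>z. E (fst z) (snd z))"
proof -
  have "continuous_on X (\<lambda>z. h (snd z))"
    by (rule continuous_on_compose2[OF continuous_on_h[of "{0..}"] continuous_on_snd[OF continuous_on_id]])
       (use assms in auto)
  moreover have "continuous_on X (\<lambda>z. \<Psi> (fst z))"
    by (rule continuous_on_compose2[OF continuous_on_Psi[of UNIV] continuous_on_fst[OF continuous_on_id]]) simp
  ultimately show ?thesis unfolding E_def by (intro continuous_intros)
qed

text \<open>In a compact set the velocity is bounded, so the orbit is Lipschitz in time, and every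
  continuous function of it is uniformly continuous in time, as \<open>barbalat\<close>
  demands.\<close>

lemma trajectory_uniformly_continuous:
  assumes I: "convex I" and tr: "\<And>t. t \<in> I \<Longrightarrow> trajectory_at \<xi> S t"
    and K: "compact K" "\<And>t. t \<in> I \<Longrightarrow> (\<xi> t, S t) \<in> K" and G: "continuous_on K G"
  shows "uniformly_continuous_on I (\<lambda>t. G (\<xi> t, S t) :: real)"
proof -
  have "continuous_on K field"
    unfolding field_def by (intro continuous_intros continuous_on_R)
  then have "bounded (field ` K)" using K by (intro compact_imp_bounded compact_continuous_image)
  then obtain C where C: "0 < C" "\<And>z. z \<in> K \<Longrightarrow> norm (field z) \<le> C"
    unfolding bounded_pos by auto
  have "C-lipschitz_on I (\<lambda>t. (\<xi> t, S t))"
  proof (rule bounded_derivative_imp_lipschitz[OF _ I])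
    fix t assume t: "t \<in> I"
    show "((\<lambda>t. (\<xi> t, S t)) has_derivative (\<lambda>x. x *\<^sub>R field (\<xi> t, S t))) (at t within I)"
      using tr[OF t] by (simp add: trajectory_field has_vector_derivative_def has_derivative_at_withinI)
    show "onorm (\<lambda>x. x *\<^sub>R field (\<xi> t, S t)) \<le> C"
      using C(1) C(2)[OF K(2)[OF t]]
      by (intro onorm_bound) (auto simp: mult.commute[of C] intro!: mult_left_mono)
  qed (use C in simp)
  then have "uniformly_continuous_on I (\<lambda>t. (\<xi> t, S t))"
    by (rule lipschitz_on_uniformly_continuous)
  moreover have "uniformly_continuous_on ((\<lambda>t. (\<xi> t, S t)) ` I) G"
    unfolding uniformly_continuous_on_def
  proof (intro allI impI)
    fix e :: real assume "0 < e"
    then obtain r where "0 < r" "\<And>x y. x \<in> K \<Longrightarrow> y \<in> K \<Longrightarrow> dist y x < r \<Longrightarrow> dist (G y) (G x) < e"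
      using compact_uniformly_continuous[OF G K(1)] unfolding uniformly_continuous_on_def by metis
    then show "\<exists>d>0. \<forall>x\<in>(\<lambda>t. (\<xi> t, S t)) ` I. \<forall>y\<in>(\<lambda>t. (\<xi> t, S t)) ` I. dist y x < d \<longrightarrow> dist (G y) (G x) < e"
      using K(2) by (intro exI[of _ r]) auto
  qed
  ultimately show ?thesis using uniformly_continuous_on_compose[of I "\<lambda>t. (\<xi> t, S t)" G] by (simp add: o_def)
qed

text \<open>\<open>barbalat\<close> is used twice: convergence of \<xi> makes \<open>a - S\<close>
  tend to 0, then convergence of \<open>S\<close> makes \<open>R\<close> tend to 0, whose limit is
  \<open>f l\<close>.\<close>

lemma converges_to_equilibrium:
  assumes tr: "\<And>t. t0 \<le> t \<Longrightarrow> trajectory_at \<xi> S t"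
    and K: "compact K" "\<And>t. t0 \<le> t \<Longrightarrow> (\<xi> t, S t) \<in> K" and lim: "(\<xi> \<longlongrightarrow> l) at_top"
  shows "(S \<longlongrightarrow> a) at_top" "f l = 0"
proof -
  have d: "DERIV \<xi> t :> a - S t" "DERIV S t :> R (\<xi> t) (S t)" if "t0 \<le> t" for t
    using tr[OF that] by (auto simp: trajectory_at_def)
  have uc: "uniformly_continuous_on {t0..} (\<lambda>t. G (\<xi> t, S t) :: real)" if "continuous_on K G" for G
    using trajectory_uniformly_continuous[OF _ _ K(1) _ that, of "{t0..}" \<xi> S] tr K(2) by auto
  have "uniformly_continuous_on {t0..} (\<lambda>t. a - S t)"
  proof -
    have "continuous_on K (\<lambda>z. a - snd z)" by (intro continuous_intros)
    from uc[OF this] show ?thesis by simp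
  qed
  from barbalat[OF d(1) lim this] have "((\<lambda>t. a - S t) \<longlongrightarrow> 0) at_top" .
  from tendsto_diff[OF tendsto_const[of a] this] show S: "(S \<longlongrightarrow> a) at_top" by simp
  have "uniformly_continuous_on {t0..} (\<lambda>t. R (\<xi> t) (S t))"
    using uc[OF continuous_on_R] by simp
  from barbalat[OF d(2) S this] have 1: "((\<lambda>t. R (\<xi> t) (S t)) \<longlongrightarrow> 0) at_top" .
  have "isCont (\<lambda>z. R (fst z) (snd z)) (l, a)"
    using continuous_on_R[of UNIV] by (simp add: continuous_on_eq_continuous_at)
  from isCont_tendsto_compose[OF this tendsto_Pair[OF lim S]]
  have "((\<lambda>t. R (\<xi> t) (S t)) \<longlongrightarrow> R l a) at_top" by simp
  with 1 show "f l = 0" unfolding f_def using tendsto_unique[OF trivial_limit_at_top_linorder] by blast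
qed

lemma Psi_increasing:
  assumes "x < y" "\<And>z. x < z \<Longrightarrow> z < y \<Longrightarrow> 0 < f z"
  shows "\<Psi> x < \<Psi> y"
  by (rule DERIV_pos_imp_increasing_open[OF assms(1)])
     (use Psi_has_derivative assms(2) a_pos continuous_on_Psi in \<open>metis exp_gt_zero mult_pos_pos powr_gt_zero less_irrefl\<close>)+

lemma Psi_decreasing:
  assumes "x < y" "\<And>z. x < z \<Longrightarrow> z < y \<Longrightarrow> f z < 0"
  shows "\<Psi> y < \<Psi> x"
  by (rule DERIV_neg_imp_decreasing_open[OF assms(1)])
     (use Psi_has_derivative assms(2) a_pos continuous_on_Psi in \<open>metis exp_gt_zero mult_pos_pos mult_pos_neg powr_gt_zero less_irrefl\<close>)+

text \<open>In terms of \<open>u\<close>, fixing \<open>\<zeta>\<close> means fixing \<open>(u')\<^sup>2 / u powr (p + 1)\<close>: this is the barrier that keeps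
  regular solutions away from the saddle.\<close>

definition "\<zeta> \<xi> S = \<xi> - a * ln (S / a)"

text \<open>With \<open>k = S / a\<close>, the identities \<open>a * (p - 1) = 2\<close> and
  \<open>a * (q - 1) + q = 2\<close> let \<open>k\<^sup>2\<close> be taken out of the quadratic, the
  power and the gradient term together; what is left is \<open>f\<close> at the shifted argument, so
  the sign of \<open>f\<close> governs motion across levels of \<zeta>.\<close>

lemma R_scaled:
  assumes "0 < S"
  shows "R \<xi> S = (S / a)\<^sup>2 * f (\<zeta> \<xi> S) + (n - 2) * (S / a) * (S - a)"
proof -
  define k where "k = S / a"
  have k: "0 < k" "S = k * a" using assms a_pos by (simp_all add: k_def)
  have "(p - 1) * (a * ln k) = 2 * ln k" using a_p by (metis mult.assoc mult.commute)
  then have "exp ((p - 1) * \<zeta> \<xi> S) = exp ((p - 1) * \<xi>) * exp (- 2 * ln k)"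
    unfolding \<zeta>_def k_def[symmetric] exp_add[symmetric] by (simp add: right_diff_distrib)
  also have "exp (- 2 * ln k) = 1 / k\<^sup>2"
    using k by (simp add: exp_minus exp_double divide_inverse)
  finally have 1: "k\<^sup>2 * exp ((p - 1) * \<zeta> \<xi> S) = exp ((p - 1) * \<xi>)" using k by simp
  have "exp ((q - 1) * \<zeta> \<xi> S) = exp ((q - 1) * \<xi>) * exp (- (a * (q - 1)) * ln k)"
    unfolding \<zeta>_def k_def[symmetric] exp_add[symmetric] by (simp add: algebra_simps)
  also have "exp (- (a * (q - 1)) * ln k) = k powr q * exp (- 2 * ln k)"
  proof -
    have "- (a * (q - 1)) = q + - 2" using a_q by simp
    then have "exp (- (a * (q - 1)) * ln k) = exp ((q + - 2) * ln k)" by (simp only:)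
    also have "\<dots> = exp (q * ln k) * exp (- 2 * ln k)"
      by (simp only: distrib_right exp_add)
    finally show ?thesis using k by (simp add: powr_def)
  qed
  also have "exp (- 2 * ln k) = 1 / k\<^sup>2"
    using k by (simp add: exp_minus exp_double divide_inverse)
  finally have 2: "k\<^sup>2 * exp ((q - 1) * \<zeta> \<xi> S) = k powr q * exp ((q - 1) * \<xi>)" using k by simp
  have 3: "\<bar>S\<bar> powr q = k powr q * a powr q" using k a_pos by (simp add: powr_mult)
  have "k\<^sup>2 * f (\<zeta> \<xi> S) = k\<^sup>2 * (a * \<kappa>) + k\<^sup>2 * exp ((p - 1) * \<zeta> \<xi> S)
      + M * a powr q * (k\<^sup>2 * exp ((q - 1) * \<zeta> \<xi> S))"
    unfolding f_eq by (simp add: algebra_simps)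
  also have "\<dots> = k\<^sup>2 * (a * \<kappa>) + exp ((p - 1) * \<xi>) + M * \<bar>S\<bar> powr q * exp ((q - 1) * \<xi>)"
    unfolding 1 2 3 by simp
  finally show ?thesis
    unfolding R_def k_def[symmetric] using k(2) by (simp add: \<kappa>_def power2_eq_square algebra_simps)
qed

lemma zeta_has_derivative:
  assumes "trajectory_at \<xi> S t" "0 < S t"
  shows "DERIV (\<lambda>t. \<zeta> (\<xi> t) (S t)) t :>
    (n - 1) * (a - S t) - S t / a * f (\<zeta> (\<xi> t) (S t))"
proof -
  have d: "DERIV \<xi> t :> a - S t" "DERIV S t :> R (\<xi> t) (S t)"
    using assms by (auto simp: trajectory_at_def)
  have "DERIV (\<lambda>t. ln (S t / a)) t :> (1 / (S t / a)) * (R (\<xi> t) (S t) / a)"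
    using assms a_pos by (auto intro!: derivative_eq_intros d)
  then have "DERIV (\<lambda>t. \<zeta> (\<xi> t) (S t)) t :> (a - S t) - a * ((1 / (S t / a)) * (R (\<xi> t) (S t) / a))"
    unfolding \<zeta>_def by (intro DERIV_diff DERIV_cmult d)
  moreover have "a * ((1 / (S t / a)) * (R (\<xi> t) (S t) / a)) = S t / a * f (\<zeta> (\<xi> t) (S t)) + (n - 2) * (S t - a)"
    unfolding R_scaled[OF assms(2)] using assms(2) a_pos by (simp add: field_simps power2_eq_square)
  ultimately show ?thesis by (elim DERIV_cong) (simp add: algebra_simps)
qed

text \<open>On a level \<open>x\<close> with \<open>f x \<le> 0\<close>, as long as
  \<open>S < a\<close>, the derivative of \<zeta> is positive. Such a level can be crossed only
  upwards, so an orbit that comes from \<zeta> = infinity never reaches it.\<close>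

lemma zeta_barrier:
  assumes tr: "\<And>t. t \<le> T \<Longrightarrow> trajectory_at \<xi> S t" and S: "\<And>t. t \<le> T \<Longrightarrow> 0 < S t" "\<And>t. t \<le> T \<Longrightarrow> S t < a"
    and lim: "filterlim (\<lambda>t. \<zeta> (\<xi> t) (S t)) at_top at_bot" and fx: "f x \<le> 0" and t: "t \<le> T"
  shows "x < \<zeta> (\<xi> t) (S t)"
proof (rule ccontr)
  let ?z = "\<lambda>t. \<zeta> (\<xi> t) (S t)"
  assume "\<not> x < ?z t"
  have d: "DERIV ?z r :> (n - 1) * (a - S r) - S r / a * f (?z r)" if "r \<le> T" for r
    using zeta_has_derivative tr S that by auto
  have "\<forall>\<^sub>F s in at_bot. x < ?z s \<and> s \<le> t"
    using lim unfolding filterlim_at_top_dense by (intro eventually_conj eventually_le_at_bot) auto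
  then obtain s where s: "x < ?z s" "s \<le> t" using eventually_happens'[OF trivial_limit_at_bot_linorder] by blast
  have "continuous_on {s..t} ?z"
    using d t by (intro continuous_at_imp_continuous_on ballI DERIV_isCont[OF d]) auto
  then obtain r where r: "s < r" "r \<le> t" "?z r = x" "\<And>y. s \<le> y \<Longrightarrow> y < r \<Longrightarrow> x < ?z y"
    using first_hit_from_above[of s t ?z x] s \<open>\<not> x < ?z t\<close> by (auto simp: not_less)
  have "0 < (n - 1) * (a - S r)" using n S(2)[of r] r t by simp
  moreover have "S r / a * f (?z r) \<le> 0"
    using S(1)[of r] a_pos fx r t by (intro mult_nonneg_nonpos) auto
  ultimately have "0 < (n - 1) * (a - S r) - S r / a * f (?z r)" by linarith
  from DERIV_pos_inc_left[OF d this] r t obtain e where e: "0 < e" "\<And>h. 0 < h \<Longrightarrow> h < e \<Longrightarrow> ?z (r - h) < ?z r"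
    by auto
  define h where "h = min (e / 2) (r - s)"
  have h: "0 < h" "h < e" "s \<le> r - h" "r - h < r" using e(1) r(1) by (auto simp: h_def)
  show False using e(2)[OF h(1,2)] r(4)[OF h(3,4)] r(3) by simp
qed


text \<open>Here \<open>f\<close> has a double zero, so near \<open>\<xi>m\<close> one has
  \<open>f \<zeta> \<le> \<zeta> - \<xi>m\<close>. With \<open>\<xi> \<le> \<xi>m\<close> and
  \<open>ln y \<le> y - 1\<close> the right-hand side is at most \<open>a * (a / S - 1)\<close>,
  which the friction term \<open>(n - 1) * (a - S)\<close> dominates after multiplication by
  \<open>S / a\<close>. Hence \<zeta> is eventually nondecreasing, yet it lies strictly above its
  limit.\<close>

lemma no_turning_limit:
  assumes tr: "\<And>t. trajectory_at \<xi> S t" and S: "\<And>t. 0 < S t" "\<And>t. S t < a"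
    and z: "filterlim (\<lambda>t. \<zeta> (\<xi> t) (S t)) at_top at_bot"
    and M: "M < 0" and fm: "f \<xi>m = 0"
    and lim: "(\<xi> \<longlongrightarrow> \<xi>m) at_top" "(S \<longlongrightarrow> a) at_top" and le: "\<And>t. \<xi> t \<le> \<xi>m"
  shows False
proof -
  let ?z = "\<lambda>t. \<zeta> (\<xi> t) (S t)"
  have zgt: "\<xi>m < ?z t" for t
    using zeta_barrier[of t \<xi> S "\<xi>m" t] tr S z fm by auto
  have "((\<lambda>t. \<xi> t - a * ln (S t / a)) \<longlongrightarrow> \<xi>m - a * ln (a / a)) at_top"
    by (intro tendsto_intros lim) (use a_pos in auto)
  then have zlim: "(?z \<longlongrightarrow> \<xi>m) at_top" using a_pos by (simp add: \<zeta>_def)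
  have "DERIV f \<xi>m :> 0"
    using f_has_derivative[of "\<xi>m"] exp_xi_m[OF M] by simp
  then have "((\<lambda>y. (f y - f \<xi>m) / (y - \<xi>m)) \<longlongrightarrow> 0) (at \<xi>m)"
    by (simp add: has_field_derivative_iff)
  moreover have "filterlim ?z (at \<xi>m) at_top"
    using zlim zgt by (auto simp: filterlim_at less_imp_neq[symmetric])
  ultimately have "((\<lambda>t. (f (?z t) - f \<xi>m) / (?z t - \<xi>m)) \<longlongrightarrow> 0) at_top"
    by (rule filterlim_compose)
  then have "\<forall>\<^sub>F t in at_top. (f (?z t) - f \<xi>m) / (?z t - \<xi>m) < 1"
    by (rule order_tendstoD) simp
  then obtain t0 where t0: "\<And>t. t0 \<le> t \<Longrightarrow> (f (?z t) - f \<xi>m) / (?z t - \<xi>m) < 1"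
    unfolding eventually_at_top_linorder by blast
  have inc: "?z t0 \<le> ?z t" if "t0 \<le> t" for t
  proof (rule DERIV_nonneg_imp_nondecreasing[OF that, of ?z])
    fix r assume r: "t0 \<le> r" "r \<le> t"
    have "f (?z r) \<le> ?z r - \<xi>m"
      using t0[OF r(1)] zgt[of r] fm by (simp add: divide_less_eq)
    also have "\<dots> \<le> a * ln (a / S r)"
      using le[of r] S(1)[of r] a_pos by (simp add: \<zeta>_def ln_div algebra_simps)
    also have "\<dots> \<le> a * (a / S r - 1)"
      using a_pos S(1)[of r] by (intro mult_left_mono ln_le_minus_one) auto
    finally have "S r / a * f (?z r) \<le> S r / a * (a * (a / S r - 1))"
      using S(1)[of r] a_pos by (intro mult_left_mono) auto
    also have "\<dots> = a - S r" using S(1)[of r] a_pos by (simp add: field_simps)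
    also have "\<dots> \<le> (n - 1) * (a - S r)"
      using mult_right_mono[of 1 "n - 1" "a - S r"] n S(2)[of r] by simp
    finally have "0 \<le> (n - 1) * (a - S r) - S r / a * f (?z r)" by simp
    then show "\<exists>y. DERIV ?z r :> y \<and> 0 \<le> y"
      using zeta_has_derivative[OF tr S(1)] by blast
  qed
  have "?z t0 \<le> \<xi>m"
    by (rule tendsto_lowerbound[OF zlim]) (auto intro!: eventually_at_top_linorderI[of t0] inc)
  with zgt[of t0] show False by simp
qed

lemma equilibrium_trajectory: "f \<xi>0 = 0 \<Longrightarrow> trajectory_at (\<lambda>_. \<xi>0) (\<lambda>_. a) t"
  by (auto simp: trajectory_at_def f_def)

lemma f_sign_cases:
  obtains (pos) "\<And>x. 0 < f x" | (double) "M < 0" "f \<xi>m = 0" | (neg) "M < - \<mu>" "M < 0" "f \<xi>m < 0"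
proof -
  have mu: "0 \<le> \<mu>" using p theta by (simp add: \<mu>_def)
  show ?thesis
  proof (cases "M = 0")
    case True
    then have "0 < f x" for x
      unfolding f_eq using mult_pos_pos[OF a_pos kappa_pos] by (simp add: add_pos_pos)
    then show ?thesis by (rule pos)
  next
    case False
    then have M: "M < 0" using M_nonpos by simp
    consider "f \<xi>m = 0" | "f \<xi>m < 0" | "0 < f \<xi>m" by linarith
    then show ?thesis
    proof cases
      case 2
      then have "M < - \<mu>" using mu_threshold(2)[OF M] by (meson not_less)
      then show ?thesis using 2 M neg by blast
    next
      case 3
      then have "0 < f x" for x using f_ge_f_xi_m(1)[OF M, of x] by linarith
      then show ?thesis by (rule pos)
    qed (use M double in blast)
  qed
qed

section \<open>Orbits of regular solutions\<close>

lemma trajectory_deriv: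
  assumes "trajectory_at \<xi> S t"
  shows "DERIV \<xi> t :> a - S t" "DERIV S t :> R (\<xi> t) (S t)"
    "isCont \<xi> t" "isCont S t"
  using assms DERIV_isCont by (auto simp: trajectory_at_def)

text \<open>The orbit arrives from the far left, so it has passed over \<open>x\<close>, and did so
  with \<open>S < a\<close>, where the kinetic part is positive; from then on the energy only
  grows.\<close>

lemma E_crossing:
  assumes tr: "\<And>t. t \<le> T \<Longrightarrow> trajectory_at \<xi> S t" and S: "\<And>t. t \<le> T \<Longrightarrow> 0 < S t" "\<And>t. t < T \<Longrightarrow> S t < a"
    and xi: "filterlim \<xi> at_bot at_bot" and x: "x < \<xi> T"
  shows "\<Psi> x < E (\<xi> T) (S T)"
proof -
  have "\<forall>\<^sub>F s in at_bot. \<xi> s < x \<and> s \<le> T"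
    using xi unfolding filterlim_at_bot_dense by (intro eventually_conj eventually_le_at_bot) auto
  then obtain s where s: "\<xi> s < x" "s \<le> T" using eventually_happens'[OF trivial_limit_at_bot_linorder] by blast
  have "continuous_on {s..T} \<xi>"
    using tr by (intro continuous_at_imp_continuous_on ballI trajectory_deriv(3)) auto
  then obtain r where r: "s \<le> r" "r \<le> T" "\<xi> r = x" using IVT'[of \<xi> s x T] s x by auto
  have "r < T" using r x by (auto simp: less_le)
  then have "\<Psi> x < E (\<xi> r) (S r)" using E_gt_Psi[of "S r" "\<xi> r"] S(1)[of r] S(2)[of r] r by auto
  also have "\<dots> \<le> E (\<xi> T) (S T)" using r tr S(1) by (intro E_mono) auto
  finally show ?thesis .
qed

text \<open>Otherwise \<xi> increases for ever. If it is unbounded, \<open>f\<close> becomes so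
  large that \<open>S\<close> rises past \<open>a\<close>. If it is bounded, its limit is a zero of
  \<open>f\<close>: a double zero is excluded by \<open>no_turning_limit\<close>, the saddle by the
  barrier, and the source because its potential lies below that of the saddle already
  passed.\<close>

lemma reaches_turning_point:
  assumes tr: "\<And>t. trajectory_at \<xi> S t" and S: "\<And>t. 0 < S t"
    and xi: "filterlim \<xi> at_bot at_bot" and z: "filterlim (\<lambda>t. \<zeta> (\<xi> t) (S t)) at_top at_bot"
  shows "\<exists>t. a \<le> S t"
proof (rule ccontr)
  assume "\<not> (\<exists>t. a \<le> S t)"
  then have lt: "S t < a" for t by (simp add: not_le)
  note d = trajectory_deriv[OF tr]
  have inc: "\<xi> s < \<xi> t" if "s < t" for s t
    by (rule DERIV_pos_imp_increasing[OF that]) (use d(1) lt in \<open>meson diff_gt_0_iff_gt\<close>)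
  have "\<exists>B. \<forall>t. \<xi> t \<le> B"
  proof (rule ccontr)
    assume "\<nexists>B. \<forall>t. \<xi> t \<le> B"
    \<comment> \<open>Of the margin \<open>a\<^sup>2 + 1\<close>, the square pays for the loss
      \<open>S\<^sup>2 - a\<^sup>2\<close> in passing from \<open>f\<close> to \<open>R\<close>, and
      1 is left as a speed for \<open>S\<close>. Starting from a positive value, \<open>S\<close>
      then exceeds \<open>a\<close> after time \<open>a\<close>.\<close>
    then obtain t0 where t0: "(a\<^sup>2 + 1 - M * a powr q) / (p - q) < \<xi> t0" by (metis not_le)
    define t where "t = t0 + a"
    have "S t0 + 1 * (t - t0) \<le> S t"
    proof -
      have "- S t - (- S t0) \<le> (- 1) * (t - t0)"
      proof (rule growth_le_of_derivative_le[of t0 t "\<lambda>t. - S t" "\<lambda>t. - R (\<xi> t) (S t)"])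
        fix x assume x: "t0 \<le> x"
        then have "\<xi> t0 \<le> \<xi> x" using inc[of t0 x] by (cases "x = t0") auto
        then have "a\<^sup>2 + 1 \<le> f (\<xi> x)"
          using f_large[of "a\<^sup>2 + 1" "\<xi> x"] t0 mult_pos_pos[OF a_pos kappa_pos] by simp
        moreover have "R (\<xi> x) (S x) - f (\<xi> x) = (S x)\<^sup>2 - a\<^sup>2 + (n - 2) * (a - S x)
            + (- M) * (a powr q - S x powr q) * exp ((q - 1) * \<xi> x)"
          using S[of x] a_pos by (simp add: f_def R_def algebra_simps)
        moreover have "0 \<le> (n - 2) * (a - S x)" using n lt[of x] by simp
        moreover have "0 \<le> (- M) * (a powr q - S x powr q) * exp ((q - 1) * \<xi> x)"
          using M_nonpos lt[of x] S[of x] q_bounds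
          by (intro mult_nonneg_nonneg) (auto intro!: powr_mono2)
        ultimately show "- R (\<xi> x) (S x) \<le> - 1"
          using zero_le_power2[of "S x"] by linarith
      qed (use a_pos d(2) in \<open>auto intro!: derivative_intros simp: t_def\<close>)
      then show ?thesis by simp
    qed
    then show False using S[of t0] lt[of t] by (simp add: t_def)
  qed
  then obtain B where B: "\<And>t. \<xi> t \<le> B" by blast
  have mono: "\<xi> s \<le> \<xi> t" if "s \<le> t" for s t using inc[of s t] that by (cases "s = t") auto
  obtain l where l: "(\<xi> \<longlongrightarrow> l) at_top" "\<And>t. \<xi> t \<le> l"
    using mono_bounded_tendsto_at_top[of 0 \<xi> B] mono B by (metis linear order_trans)
  have K: "compact ({\<xi> 0..l} \<times> {0..a})" by (intro compact_Times) auto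
  have "(\<xi> t, S t) \<in> {\<xi> 0..l} \<times> {0..a}" if "0 \<le> t" for t
    using mono[of 0 t] l(2) S[of t] lt[of t] that by (auto intro: less_imp_le)
  then have "(S \<longlongrightarrow> a) at_top" "f l = 0"
    using converges_to_equilibrium[OF tr K _ l(1), of 0] by blast+
  note Sl = this
  show False
  proof (cases rule: f_sign_cases)
    case pos
    then show False using Sl(2) by (metis less_irrefl)
  next
    case double
    then have "l = \<xi>m" using f_ge_f_xi_m(2)[of l] Sl(2) by (metis less_irrefl)
    then show False using no_turning_limit[OF tr S lt z double] l Sl(1) by simp
  next
    case neg
    obtain \<xi>1 \<xi>2 where r: "\<xi>1 < \<xi>m" "\<xi>m < \<xi>2" "f \<xi>1 = 0" "f \<xi>2 = 0"
      "\<And>\<xi>. \<xi>1 < \<xi> \<Longrightarrow> \<xi> < \<xi>2 \<Longrightarrow> f \<xi> < 0" "\<And>\<xi>. \<xi>2 < \<xi> \<Longrightarrow> 0 < f \<xi>"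
      using f_two_roots[OF neg(1)] by metis
    have "((\<lambda>t. \<xi> t - a * ln (S t / a)) \<longlongrightarrow> l - a * ln (a / a)) at_top"
      by (intro tendsto_intros l Sl(1)) (use a_pos in auto)
    then have zl: "((\<lambda>t. \<zeta> (\<xi> t) (S t)) \<longlongrightarrow> l) at_top" using a_pos by (simp add: \<zeta>_def)
    have "\<xi>m < \<zeta> (\<xi> t) (S t)" for t
      using zeta_barrier[of t \<xi> S "\<xi>m" t] tr S lt z neg(3) by auto
    then have "\<xi>m \<le> l" by (intro tendsto_lowerbound[OF zl]) (auto intro!: always_eventually less_imp_le)
    then have "l = \<xi>2" using r(5)[of l] r(6)[of l] Sl(2) r(1) by (metis less_irrefl neqE order_less_le_trans)
    have "\<forall>\<^sub>F t in at_top. \<xi>1 < \<xi> t" using order_tendstoD(1)[OF l(1), of "\<xi>1"] r \<open>l = \<xi>2\<close> by simp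
    then obtain T where T: "\<And>t. T \<le> t \<Longrightarrow> \<xi>1 < \<xi> t" unfolding eventually_at_top_linorder by blast
    have "\<Psi> \<xi>1 < E (\<xi> T) (S T)" using E_crossing[OF tr S lt xi] T by auto
    moreover have "E (\<xi> T) (S T) \<le> E l a"
    proof (rule tendsto_lowerbound)
      have "continuous_on (UNIV \<times> {0..}) (\<lambda>z. E (fst z) (snd z))" by (rule continuous_on_E) auto
      then have "isCont (\<lambda>z. E (fst z) (snd z)) (l, a)"
        using a_pos by (elim continuous_on_interior) (simp add: interior_Times)
      from isCont_tendsto_compose[OF this tendsto_Pair[OF l(1) Sl(1)]]
      show "((\<lambda>t. E (\<xi> t) (S t)) \<longlongrightarrow> E l a) at_top" by simp
      show "\<forall>\<^sub>F t in at_top. E (\<xi> T) (S T) \<le> E (\<xi> t) (S t)"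
        using tr S by (auto intro!: eventually_at_top_linorderI[of T] E_mono)
    qed simp
    moreover have "\<Psi> \<xi>2 < \<Psi> \<xi>1" using r by (intro Psi_decreasing) auto
    ultimately show False using \<open>l = \<xi>2\<close> by (simp add: E_a)
  qed
qed

text \<open>After the turning point the orbit cannot return to \<open>S = a\<close>: its energy
  would there equal the potential at a point further left, below the level already attained. The
  energy surplus \<delta> forces \<open>S\<close> to grow at least like
  \<open>exp (- \<gamma> * \<xi>)\<close>, so that \<open>exp (\<gamma> * \<xi>)\<close> would be
  used up in finite time, whereas the trajectory is defined for all times.\<close>

lemma no_regular_trajectory:
  assumes tr: "\<And>t. trajectory_at \<xi> S t" and S: "\<And>t. 0 < S t"
    and xi: "filterlim \<xi> at_bot at_bot" and S0: "(S \<longlongrightarrow> 0) at_bot"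
    and z: "filterlim (\<lambda>t. \<zeta> (\<xi> t) (S t)) at_top at_bot"
  shows False
proof -
  note d = trajectory_deriv[OF tr]
  obtain t' where t': "a \<le> S t'" using reaches_turning_point[OF tr S xi z] by blast
  have "\<forall>\<^sub>F s in at_bot. S s < a" using order_tendstoD(2)[OF S0 a_pos] .
  then obtain s0 where s0: "\<And>s. s \<le> s0 \<Longrightarrow> S s < a" unfolding eventually_at_bot_linorder by blast
  have contS: "continuous_on X S" for X using d(4) by (simp add: continuous_at_imp_continuous_on)
  have "s0 \<le> t'" using s0[of t'] t' by linarith
  then obtain t0 where t0: "s0 < t0" "S t0 = a" "\<And>x. s0 \<le> x \<Longrightarrow> x < t0 \<Longrightarrow> S x < a"
    using first_hit_from_below[OF contS \<open>s0 \<le> t'\<close> s0[OF order.refl] t'] by metis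
  have lt: "S t < a" if "t < t0" for t using s0[of t] t0(3)[of t] that by (cases "t \<le> s0") auto
  define \<xi>0 where "\<xi>0 = \<xi> t0"
  \<comment> \<open>\<open>S\<close> reaches \<open>a\<close> from below, so its derivative there is
    not negative; if it were 0 the orbit would be an equilibrium.\<close>
  have f0: "0 < f \<xi>0"
  proof (rule ccontr)
    assume "\<not> 0 < f \<xi>0"
    moreover have "f \<xi>0 \<noteq> 0"
    proof
      assume "f \<xi>0 = 0"
      from trajectory_unique[OF tr equilibrium_trajectory[OF this], of t0 s0] t0(2) s0[of s0]
      show False by (simp add: \<xi>0_def)
    qed
    ultimately have "R (\<xi> t0) (S t0) < 0" by (simp add: t0(2) f_def \<xi>0_def)
    from DERIV_neg_dec_left[OF d(2) this] obtain e where e: "0 < e" "\<And>h. 0 < h \<Longrightarrow> h < e \<Longrightarrow> S t0 < S (t0 - h)"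
      by auto
    from e(2)[of "e / 2"] lt[of "t0 - e / 2"] e(1) t0(2) show False by simp
  qed
  \<comment> \<open>The turning point lies higher than everything to its left. With two equilibria
    the only competing maximum of the potential is the saddle, and \<open>E_crossing\<close> puts
    its level below.\<close>
  have Psi0: "\<Psi> x < \<Psi> \<xi>0" if x: "x < \<xi>0" for x
  proof -
    \<comment> \<open>At \<open>S = a\<close> the quantity \<zeta> is \<xi> itself, so in the limit
      the barrier at \<open>\<xi>m\<close> becomes a lower bound for the position of the turning
      point.\<close>
    have zt0: "\<xi>m \<le> \<xi>0" if fm: "f \<xi>m \<le> 0"
    proof -
      let ?z = "\<lambda>t. \<zeta> (\<xi> t) (S t)"
      have "isCont ?z t0" using DERIV_isCont[OF zeta_has_derivative[OF tr S]] .
      then have "(?z \<longlongrightarrow> ?z t0) (at_left t0)"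
        unfolding isCont_def by (rule tendsto_within_subset) simp
      moreover have "\<forall>\<^sub>F t in at_left t0. \<xi>m \<le> ?z t"
        unfolding eventually_at_left_field
      proof (intro exI[of _ "t0 - 1"] conjI allI impI)
        fix y assume y: "y < t0"
        have "\<xi>m < ?z y" by (rule zeta_barrier[of y \<xi> S, OF tr S _ z fm]) (use lt y in auto)
        then show "\<xi>m \<le> ?z y" by simp
      qed simp
      ultimately have "\<xi>m \<le> ?z t0" by (rule tendsto_lowerbound) simp
      then show ?thesis using a_pos by (simp add: \<zeta>_def t0(2) \<xi>0_def)
    qed
    show ?thesis
    proof (cases rule: f_sign_cases)
      case pos
      then show ?thesis using Psi_increasing[OF x] by blast
    next
      case double
      have ne: "\<xi>m < \<xi>0" using zt0 double f0 by (metis order.refl order_le_imp_less_or_eq less_irrefl)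
      have fpos: "0 < f y" if "y \<noteq> \<xi>m" for y using f_ge_f_xi_m(2)[OF double(1) that] double by simp
      have 1: "\<Psi> y < \<Psi> \<xi>0" if "\<xi>m \<le> y" "y < \<xi>0" for y
        using that by (intro Psi_increasing fpos) auto
      show ?thesis
      proof (cases "\<xi>m \<le> x")
        case False
        then have "\<Psi> x < \<Psi> \<xi>m" by (intro Psi_increasing fpos) auto
        then show ?thesis using 1[of "\<xi>m"] ne by simp
      qed (use 1 x in auto)
    next
      case neg
      obtain \<xi>1 \<xi>2 where r: "\<xi>1 < \<xi>m" "\<xi>m < \<xi>2" "f \<xi>1 = 0" "f \<xi>2 = 0" "\<And>\<xi>. \<xi> < \<xi>1 \<Longrightarrow> 0 < f \<xi>"
        "\<And>\<xi>. \<xi>1 < \<xi> \<Longrightarrow> \<xi> < \<xi>2 \<Longrightarrow> f \<xi> < 0" "\<And>\<xi>. \<xi>2 < \<xi> \<Longrightarrow> 0 < f \<xi>"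
        using f_two_roots[OF neg(1)] by metis
      have "\<xi>m \<le> \<xi>0" using zt0 neg(3) by simp
      then have "\<xi>2 < \<xi>0" using r(6)[of "\<xi>0"] f0 r(1,4) by (metis less_asym' neqE order_less_le_trans less_irrefl)
      have "\<Psi> \<xi>1 < E (\<xi> t0) (S t0)"
        by (rule E_crossing[OF tr S lt xi]) (use r \<open>\<xi>2 < \<xi>0\<close> in \<open>auto simp: \<xi>0_def\<close>)
      then have 1: "\<Psi> \<xi>1 < \<Psi> \<xi>0" by (simp add: t0(2) E_a \<xi>0_def)
      consider "x < \<xi>1" | "x = \<xi>1" | "\<xi>1 < x" "x \<le> \<xi>2" | "\<xi>2 < x" by linarith
      then show ?thesis
      proof cases
        case 1
        then have "\<Psi> x < \<Psi> \<xi>1" by (intro Psi_increasing r) auto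
        then show ?thesis using \<open>\<Psi> \<xi>1 < \<Psi> \<xi>0\<close> by simp
      next
        case 3
        then have "\<Psi> x < \<Psi> \<xi>1" by (intro Psi_decreasing r) auto
        then show ?thesis using \<open>\<Psi> \<xi>1 < \<Psi> \<xi>0\<close> by simp
      next
        case 4
        then show ?thesis using x by (intro Psi_increasing r) auto
      qed (use 1 in simp)
    qed
  qed
  have Emono: "E (\<xi> s) (S s) \<le> E (\<xi> t) (S t)" if "s \<le> t" for s t
    using that tr S by (intro E_mono) auto
  have E0: "E (\<xi> t0) (S t0) = \<Psi> \<xi>0" by (simp add: t0(2) E_a \<xi>0_def)
  have "0 < R (\<xi> t0) (S t0)" using f0 by (simp add: t0(2) f_def \<xi>0_def)
  from DERIV_pos_inc_right[OF d(2) this] obtain e where e: "0 < e" "\<And>h. 0 < h \<Longrightarrow> h < e \<Longrightarrow> S t0 < S (t0 + h)"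
    by auto
  have decr: "\<xi> t < \<xi>0" if "t0 < t" "\<And>r. t0 < r \<Longrightarrow> r < t \<Longrightarrow> a < S r" for t
    unfolding \<xi>0_def
  proof (rule DERIV_neg_imp_decreasing_open[OF that(1)])
    fix x assume "t0 < x" "x < t"
    then show "\<exists>y. DERIV \<xi> x :> y \<and> y < 0"
      using that(2)[of x] d(1)[of x] by (intro exI[of _ "a - S x"]) auto
  qed (use d(3) in \<open>simp add: continuous_at_imp_continuous_on\<close>)
  have gt: "a < S t" if "t0 < t" for t
  proof (rule ccontr)
    assume "\<not> a < S t"
    define s where "s = min (t0 + e / 2) t"
    have "e \<le> t - t0"
    proof (rule ccontr)
      assume "\<not> e \<le> t - t0"
      then show False using e(2)[of "t - t0"] that \<open>\<not> a < S t\<close> t0(2) by simp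
    qed
    then have s: "t0 < s" "s < t0 + e" "s \<le> t" using e(1) by (auto simp: s_def)
    have near: "a < S r" if "t0 < r" "r \<le> s" for r using e(2)[of "r - t0"] that s t0(2) by simp
    obtain r where r: "s < r" "S r = a" "\<And>x. s \<le> x \<Longrightarrow> x < r \<Longrightarrow> a < S x"
      using first_hit_from_above[OF contS s(3) near[OF s(1) order.refl] leI[OF \<open>\<not> a < S t\<close>]] by metis
    have "\<xi> r < \<xi>0"
    proof (rule decr)
      show "a < S x" if "t0 < x" "x < r" for x using near[of x] r(3)[of x] that by (cases "x \<le> s") auto
    qed (use s r in simp)
    then have "E (\<xi> r) (S r) < \<Psi> \<xi>0" using Psi0 by (simp add: r(2) E_a)
    then show False using Emono[of t0 r] E0 s r by simp
  qed
  have xilt: "\<xi> t < \<xi>0" if "t0 < t" for t using decr[OF that] gt by blast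
  define t1 where "t1 = t0 + 1"
  define \<delta> where "\<delta> = E (\<xi> t1) (S t1) - \<Psi> \<xi>0"
  have "E (\<xi> t0) (S t0) < E (\<xi> t1) (S t1)"
  proof (rule DERIV_pos_imp_increasing_open[of t0 t1 "\<lambda>t. E (\<xi> t) (S t)"])
    fix x assume "t0 < x"
    then show "\<exists>y. DERIV (\<lambda>t. E (\<xi> t) (S t)) x :> y \<and> 0 < y"
      using E_along[OF tr[of x] S[of x]] E_along_pos[of "S x" "\<xi> x"] gt[of x] S[of x] by (metis less_imp_le less_irrefl)
  qed (use DERIV_isCont[OF E_along[OF tr S]] in \<open>auto simp: t1_def continuous_at_imp_continuous_on\<close>)
  then have \<delta>: "0 < \<delta>" by (simp add: \<delta>_def E0)
  have hl: "\<delta> * exp (- c * \<xi> t) \<le> h (S t)" if "t1 \<le> t" for t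
  proof -
    have "\<delta> \<le> E (\<xi> t) (S t) - \<Psi> (\<xi> t)"
      using Emono[OF that] Psi0[OF xilt[of t]] that by (simp add: \<delta>_def t1_def)
    also have "\<dots> = exp (c * \<xi> t) * h (S t)" by (simp add: E_def)
    finally show ?thesis by (simp add: exp_minus field_simps)
  qed
  have "isCont h a" using DERIV_isCont[OF h_has_derivative[OF a_pos]] .
  moreover have "0 < \<delta> * exp (- c * \<xi>0)" using \<delta> by simp
  ultimately obtain e' where e': "0 < e'" "\<And>x. \<bar>x - a\<bar> < e' \<Longrightarrow> \<bar>h x\<bar> < \<delta> * exp (- c * \<xi>0)"
    unfolding continuous_at_eps_delta h_a dist_real_def by auto
  \<comment> \<open>\<open>h\<close> vanishes at \<open>a\<close>, so a kinetic part bounded below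
    keeps \<open>S\<close> at least \<eta> above \<open>a\<close>, and \<xi> then decreases at least
    linearly.\<close>
  define \<eta> where "\<eta> = e' / 2"
  have \<eta>: "0 < \<eta>" "h (a + \<eta>) < \<delta> * exp (- c * \<xi>0)"
    using e'(1) e'(2)[of "a + \<eta>"] by (auto simp: \<eta>_def)
  have Sgap: "a + \<eta> \<le> S t" if "t1 \<le> t" for t
  proof (rule ccontr)
    assume "\<not> a + \<eta> \<le> S t"
    then have "h (S t) < h (a + \<eta>)" using gt[of t] that by (intro h_increasing) (auto simp: t1_def)
    moreover have "\<delta> * exp (- c * \<xi>0) \<le> \<delta> * exp (- c * \<xi> t)"
      using \<delta> xilt[of t] that c_pos by (intro mult_left_mono) (auto simp: t1_def)
    ultimately show False using hl[OF that] \<eta>(2) by simp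
  qed
  have lin: "\<xi> t \<le> \<xi> t1 - \<eta> * (t - t1)" if "t1 \<le> t" for t
    using growth_le_of_derivative_le[OF that d(1), of "- \<eta>"] Sgap by fastforce
  \<comment> \<open>Taking the root of order \<open>\<beta> + 2\<close> in \<open>\<delta> * exp (-
    c * \<xi>) \<le> h S \<le> S powr (\<beta> + 2)\<close> produces \<gamma> and \<delta>'.\<close>
  define \<gamma> where "\<gamma> = c / (\<beta> + 2)"
  define \<delta>' where "\<delta>' = \<delta> powr (1 / (\<beta> + 2))"
  have \<gamma>: "0 < \<gamma>" using c_pos beta_pos by (simp add: \<gamma>_def)
  have \<delta>': "0 < \<delta>'" using \<delta> by (simp add: \<delta>'_def)
  have mS: "\<delta>' \<le> exp (\<gamma> * \<xi> t) * S t" if "t1 \<le> t" for t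
  proof -
    have b2: "0 < \<beta> + 2" using beta_pos by simp
    have "\<delta> * exp (- c * \<xi> t) \<le> S t powr (\<beta> + 2)"
      using hl[OF that] h_le_powr[of "S t"] gt[of t] that by (simp add: t1_def)
    then have "(\<delta> * exp (- c * \<xi> t)) powr (1 / (\<beta> + 2)) \<le> (S t powr (\<beta> + 2)) powr (1 / (\<beta> + 2))"
      using \<delta> b2 by (intro powr_mono2) auto
    also have "\<dots> = S t" using S[of t] b2 by (simp add: powr_powr)
    also have "(\<delta> * exp (- c * \<xi> t)) powr (1 / (\<beta> + 2)) = \<delta>' * exp (- \<gamma> * \<xi> t)"
    proof -
      have "ln (\<delta> * exp (- c * \<xi> t)) = ln \<delta> + - c * \<xi> t" using \<delta> by (simp add: ln_mult)
      then show ?thesis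
        using \<delta> by (simp add: \<delta>'_def \<gamma>_def powr_def add_divide_distrib diff_divide_distrib flip: exp_add)
    qed
    finally show ?thesis by (simp add: exp_minus field_simps)
  qed
  \<comment> \<open>From this time on, the linear decay of \<xi> makes the term with
    \<open>a\<close> at most half of the lower bound \<delta>' for the term with
    \<open>S\<close>.\<close>
  define t2 where "t2 = t1 + max 0 ((\<xi> t1 - ln (\<delta>' / (2 * a)) / \<gamma>) / \<eta>)"
  have t12: "t1 \<le> t2" by (simp add: t2_def)
  have small: "exp (\<gamma> * \<xi> t) * a \<le> \<delta>' / 2" if "t2 \<le> t" for t
  proof -
    have "(\<xi> t1 - ln (\<delta>' / (2 * a)) / \<gamma>) / \<eta> \<le> t - t1" using that by (simp add: t2_def)
    then have "\<xi> t1 - ln (\<delta>' / (2 * a)) / \<gamma> \<le> \<eta> * (t - t1)" using \<eta> by (simp add: field_simps)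
    then have "\<xi> t \<le> ln (\<delta>' / (2 * a)) / \<gamma>" using lin[of t] that t12 by linarith
    then have "\<gamma> * \<xi> t \<le> ln (\<delta>' / (2 * a))" using \<gamma> by (simp add: field_simps)
    then have "exp (\<gamma> * \<xi> t) \<le> exp (ln (\<delta>' / (2 * a)))" by simp
    then show ?thesis using \<delta>' a_pos by (simp add: field_simps)
  qed
  \<comment> \<open>From \<open>t2\<close> on \<open>exp (\<gamma> * \<xi>)\<close> falls at a rate
    of at least \<open>\<gamma> * \<delta>' / 2\<close>; \<open>t3\<close> is when nothing would be
    left of its value at \<open>t2\<close>.\<close>
  define t3 where "t3 = t2 + 2 * exp (\<gamma> * \<xi> t2) / (\<gamma> * \<delta>')"
  have t23: "t2 \<le> t3" using \<gamma> \<delta>' by (simp add: t3_def)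
  have "exp (\<gamma> * \<xi> t3) - exp (\<gamma> * \<xi> t2) \<le> (- \<gamma> * \<delta>' / 2) * (t3 - t2)"
  proof (rule growth_le_of_derivative_le[OF t23])
    fix x assume x: "t2 \<le> x" "x \<le> t3"
    show "DERIV (\<lambda>t. exp (\<gamma> * \<xi> t)) x :> \<gamma> * (exp (\<gamma> * \<xi> x) * a - exp (\<gamma> * \<xi> x) * S x)"
      by (auto intro!: derivative_eq_intros d(1) simp: algebra_simps)
    have "exp (\<gamma> * \<xi> x) * a - exp (\<gamma> * \<xi> x) * S x \<le> - (\<delta>' / 2)"
      using small[OF x(1)] mS[of x] x t12 by simp
    then have "\<gamma> * (exp (\<gamma> * \<xi> x) * a - exp (\<gamma> * \<xi> x) * S x) \<le> \<gamma> * - (\<delta>' / 2)"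
      using \<gamma> by (intro mult_left_mono) auto
    then show "\<gamma> * (exp (\<gamma> * \<xi> x) * a - exp (\<gamma> * \<xi> x) * S x) \<le> - \<gamma> * \<delta>' / 2" by simp
  qed
  also have "\<dots> = - exp (\<gamma> * \<xi> t2)" using \<gamma> \<delta>' by (simp add: t3_def)
  finally show False using exp_gt_zero[of "\<gamma> * \<xi> t3"] by linarith
qed

end

section \<open>The heteroclinic trajectory\<close>

lemma barbalat_at_bot:
  fixes g g' :: "real \<Rightarrow> real"
  assumes d: "\<And>t. t \<le> t0 \<Longrightarrow> DERIV g t :> g' t"
    and lim: "(g \<longlongrightarrow> l) at_bot" and uc: "uniformly_continuous_on {..t0} g'"
  shows "(g' \<longlongrightarrow> 0) at_bot"
proof -
  have "((\<lambda>t. - g' (- t)) \<longlongrightarrow> 0) at_top"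
  proof (rule barbalat[of "- t0" "\<lambda>t. g (- t)"])
    show "DERIV (\<lambda>t. g (- t)) t :> - g' (- t)" if "- t0 \<le> t" for t
      using d[of "- t"] that by (simp add: DERIV_mirror)
    show "((\<lambda>t. g (- t)) \<longlongrightarrow> l) at_top" using lim by (simp add: filterlim_at_bot_mirror)
    show "uniformly_continuous_on {- t0..} (\<lambda>t. - g' (- t))"
      unfolding uniformly_continuous_on_def
    proof (intro allI impI)
      fix e :: real assume "0 < e"
      then obtain d where "0 < d" and d: "\<forall>x\<in>{..t0}. \<forall>y\<in>{..t0}. dist y x < d \<longrightarrow> dist (g' y) (g' x) < e"
        using uc unfolding uniformly_continuous_on_def by blast
      have "dist (- g' (- y)) (- g' (- x)) < e" if "x \<in> {- t0..}" "y \<in> {- t0..}" "dist y x < d" for x y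
        using d[rule_format, of "- x" "- y"] that by (simp add: dist_minus)
      then show "\<exists>d>0. \<forall>x\<in>{- t0..}. \<forall>y\<in>{- t0..}. dist y x < d \<longrightarrow> dist (- g' (- y)) (- g' (- x)) < e"
        using \<open>0 < d\<close> by blast
    qed
  qed
  then show ?thesis
    using tendsto_minus[of "\<lambda>t. - g' (- t)" 0 at_top] by (simp add: filterlim_at_bot_mirror)
qed

lemma mono_bounded_tendsto_at_bot:
  fixes g :: "real \<Rightarrow> real"
  assumes mono: "\<And>s t. s \<le> t \<Longrightarrow> t \<le> t0 \<Longrightarrow> g s \<le> g t" and bd: "\<And>t. t \<le> t0 \<Longrightarrow> B \<le> g t"
  obtains l where "(g \<longlongrightarrow> l) at_bot"
proof -
  obtain l where "((\<lambda>t. - g (- t)) \<longlongrightarrow> l) at_top"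
    using mono_bounded_tendsto_at_top[of "- t0" "\<lambda>t. - g (- t)" "- B"] mono bd
    by (metis (no_types, lifting) minus_le_iff neg_le_iff_le)
  then have "(g \<longlongrightarrow> - l) at_bot"
    using tendsto_minus[of "\<lambda>t. - g (- t)" l at_top] by (simp add: filterlim_at_bot_mirror)
  then show ?thesis by (rule that)
qed

context emden_fowler
begin

text \<open>Composition with the projection onto the square makes the field globally Lipschitz, so
  solutions exist for all times; while they stay in the square they are genuine
  trajectories.\<close>

definition "clamped B z = field (max (- B) (min B (fst z)), max (- B) (min B (snd z)))"

lemma clamped_eq: "z \<in> square B \<Longrightarrow> clamped B z = field z"
  by (cases z) (auto simp: clamped_def square_def)

lemma clamped_lipschitz:
  assumes "0 \<le> B"
  obtains L where "L-lipschitz_on UNIV (clamped B)"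
proof -
  have c: "1-lipschitz_on UNIV (\<lambda>x :: real. max (- B) (min B x))"
    by (rule lipschitz_onI) (auto simp: dist_real_def)
  define C where "C z = (max (- B) (min B (fst z)), max (- B) (min B (snd z)))" for z :: "real \<times> real"
  obtain L where L: "L-lipschitz_on (square B) field" using square_lipschitz .
  have "C ` UNIV \<subseteq> square B" using assms by (auto simp: C_def square_def)
  then have L': "L-lipschitz_on (C ` UNIV) field" using L lipschitz_on_subset by blast
  have "(sqrt (1\<^sup>2 + 1\<^sup>2))-lipschitz_on UNIV C"
    unfolding C_def by (intro lipschitz_on_Pair lipschitz_on_of_fst[OF c] lipschitz_on_of_snd[OF c]) auto
  from lipschitz_on_compose[OF this L'] show ?thesis
    using that by (auto simp: clamped_def C_def o_def cong: if_cong)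
qed

lemma continuous_on_D:
  assumes "\<And>z. z \<in> X \<Longrightarrow> 0 \<le> snd z"
  shows "continuous_on X (\<lambda>z. D (fst z) (snd z))"
proof -
  have c: "continuous_on X (\<lambda>z. snd z powr e)" if "0 < e" for e
    using that assms by (intro continuous_on_compose2[OF continuous_on_powr_pos[of "{0..}" e]
        continuous_on_snd[OF continuous_on_id]]) auto
  have e: "continuous_on X (\<lambda>z. exp (k * fst z))" for k
    by (intro continuous_intros)
  have "0 < \<beta> + 2" "0 < \<beta> + q" using beta_pos q_bounds by auto
  then show ?thesis unfolding D_def
    by (intro continuous_on_add continuous_on_mult continuous_on_diff continuous_on_const c e beta_pos)
qed

end

section \<open>Sublevel regions to the right of the saddle\<close>

locale two_equilibria = emden_fowler +
  fixes \<xi>1 \<xi>2 :: real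
  assumes roots: "\<xi>1 < \<xi>2" "f \<xi>1 = 0" "f \<xi>2 = 0"
    and f_neg: "\<And>\<xi>. \<xi>1 < \<xi> \<Longrightarrow> \<xi> < \<xi>2 \<Longrightarrow> f \<xi> < 0"
    and f_pos: "\<And>\<xi>. \<xi>2 < \<xi> \<Longrightarrow> 0 < f \<xi>"
begin

text \<open>For \<open>e < \<Psi> \<xi>1\<close> such a set touches neither the vertical line
  through the saddle nor the axis \<open>S = 0\<close>, so a backward orbit could leave it only
  through its energy level.\<close>

definition "region e = {z. \<xi>1 \<le> fst z \<and> 0 \<le> snd z \<and> E (fst z) (snd z) \<le> e}"

lemma region_mono: "e \<le> e' \<Longrightarrow> region e \<subseteq> region e'"
  by (auto simp: region_def)

lemma region_closed: "closed (region e)"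
proof -
  have "closed (({\<xi>1..} \<times> {0..}) \<inter> (\<lambda>z. E (fst z) (snd z)) -` {..e})"
    by (intro continuous_closed_preimage continuous_on_E closed_Times) auto
  moreover have "({\<xi>1..} \<times> {0..}) \<inter> (\<lambda>z. E (fst z) (snd z)) -` {..e} = region e"
    by (auto simp: region_def)
  ultimately show ?thesis by simp
qed

text \<open>The potential is unbounded to the right, which limits \<xi>; it is bounded below on the
  remaining interval, which limits \<open>exp (c * \<xi>) * h S\<close>, and coercivity of
  \<open>h\<close> then limits \<open>S\<close>.\<close>

lemma region_bounded:
  obtains B where "0 < B" "region (\<Psi> \<xi>1) \<subseteq> {-B<..<B} \<times> {-B<..<B}"
proof -
  obtain b where b: "\<And>\<xi>. b \<le> \<xi> \<Longrightarrow> \<Psi> \<xi>1 < \<Psi> \<xi>" using Psi_unbounded[of "\<Psi> \<xi>1"] by metis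
  have "compact (\<Psi> ` {\<xi>1..b})" by (intro compact_continuous_image continuous_on_Psi) auto
  then have "bounded (\<Psi> ` {\<xi>1..b})" by (rule compact_imp_bounded)
  then obtain m where m: "\<forall>x\<in>\<Psi> ` {\<xi>1..b}. norm x \<le> m"
    unfolding bounded_iff by blast
  define H where "H = (\<Psi> \<xi>1 + m) * exp (- c * \<xi>1)"
  define B where "B = \<bar>\<xi>1\<bar> + \<bar>b\<bar> + a + \<bar>H\<bar> + 2"
  have "z \<in> {-B<..<B} \<times> {-B<..<B}" if "z \<in> region (\<Psi> \<xi>1)" for z
  proof -
    obtain \<xi> S where z: "z = (\<xi>, S)" by (cases z)
    have r: "\<xi>1 \<le> \<xi>" "0 \<le> S" "E \<xi> S \<le> \<Psi> \<xi>1" using that by (auto simp: region_def z)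
    have "\<xi> < b" using b[of \<xi>] E_ge_Psi[OF r(2), of \<xi>] r(3) by (meson not_le order_le_less_trans order_trans)
    then have "- m \<le> \<Psi> \<xi>" using bspec[OF m imageI, of \<xi>] r(1) by (simp add: abs_le_iff)
    then have "exp (c * \<xi>) * h S \<le> \<Psi> \<xi>1 + m" using r(3) by (simp add: E_def)
    moreover have "exp (c * \<xi>1) * h S \<le> exp (c * \<xi>) * h S"
      using r c_pos by (intro mult_right_mono h_nonneg) auto
    ultimately have "exp (c * \<xi>1) * h S \<le> \<Psi> \<xi>1 + m" by simp
    then have "h S \<le> H" unfolding H_def by (simp add: exp_minus field_simps)
    then have "S \<le> a + 1 + \<bar>H\<bar>" using h_ge_linear[of S] by (cases "a + 1 \<le> S") auto
    then show ?thesis using \<open>\<xi> < b\<close> r a_pos by (auto simp: z B_def)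
  qed
  then have "region (\<Psi> \<xi>1) \<subseteq> {-B<..<B} \<times> {-B<..<B}" by blast
  moreover have "0 < B" using a_pos by (simp add: B_def)
  ultimately show ?thesis by (rule that[rotated])
qed

lemma region_compact: "e \<le> \<Psi> \<xi>1 \<Longrightarrow> compact (region e)"
proof -
  assume "e \<le> \<Psi> \<xi>1"
  obtain B where "0 < B" and B: "region (\<Psi> \<xi>1) \<subseteq> {-B<..<B} \<times> {-B<..<B}" using region_bounded .
  have "bounded ({-B<..<B} \<times> {-B<..<B})" by (intro bounded_Times) auto
  then have "bounded (region e)" using B region_mono[OF \<open>e \<le> \<Psi> \<xi>1\<close>] by (meson bounded_subset order_trans)
  then show "compact (region e)" using region_closed compact_eq_bounded_closed by blast
qed

lemma region_pos:
  assumes "z \<in> region (\<Psi> \<xi>1)"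
  shows "0 < snd z"
proof (rule ccontr)
  assume "\<not> 0 < snd z"
  then have "snd z = 0" using assms by (auto simp: region_def)
  then have "E \<xi>1 0 \<le> \<Psi> \<xi>1"
    using assms E_at_0_increasing[of "\<xi>1" "fst z"] by (auto simp: region_def)
  then show False using E_gt_Psi[of 0 "\<xi>1"] a_pos by simp
qed

lemma region_right:
  assumes "z \<in> region e" "e < \<Psi> \<xi>1"
  shows "\<xi>1 < fst z"
proof (rule ccontr)
  assume "\<not> \<xi>1 < fst z"
  then have "fst z = \<xi>1" using assms(1) by (auto simp: region_def)
  then show False using assms E_ge_Psi[of "snd z" "\<xi>1"] by (auto simp: region_def)
qed

text \<open>Backwards in time \<open>E\<close> does not increase. Let \<open>s\<close> be the
  infimum of the times from which the orbit stays inside up to \<open>t0\<close>: closedness puts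
  \<open>z s\<close> in the region, and since the other edges are out of reach the orbit remains
  inside slightly before \<open>s\<close> as well.\<close>

lemma backward_invariant:
  assumes B: "region (\<Psi> \<xi>1) \<subseteq> {-B<..<B} \<times> {-B<..<B}" and e: "e < \<Psi> \<xi>1"
    and z: "\<And>t. (z has_vector_derivative clamped B (z t)) (at t)"
    and z0: "z t0 \<in> region e" and t: "t \<le> t0"
  shows "z t \<in> region e"
proof (rule ccontr)
  assume nt: "z t \<notin> region e"
  have contz: "isCont z r" for r using z has_vector_derivative_continuous by blast
  define A where "A = {s \<in> {t..t0}. \<forall>r\<in>{s..t0}. z r \<in> region e}"
  define s where "s = Inf A"
  have A: "t0 \<in> A" "bdd_below A" using z0 t by (auto simp: A_def bdd_below_def)
  have s: "t \<le> s" "s \<le> t0"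
    unfolding s_def using A by (auto intro!: cInf_greatest cInf_lower simp: A_def)
  have right: "z r \<in> region e" if r: "s < r" "r \<le> t0" for r
  proof -
    have "\<exists>x\<in>A. x < r" using r(1) A(1) unfolding s_def by (intro cInf_lessD) auto
    then show ?thesis using r by (auto simp: A_def)
  qed
  have zs: "z s \<in> region e"
  proof (cases "s = t0")
    case False
    have "(z \<longlongrightarrow> z s) (at_right s)"
      using contz[of s] unfolding isCont_def by (rule tendsto_within_subset) simp
    moreover have "\<forall>\<^sub>F r in at_right s. z r \<in> region e"
      unfolding eventually_at_right_field using right s False by (intro exI[of _ t0]) auto
    ultimately show ?thesis using Lim_in_closed_set[OF region_closed] by (metis trivial_limit_at_right_real)
  qed (use z0 in simp)
  \<comment> \<open>On \<open>U\<close> the side conditions of the region hold strictly and the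
    clamped field is the true one, so \<open>E_mono\<close> is available just before
    \<open>s\<close>.\<close>
  define U where "U = {max \<xi>1 (-B)<..<B} \<times> {max 0 (-B)<..<B}"
  have "open U" unfolding U_def by (intro open_Times) auto
  moreover have "z s \<in> U"
    using zs region_mono[OF less_imp_le[OF e]] region_pos[of "z s"] region_right[OF zs e] B
    unfolding U_def mem_Times_iff by auto
  ultimately have "\<forall>\<^sub>F r in nhds s. z r \<in> U"
    using contz[of s] unfolding isCont_def tendsto_at_iff_tendsto_nhds by (auto dest: topological_tendstoD)
  then obtain d where d: "0 < d" "\<And>r. \<bar>r - s\<bar> < d \<Longrightarrow> z r \<in> U"
    unfolding eventually_nhds_metric dist_real_def by blast
  define x where "x = s - d / 2"
  have good: "z r \<in> region e" if r: "x \<le> r" "r \<le> s" for r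
  proof -
    have U: "z y \<in> U" if "r \<le> y" "y \<le> s" for y using d(2)[of y] that r d(1) by (auto simp: x_def)
    have "E (fst (z r)) (snd (z r)) \<le> E (fst (z s)) (snd (z s))"
    proof (rule E_mono[OF r(2)])
      fix y assume y: "r \<le> y" "y \<le> s"
      show "0 < snd (z y)" using U[OF y] by (auto simp: U_def)
      have "z y \<in> square B" using U[OF y] by (auto simp: U_def square_def)
      then show "trajectory_at (\<lambda>t. fst (z t)) (\<lambda>t. snd (z t)) y"
        using z[of y] by (simp add: trajectory_field clamped_eq)
    qed
    then show ?thesis using U[of r] r zs by (auto simp: region_def U_def)
  qed
  show False
  proof (cases "t < s")
    case True
    define y where "y = max x t"
    have "z r \<in> region e" if "y \<le> r" "r \<le> t0" for r
      using good[of r] right[of r] that by (cases "r \<le> s") (auto simp: y_def)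
    then have "y \<in> A" using True s d(1) by (auto simp: A_def y_def x_def)
    then have "s \<le> y" unfolding s_def using A by (intro cInf_lower) auto
    then show False using True d(1) by (auto simp: y_def x_def)
  qed (use s zs nt in simp)
qed

text \<open>The energy converges, so by \<open>barbalat_at_bot\<close> its rate of change tends to
  0; that rate vanishes only on \<open>S = a\<close>, hence \<open>S\<close> tends to
  \<open>a\<close>. Applied to \<open>S\<close>, the same argument sends \<open>R\<close> to 0,
  which leaves the source as the only candidate.\<close>

lemma backward_limit:
  assumes e: "e < \<Psi> \<xi>1" and tr: "\<And>t. t \<le> t0 \<Longrightarrow> trajectory_at \<xi> S t"
    and reg: "\<And>t. t \<le> t0 \<Longrightarrow> (\<xi> t, S t) \<in> region e"
  shows "(\<xi> \<longlongrightarrow> \<xi>2) at_bot"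
proof -
  let ?K = "region e"
  have K: "compact ?K" using e by (intro region_compact) simp
  have S: "0 < S t" if "t \<le> t0" for t
    using region_pos[of "(\<xi> t, S t)"] region_mono[of e "\<Psi> \<xi>1"] reg[OF that] e by auto
  have nonneg: "0 \<le> snd z" if "z \<in> ?K" for z using that by (simp add: region_def)
  have uc: "uniformly_continuous_on {..t0} (\<lambda>t. G (\<xi> t, S t) :: real)" if "continuous_on ?K G" for G
    using trajectory_uniformly_continuous[OF _ _ K _ that, of "{..t0}" \<xi> S] tr reg by auto
  define P where "P z = (snd z - a) * (exp (c * fst z) * D (fst z) (snd z))" for z
  have contP: "continuous_on ?K P"
    unfolding P_def by (intro continuous_intros continuous_on_D nonneg)
  have "continuous_on ?K (\<lambda>z. E (fst z) (snd z))" using nonneg by (rule continuous_on_E)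
  then have "bounded ((\<lambda>z. E (fst z) (snd z)) ` ?K)"
    using K by (intro compact_imp_bounded compact_continuous_image)
  then obtain m where m: "\<forall>x\<in>(\<lambda>z. E (fst z) (snd z)) ` ?K. norm x \<le> m"
    unfolding bounded_iff by blast
  obtain l where l: "((\<lambda>t. E (\<xi> t) (S t)) \<longlongrightarrow> l) at_bot"
  proof (rule mono_bounded_tendsto_at_bot[of t0 "\<lambda>t. E (\<xi> t) (S t)" "- m"])
    show "E (\<xi> s) (S s) \<le> E (\<xi> t) (S t)" if "s \<le> t" "t \<le> t0" for s t
      using that tr S by (intro E_mono) auto
    show "- m \<le> E (\<xi> t) (S t)" if "t \<le> t0" for t
      using bspec[OF m imageI[OF reg[OF that]]] by (simp add: abs_le_iff)
  qed
  have evK: "\<forall>\<^sub>F t in at_bot. (\<xi> t, S t) \<in> ?K"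
    using eventually_le_at_bot[of t0] by eventually_elim (rule reg)
  have "((\<lambda>t. (S t - a) * (exp (c * \<xi> t) * D (\<xi> t) (S t))) \<longlongrightarrow> 0) at_bot"
  proof (rule barbalat_at_bot[OF E_along l])
    show "uniformly_continuous_on {..t0} (\<lambda>t. (S t - a) * (exp (c * \<xi> t) * D (\<xi> t) (S t)))"
      using uc[OF contP] by (simp add: P_def)
  qed (use tr S in auto)
  then have "((\<lambda>t. P (\<xi> t, S t)) \<longlongrightarrow> 0) at_bot" by (simp add: P_def)
  then have "((\<lambda>t. snd (\<xi> t, S t) - a) \<longlongrightarrow> 0) at_bot"
  proof (rule tendsto_zero_of_compact[OF K contP, rotated 3])
    show "continuous_on ?K (\<lambda>z. snd z - a)" by (intro continuous_intros)
    show "snd z - a = 0" if "z \<in> ?K" "P z = 0" for z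
      using E_along_pos[OF nonneg[OF that(1)], of "fst z"] that(2) unfolding P_def
      by (metis less_irrefl right_minus_eq)
  qed (rule evK)
  then have S0: "((\<lambda>t. S t - a) \<longlongrightarrow> 0) at_bot" by simp
  have Sa: "(S \<longlongrightarrow> a) at_bot" using S0 LIM_zero_iff by blast
  have R0: "((\<lambda>t. R (\<xi> t) (S t)) \<longlongrightarrow> 0) at_bot"
    by (rule barbalat_at_bot[OF trajectory_deriv(2) Sa]) (use tr uc[OF continuous_on_R] in auto)
  \<comment> \<open>\<open>Q\<close> vanishes exactly at the equilibria, and below the energy of the
    saddle the region contains only the source.\<close>
  define Q where "Q z = \<bar>snd z - a\<bar> + \<bar>R (fst z) (snd z)\<bar>" for z
  have "((\<lambda>t. \<bar>S t - a\<bar> + \<bar>R (\<xi> t) (S t)\<bar>) \<longlongrightarrow> \<bar>0\<bar> + \<bar>0\<bar>) at_bot"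
    by (intro tendsto_intros S0 R0)
  then have "((\<lambda>t. Q (\<xi> t, S t)) \<longlongrightarrow> 0) at_bot" by (simp add: Q_def)
  then have "((\<lambda>t. fst (\<xi> t, S t) - \<xi>2) \<longlongrightarrow> 0) at_bot"
  proof (rule tendsto_zero_of_compact[OF K, rotated 4])
    show "continuous_on ?K Q" unfolding Q_def by (intro continuous_intros continuous_on_R)
    show "continuous_on ?K (\<lambda>z. fst z - \<xi>2)" by (intro continuous_intros)
    show "fst z - \<xi>2 = 0" if z: "z \<in> ?K" "Q z = 0" for z
    proof -
      have "snd z = a" "R (fst z) (snd z) = 0" using z(2) by (auto simp: Q_def abs_if split: if_splits)
      then have "f (fst z) = 0" by (simp add: f_def)
      then show ?thesis using region_right[OF z(1) e] f_neg[of "fst z"] f_pos[of "fst z"]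
        by (cases "fst z" "\<xi>2" rule: linorder_cases) auto
    qed
  qed (rule evK)
  then show ?thesis using LIM_zero_iff by force
qed

text \<open>Over the open interval between the equilibria \<open>f\<close> is negative, so the line
  \<open>S = a\<close> can be crossed only downwards.\<close>

lemma stays_below:
  assumes tr: "\<And>r. s \<le> r \<Longrightarrow> r \<le> t \<Longrightarrow> trajectory_at \<xi> S r"
    and xi: "\<And>r. s \<le> r \<Longrightarrow> r \<le> t \<Longrightarrow> \<xi>1 < \<xi> r \<and> \<xi> r < \<xi>2"
    and s: "s \<le> t" "S s < a"
  shows "S t < a"
proof (rule ccontr)
  assume "\<not> S t < a"
  then have "a \<le> S t" by simp
  have "continuous_on {s..t} S"
    using tr by (intro continuous_at_imp_continuous_on ballI trajectory_deriv(4)) auto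
  from first_hit_from_below[OF this s(1) s(2) \<open>a \<le> S t\<close>]
  obtain r where r: "s < r" "r \<le> t" "S r = a" "\<And>x. s \<le> x \<Longrightarrow> x < r \<Longrightarrow> S x < a" by metis
  have "R (\<xi> r) (S r) < 0" using f_neg[of "\<xi> r"] xi[of r] r by (simp add: f_def)
  from DERIV_neg_dec_left[OF trajectory_deriv(2)[OF tr] this] r
  obtain e where e: "0 < e" "\<And>h. 0 < h \<Longrightarrow> h < e \<Longrightarrow> S r < S (r - h)" by auto
  define k where "k = min (e / 2) (r - s)"
  have k: "0 < k" "k < e" "s \<le> r - k" "r - k < r" using e(1) r(1) by (auto simp: k_def)
  show False using e(2)[OF k(1,2)] r(4)[OF k(3,4)] r(3) by simp
qed

end

section \<open>Existence of the heteroclinic orbit\<close>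

context emden_fowler
begin

lemma trajectory_shift:
  assumes "\<And>t. trajectory_at \<xi> S t"
  shows "trajectory_at (\<lambda>t. \<xi> (t + s)) (\<lambda>t. S (t + s)) t"
  using assms[of "t + s"] by (auto simp: trajectory_at_def DERIV_shift)

end

context two_equilibria
begin

text \<open>The starting points tend to the saddle, so without renormalisation the limit would be
  the constant orbit. Time is therefore recentred where each orbit meets the fixed section \<xi> =
  \<open>\<xi>1 + d\<close>. The section points stay in a compact interval, and the recentring times
  tend to infinity, so the limit orbit inherits the bounds at all times.\<close>

lemma heteroclinic_exists:
  obtains \<xi> S where "\<And>t. trajectory_at \<xi> S t" "\<And>t. 0 < S t" "\<And>t. \<xi>1 < \<xi> t"
    "(\<xi> \<longlongrightarrow> \<xi>1) at_top" "(\<xi> \<longlongrightarrow> \<xi>2) at_bot"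
proof -
  obtain B where B0: "0 < B" and B: "region (\<Psi> \<xi>1) \<subseteq> {-B<..<B} \<times> {-B<..<B}" using region_bounded .
  obtain L where L: "L-lipschitz_on UNIV (clamped B)" using clamped_lipschitz[of B] B0 by auto
  have L0: "0 \<le> L" using L by (rule lipschitz_on_nonneg)
  have sq: "z \<in> square B" if "z \<in> region (\<Psi> \<xi>1)" for z
    using subsetD[OF B that] by (auto simp: square_def)
  define d where "d = (\<xi>2 - \<xi>1) / 2"
  have d: "0 < d" "\<xi>1 + d < \<xi>2" using roots(1) by (auto simp: d_def field_simps)
  \<comment> \<open>With the offset 2 even the first value is strictly less than
    \<open>d\<close>.\<close>
  define \<epsilon> where "\<epsilon> k = d / (real k + 2)" for k :: nat
  have \<epsilon>: "0 < \<epsilon> k" "\<epsilon> k < d" for k using d(1) by (auto simp: \<epsilon>_def field_simps add_pos_nonneg)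
  have \<epsilon>lim: "\<epsilon> \<longlonglongrightarrow> 0"
    using LIMSEQ_ignore_initial_segment[OF lim_const_over_n[of d], of 2] by (simp add: \<epsilon>_def[abs_def] add.commute)
  have "\<exists>z. z 0 = (\<xi>1 + \<epsilon> k, a) \<and> (\<forall>t. (z has_vector_derivative clamped B (z t)) (at t))" for k
    using lipschitz_ode_solution[OF L] by metis
  then obtain z where z0: "\<And>k. z k 0 = (\<xi>1 + \<epsilon> k, a)"
    and z: "\<And>k t. (z k has_vector_derivative clamped B (z k t)) (at t)" by metis
  have contz: "continuous_on X (z k)" for X k
    using z has_vector_derivative_continuous by (blast intro: continuous_at_imp_continuous_on)
  have Elt: "\<Psi> (\<xi>1 + \<epsilon> k) < \<Psi> \<xi>1" for k
    using \<epsilon>[of k] d(2) by (intro Psi_decreasing f_neg) auto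
  have zreg: "z k t \<in> region (\<Psi> (\<xi>1 + \<epsilon> k))" if "t \<le> 0" for k t
  proof (rule backward_invariant[OF B Elt z _ that])
    show "z k 0 \<in> region (\<Psi> (\<xi>1 + \<epsilon> k))"
      using \<epsilon>[of k] a_pos by (simp add: z0 region_def E_a)
  qed
  have zreg': "z k t \<in> region (\<Psi> \<xi>1)" if "t \<le> 0" for k t
    using zreg[OF that] region_mono Elt by (meson less_imp_le subsetD)
  have ztr: "trajectory_at (\<lambda>t. fst (z k t)) (\<lambda>t. snd (z k t)) t" if "t \<le> 0" for k t
    using z[of k t] clamped_eq[OF sq[OF zreg'[OF that]]] by (simp add: trajectory_field)
  have "\<exists>r>0. fst (z k (- r)) = \<xi>1 + d \<and> (\<forall>x. 0 \<le> x \<longrightarrow> x < r \<longrightarrow> fst (z k (- x)) < \<xi>1 + d)" for k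
  proof -
    have "((\<lambda>t. fst (z k t)) \<longlongrightarrow> \<xi>2) at_bot"
      by (rule backward_limit[OF Elt ztr, of 0 k k]) (use zreg in auto)
    then have "\<forall>\<^sub>F t in at_bot. \<xi>1 + d < fst (z k t)" using d(2) by (rule order_tendstoD)
    then have "\<forall>\<^sub>F t in at_bot. \<xi>1 + d < fst (z k t) \<and> t \<le> 0" by (intro eventually_conj eventually_le_at_bot)
    then obtain t where t: "\<xi>1 + d < fst (z k t)" "t \<le> 0"
      using eventually_happens'[OF trivial_limit_at_bot_linorder] by blast
    have "continuous_on {0..- t} (\<lambda>x. fst (z k (- x)))"
      by (intro continuous_on_fst continuous_on_compose2[OF contz[of UNIV]] continuous_intros) auto
    from first_hit_from_below[OF this, of "\<xi>1 + d"] t \<epsilon>[of k] show ?thesis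
      by (simp add: z0) (metis less_imp_le)
  qed
  then obtain r where r: "\<And>k. 0 < r k" "\<And>k. fst (z k (- r k)) = \<xi>1 + d"
    "\<And>k x. 0 \<le> x \<Longrightarrow> x < r k \<Longrightarrow> fst (z k (- x)) < \<xi>1 + d" by metis
  \<comment> \<open>Read forwards: an orbit that drops below \<open>a\<close> between the equilibria
    stays below, yet it ends with \<open>S = a\<close> at time 0.\<close>
  have Sge: "a \<le> snd (z k (- x))" if "0 \<le> x" "x \<le> r k" for k x
  proof (rule ccontr)
    assume "\<not> a \<le> snd (z k (- x))"
    moreover have "snd (z k 0) < a" if "snd (z k (- x)) < a"
    proof (rule stays_below[of "- x" 0 "\<lambda>t. fst (z k t)"])
      fix y assume y: "- x \<le> y" "y \<le> 0"
      show "trajectory_at (\<lambda>t. fst (z k t)) (\<lambda>t. snd (z k t)) y" using ztr y by simp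
      have "fst (z k y) \<le> \<xi>1 + d"
        using r(3)[of "- y" k] r(2)[of k] y \<open>x \<le> r k\<close> by (cases "y = - r k") auto
      then show "\<xi>1 < fst (z k y) \<and> fst (z k y) < \<xi>2"
        using region_right[OF zreg Elt, of y k] y d(2) by simp
    qed (use that \<open>0 \<le> x\<close> in auto)
    ultimately show False by (simp add: z0)
  qed
  define w where "w k t = z k (t - r k)" for k t
  have w: "(w k has_vector_derivative clamped B (w k t)) (at t)" for k t
  proof -
    have "((\<lambda>t. t - r k) has_vector_derivative 1) (at t)"
      by (auto intro!: derivative_eq_intros simp: has_vector_derivative_def)
    from vector_diff_chain_at[OF this z[of k]] show ?thesis by (simp add: o_def w_def[abs_def])
  qed
  define \<sigma> where "\<sigma> k = snd (z k (- r k))" for k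
  have w0: "w k 0 = (\<xi>1 + d, \<sigma> k)" for k using r(2)[of k] by (simp add: w_def \<sigma>_def prod_eq_iff)
  have \<sigma>: "\<sigma> k \<in> {a..B}" for k
    using Sge[of "r k" k] r(1)[of k] sq[OF zreg', of "- r k" k] by (auto simp: \<sigma>_def square_def mem_Times_iff)
  obtain s \<phi> where \<phi>: "strict_mono \<phi>" and s: "((\<sigma> \<circ> \<phi>) \<longlongrightarrow> s) sequentially"
    using compact_imp_seq_compact[OF compact_Icc[of a B]] \<sigma> unfolding seq_compact_def by metis
  obtain y where y0: "y 0 = (\<xi>1 + d, s)" and y: "\<And>t. (y has_vector_derivative clamped B (y t)) (at t)"
    using lipschitz_ode_solution[OF L, where ?z0.0 = "(\<xi>1 + d, s)"] by blast
  have wy: "((\<lambda>k. w (\<phi> k) t) \<longlonglongrightarrow> y t)" for t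
  proof -
    have bd: "norm (w (\<phi> k) t - y t) \<le> exp (L * \<bar>t\<bar>) * \<bar>(\<sigma> \<circ> \<phi>) k - s\<bar>" for k
      using lipschitz_ode_dependence[OF L, of t "w (\<phi> k)" y] w y
      by (simp add: w0 y0 norm_Pair)
    have "(\<lambda>k. exp (L * \<bar>t\<bar>) * \<bar>(\<sigma> \<circ> \<phi>) k - s\<bar>) \<longlonglongrightarrow> exp (L * \<bar>t\<bar>) * \<bar>s - s\<bar>"
      by (intro tendsto_intros s)
    then have lim0: "(\<lambda>k. exp (L * \<bar>t\<bar>) * \<bar>(\<sigma> \<circ> \<phi>) k - s\<bar>) \<longlonglongrightarrow> 0" by simp
    have "(\<lambda>k. w (\<phi> k) t - y t) \<longlonglongrightarrow> 0"
      by (rule Lim_null_comparison[OF _ lim0]) (intro always_eventually allI bd)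
    then show ?thesis using LIM_zero_iff by blast
  qed
  \<comment> \<open>The saddle is itself a solution, so moving from distance
    \<open>\<epsilon> k\<close> to distance \<open>d\<close> needs
    \<open>d \<le> exp (L * r k) * \<epsilon> k\<close>; this fails for bounded \<open>r k\<close>
    once \<open>\<epsilon> k\<close> is small.\<close>
  have rlim: "\<forall>\<^sub>F k in sequentially. t \<le> r (\<phi> k)" for t
  proof -
    have P1: "((\<lambda>_. (\<xi>1, a)) has_vector_derivative clamped B (\<xi>1, a)) (at x)" for x :: real
    proof -
      have "(\<xi>1, a) \<in> region (\<Psi> \<xi>1)" using a_pos by (simp add: region_def E_a)
      then have "clamped B (\<xi>1, a) = 0"
        using clamped_eq[OF sq] roots(2) by (simp add: field_def f_def zero_prod_def)
      then show ?thesis by simp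
    qed
    have key: "d \<le> exp (L * t) * \<epsilon> k" if "r k < t" for k
    proof -
      have "norm (z k (- r k) - (\<xi>1, a)) \<le> exp (L * \<bar>- r k\<bar>) * norm (z k 0 - (\<xi>1, a))"
        using lipschitz_ode_dependence[OF L, of "- r k" "z k" "\<lambda>_. (\<xi>1, a)"] z P1 by simp
      also have "\<dots> = exp (L * r k) * \<epsilon> k" using r(1)[of k] \<epsilon>[of k] by (simp add: z0 norm_Pair)
      also have "\<dots> \<le> exp (L * t) * \<epsilon> k"
        using that L0 \<epsilon>[of k] by (intro mult_right_mono) (auto intro: mult_left_mono)
      finally have "norm (z k (- r k) - (\<xi>1, a)) \<le> exp (L * t) * \<epsilon> k" .
      moreover have "d \<le> norm (z k (- r k) - (\<xi>1, a))"
        using norm_fst_le[of "fst (z k (- r k)) - \<xi>1" "snd (z k (- r k)) - a"] r(2)[of k] d(1)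
        by (cases "z k (- r k)") simp
      ultimately show ?thesis by simp
    qed
    have "(\<lambda>k. exp (L * t) * \<epsilon> k) \<longlonglongrightarrow> exp (L * t) * 0" by (intro tendsto_intros \<epsilon>lim)
    then have "\<forall>\<^sub>F k in sequentially. exp (L * t) * \<epsilon> k < d" using d(1) by (intro order_tendstoD) auto
    then have "\<forall>\<^sub>F k in sequentially. t \<le> r k" by eventually_elim (use key in \<open>force simp: not_less\<close>)
    then show ?thesis using \<phi> by (rule eventually_subseq[rotated])
  qed
  have yreg: "y t \<in> region (\<Psi> \<xi>1)" for t
  proof (rule Lim_in_closed_set[OF region_closed _ _ wy])
    show "\<forall>\<^sub>F k in sequentially. w (\<phi> k) t \<in> region (\<Psi> \<xi>1)"
      using rlim[of t] by eventually_elim (auto simp: w_def intro: zreg')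
  qed simp
  have ytr: "trajectory_at (\<lambda>t. fst (y t)) (\<lambda>t. snd (y t)) t" for t
    using y[of t] clamped_eq[OF sq[OF yreg]] by (simp add: trajectory_field)
  have yS: "0 < snd (y t)" for t using region_pos[OF yreg] .
  have yfwd: "fst (y t) \<le> \<xi>1 + d" "a \<le> snd (y t)" if "0 \<le> t" for t
  proof -
    have "\<forall>\<^sub>F k in sequentially. fst (w (\<phi> k) t) \<le> \<xi>1 + d \<and> a \<le> snd (w (\<phi> k) t)"
      using rlim[of t]
    proof eventually_elim
      case (elim k)
      then show ?case
        using r(3)[of "r (\<phi> k) - t" "\<phi> k"] r(2)[of "\<phi> k"] Sge[of "r (\<phi> k) - t" "\<phi> k"] that
        by (cases "t = 0") (auto simp: w_def)
    qed
    then show "fst (y t) \<le> \<xi>1 + d" "a \<le> snd (y t)"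
      by (auto intro!: tendsto_upperbound[OF tendsto_fst[OF wy]] tendsto_lowerbound[OF tendsto_snd[OF wy]]
          elim: eventually_mono)
  qed
  have yge: "\<xi>1 \<le> fst (y t)" for t using yreg[of t] by (simp add: region_def)
  have mono: "fst (y t) \<le> fst (y u)" if "0 \<le> u" "u \<le> t" for u t
    by (rule DERIV_nonpos_imp_nonincreasing[OF that(2), of "\<lambda>t. fst (y t)"])
       (use trajectory_deriv(1)[OF ytr] yfwd(2) that in \<open>meson diff_le_0_iff_le order_trans\<close>)
  obtain l where l: "((\<lambda>t. - fst (y t)) \<longlongrightarrow> l) at_top" "\<And>t. 0 \<le> t \<Longrightarrow> - fst (y t) \<le> l" "l \<le> - \<xi>1"
    using mono_bounded_tendsto_at_top[of 0 "\<lambda>t. - fst (y t)" "- \<xi>1"] mono yge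
    by (metis (no_types, lifting) neg_le_iff_le)
  have ylim': "((\<lambda>t. fst (y t)) \<longlongrightarrow> - l) at_top" using tendsto_minus[OF l(1)] by simp
  have "f (- l) = 0"
    by (rule converges_to_equilibrium(2)[OF ytr region_compact[OF order.refl] _ ylim']) (use yreg in auto)
  moreover have "- l < \<xi>2" using l(2)[of 0] y0 d(2) by simp
  ultimately have "- l = \<xi>1" using f_neg[of "- l"] l(3) by force
  with ylim' have ylim: "((\<lambda>t. fst (y t)) \<longlongrightarrow> \<xi>1) at_top" by simp
  \<comment> \<open>\<open>backward_limit\<close> needs a level strictly below the saddle. Equality
    at one time would freeze the energy from then on, forcing \<open>S = a\<close> and \<xi> =
    \<open>\<xi>1\<close>; by uniqueness the orbit would be the saddle.\<close>
  have Ey: "E (fst (y t)) (snd (y t)) < \<Psi> \<xi>1" for t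
  proof (rule ccontr)
    assume "\<not> E (fst (y t)) (snd (y t)) < \<Psi> \<xi>1"
    then have ge: "\<Psi> \<xi>1 \<le> E (fst (y t)) (snd (y t))" by simp
    define u where "u = max t 0 + 1"
    have const: "E (fst (y x)) (snd (y x)) = \<Psi> \<xi>1" if "t \<le> x" for x
    proof (rule antisym)
      show "E (fst (y x)) (snd (y x)) \<le> \<Psi> \<xi>1" using yreg[of x] by (simp add: region_def)
      have "E (fst (y t)) (snd (y t)) \<le> E (fst (y x)) (snd (y x))"
        by (rule E_mono[OF that]) (use ytr yS in auto)
      with ge show "\<Psi> \<xi>1 \<le> E (fst (y x)) (snd (y x))" by simp
    qed
    have "snd (y u) = a"
    proof (rule ccontr)
      assume "snd (y u) \<noteq> a"
      then have "0 < (snd (y u) - a) * (exp (c * fst (y u)) * D (fst (y u)) (snd (y u)))"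
        using yS[of u] by (intro E_along_pos) auto
      from DERIV_pos_inc_right[OF E_along[OF ytr yS] this]
      obtain e where "0 < e" "\<And>h. 0 < h \<Longrightarrow> h < e \<Longrightarrow>
          E (fst (y u)) (snd (y u)) < E (fst (y (u + h))) (snd (y (u + h)))" by auto
      from this(2)[of "e / 2"] this(1) const[of u] const[of "u + e / 2"] show False by (simp add: u_def)
    qed
    then have Pu: "\<Psi> (fst (y u)) = \<Psi> \<xi>1" using const[of u] by (simp add: E_a u_def)
    have "fst (y u) = \<xi>1"
    proof (rule ccontr)
      assume "fst (y u) \<noteq> \<xi>1"
      then have "\<xi>1 < fst (y u)" using yge[of u] by simp
      then have "\<Psi> (fst (y u)) < \<Psi> \<xi>1"
        using yfwd(1)[of u] d(2) by (intro Psi_decreasing f_neg) (auto simp: u_def)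
      then show False using Pu by simp
    qed
    then have "fst (y 0) = \<xi>1"
      using trajectory_unique[OF ytr equilibrium_trajectory[OF roots(2)], of u 0] \<open>snd (y u) = a\<close> by simp
    then show False using y0 d(1) by simp
  qed
  have ygt: "\<xi>1 < fst (y t)" for t
    by (rule region_right[OF _ Ey[of t]]) (use yreg[of t] in \<open>simp add: region_def\<close>)
  have "((\<lambda>t. fst (y t)) \<longlongrightarrow> \<xi>2) at_bot"
  proof (rule backward_limit[OF Ey[of 0] ytr])
    fix t :: real assume "t \<le> 0"
    then have "E (fst (y t)) (snd (y t)) \<le> E (fst (y 0)) (snd (y 0))" using ytr yS by (intro E_mono) auto
    then show "(fst (y t), snd (y t)) \<in> region (E (fst (y 0)) (snd (y 0)))"
      using yreg[of t] by (simp add: region_def)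
  qed
  with ytr yS ygt ylim show ?thesis by (rule that)
qed

section \<open>Uniqueness of the stable branch\<close>

lemma approach_from_right:
  assumes tr: "\<And>t. trajectory_at \<xi> S t" and gt: "\<And>t. \<xi>1 < \<xi> t" and lim: "(\<xi> \<longlongrightarrow> \<xi>1) at_top"
  obtains T where "\<And>t. T \<le> t \<Longrightarrow> a < S t"
    and "\<And>t \<eta>. 0 < \<eta> \<Longrightarrow> \<exists>r\<ge>t. S r < a + \<eta>"
proof -
  note d = trajectory_deriv[OF tr]
  have "\<forall>\<^sub>F t in at_top. \<xi> t < \<xi>2" using lim roots(1) by (rule order_tendstoD)
  then obtain T where T: "\<And>t. T \<le> t \<Longrightarrow> \<xi> t < \<xi>2" unfolding eventually_at_top_linorder by blast
  \<comment> \<open>Below \<open>a\<close> and between the equilibria, \<open>S\<close> stays below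
    and \<xi> increases, away from its limit \<open>\<xi>1\<close>.\<close>
  have below: False if t: "T \<le> t" "S t < a" for t
  proof -
    have lt: "S r < a" if "t \<le> r" for r
      by (rule stays_below[OF tr _ that t(2)]) (use gt T t(1) in auto)
    have "\<xi> t \<le> \<xi> r" if "t \<le> r" for r
      by (rule DERIV_nonneg_imp_nondecreasing[OF that])
         (use d(1) lt in \<open>meson diff_ge_0_iff_ge less_imp_le\<close>)
    then have "\<xi> t \<le> \<xi>1"
      by (intro tendsto_lowerbound[OF lim]) (auto intro!: eventually_at_top_linorderI[of t])
    then show False using gt[of t] by simp
  qed
  have "a < S t" if "T \<le> t" for t
  proof (rule ccontr)
    assume "\<not> a < S t"
    then have Sa: "S t = a" using below[OF that] by force
    then have "R (\<xi> t) (S t) < 0" using f_neg[OF gt T[OF that]] by (simp add: f_def)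
    from DERIV_neg_dec_right[OF d(2) this]
    obtain e where "0 < e" "\<And>h. 0 < h \<Longrightarrow> h < e \<Longrightarrow> S (t + h) < S t" by auto
    then have "S (t + e / 2) < a" "T \<le> t + e / 2" using Sa that by auto
    then show False using below by blast
  qed
  moreover have "\<exists>r\<ge>t. S r < a + \<eta>" if "0 < \<eta>" for t \<eta>
  proof (rule ccontr)
    assume "\<not> (\<exists>r\<ge>t. S r < a + \<eta>)"
    then have ge: "a + \<eta> \<le> S r" if "t \<le> r" for r using that by force
    \<comment> \<open>If \<open>S\<close> stayed above \<open>a + \<eta>\<close>, then \<xi> would
      have covered its whole distance to \<open>\<xi>1\<close> by time \<open>r\<close>.\<close>
    define r where "r = t + (\<xi> t - \<xi>1) / \<eta>"
    have "t \<le> r" using gt[of t] \<open>0 < \<eta>\<close> by (simp add: r_def)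
    have "\<xi> r - \<xi> t \<le> - \<eta> * (r - t)"
      by (rule growth_le_of_derivative_le[OF \<open>t \<le> r\<close> d(1)]) (use ge in force)
    also have "\<dots> = \<xi>1 - \<xi> t" using \<open>0 < \<eta>\<close> by (simp add: r_def)
    finally show False using gt[of r] by simp
  qed
  ultimately show ?thesis by (rule that)
qed

text \<open>Late in time \<xi> is strictly decreasing and can replace time as the independent
  variable. Division by its speed \<open>a - S\<close> cancels the factor \<open>S - a\<close> of
  the energy rate, so only \<open>D\<close>, which is monotone in \<open>S\<close>, is left. The
  last property is a weak form of \<open>s\<close> tending to \<open>a\<close> at the
  saddle.\<close>

lemma stable_graph:
  assumes tr: "\<And>t. trajectory_at \<xi> S t" and gt: "\<And>t. \<xi>1 < \<xi> t" and lim: "(\<xi> \<longlongrightarrow> \<xi>1) at_top"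
  obtains x0 s where "\<xi>1 < x0"
    and "\<And>x. \<xi>1 < x \<Longrightarrow> x < x0 \<Longrightarrow> a < s x \<and> (\<exists>t. \<xi> t = x \<and> S t = s x)"
    and "\<And>x. \<xi>1 < x \<Longrightarrow> x < x0 \<Longrightarrow>
      DERIV (\<lambda>x. E x (s x)) x :> - exp (c * x) * D x (s x)"
    and "\<And>x \<eta>. \<xi>1 < x \<Longrightarrow> 0 < \<eta> \<Longrightarrow> \<exists>y. \<xi>1 < y \<and> y < x \<and> s y < a + \<eta>"
proof -
  note d = trajectory_deriv[OF tr]
  obtain T where T: "\<And>t. T \<le> t \<Longrightarrow> a < S t" and inf: "\<And>t \<eta>. 0 < \<eta> \<Longrightarrow> \<exists>r\<ge>t. S r < a + \<eta>"
    using approach_from_right[OF tr gt lim] by blast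
  have decr: "\<xi> t < \<xi> s" if "T \<le> s" "s < t" for s t
  proof (rule DERIV_neg_imp_decreasing[OF that(2)])
    fix x assume "s \<le> x"
    then show "\<exists>y. DERIV \<xi> x :> y \<and> y < 0"
      using d(1)[of x] T[of x] that(1) by (intro exI[of _ "a - S x"]) auto
  qed
  define \<tau> where "\<tau> x = (THE t. T \<le> t \<and> \<xi> t = x)" for x
  have \<tau>\<xi>: "\<tau> (\<xi> t) = t" if "T \<le> t" for t
    unfolding \<tau>_def using that decr by (intro the_equality) (auto, metis less_irrefl neqE)
  have surj: "\<exists>t>T. \<xi> t = x" if x: "\<xi>1 < x" "x < \<xi> T" for x
  proof -
    have "\<forall>\<^sub>F t in at_top. \<xi> t < x \<and> T \<le> t"
      using order_tendstoD(2)[OF lim x(1)] by (intro eventually_conj eventually_ge_at_top)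
    then obtain t where t: "\<xi> t < x" "T \<le> t" using eventually_happens'[OF trivial_limit_at_top_linorder] by blast
    have "continuous_on {T..t} \<xi>" using d(3) by (simp add: continuous_at_imp_continuous_on)
    then obtain r where "T \<le> r" "\<xi> r = x" using IVT2'[of \<xi> t x T] t x by auto
    then show ?thesis using x by (intro exI[of _ r]) (auto simp: less_le)
  qed
  have \<tau>: "T < \<tau> x" "\<xi> (\<tau> x) = x" if "\<xi>1 < x" "x < \<xi> T" for x
    using surj[OF that] \<tau>\<xi> by (metis less_imp_le)+
  have d\<tau>: "DERIV \<tau> x :> inverse (a - S (\<tau> x))" if x: "\<xi>1 < x" "x < \<xi> T" for x
  proof (rule DERIV_inverse_function[OF d(1) _ x])
    show "a - S (\<tau> x) \<noteq> 0" using T[of "\<tau> x"] \<tau>(1)[OF x] by simp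
    show "\<xi> (\<tau> y) = y" if "\<xi>1 < y" "y < \<xi> T" for y using \<tau>(2)[OF that] .
    have "isCont \<tau> (\<xi> (\<tau> x))"
      by (rule isCont_inverse_function2[of T _ "\<tau> x + 1"]) (use \<tau>(1)[OF x] \<tau>\<xi> d(3) in auto)
    then show "isCont \<tau> x" using \<tau>(2)[OF x] by simp
  qed
  show ?thesis
  proof (rule that[of "\<xi> T" "\<lambda>x. S (\<tau> x)"])
    show "\<xi>1 < \<xi> T" by (rule gt)
    fix x assume x: "\<xi>1 < x"
    show "a < S (\<tau> x) \<and> (\<exists>t. \<xi> t = x \<and> S t = S (\<tau> x))" if "x < \<xi> T"
      using \<tau>[OF x that] T[of "\<tau> x"] by auto
    show "DERIV (\<lambda>x. E x (S (\<tau> x))) x :> - exp (c * x) * D x (S (\<tau> x))" if xT: "x < \<xi> T"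
    proof -
      have pos: "0 < S (\<tau> x)" using T[of "\<tau> x"] \<tau>(1)[OF x xT] a_pos by simp
      have "DERIV (\<lambda>x. E (\<xi> (\<tau> x)) (S (\<tau> x))) x :>
          (S (\<tau> x) - a) * (exp (c * \<xi> (\<tau> x)) * D (\<xi> (\<tau> x)) (S (\<tau> x))) * inverse (a - S (\<tau> x))"
        by (rule DERIV_chain2[OF E_along[OF tr pos] d\<tau>[OF x xT]])
      moreover have "(S (\<tau> x) - a) * (exp (c * \<xi> (\<tau> x)) * D (\<xi> (\<tau> x)) (S (\<tau> x))) * inverse (a - S (\<tau> x))
          = - exp (c * x) * D x (S (\<tau> x))"
        using T[of "\<tau> x"] \<tau>[OF x xT] by (simp add: field_simps)
      ultimately have "DERIV (\<lambda>x. E (\<xi> (\<tau> x)) (S (\<tau> x))) x :> - exp (c * x) * D x (S (\<tau> x))"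
        by simp
      then show ?thesis
        by (rule has_field_derivative_transform_within_open[of _ _ _ "{\<xi>1<..<\<xi> T}"]) (use x xT \<tau>(2) in auto)
    qed
    fix \<eta> :: real assume "0 < \<eta>"
    have "\<forall>\<^sub>F t in at_top. \<xi> t < x" using lim x by (rule order_tendstoD)
    then obtain t where t: "\<And>r. t \<le> r \<Longrightarrow> \<xi> r < x" unfolding eventually_at_top_linorder by blast
    obtain r where "max t T \<le> r" "S r < a + \<eta>" using inf[OF \<open>0 < \<eta>\<close>] by blast
    then show "\<exists>y. \<xi>1 < y \<and> y < x \<and> S (\<tau> y) < a + \<eta>"
      using gt[of r] t[of r] \<tau>\<xi>[of r] by (intro exI[of _ "\<xi> r"]) auto
  qed
qed

text \<open>Where \<open>s1\<close> exceeds \<open>s2\<close>, the energy difference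
  \<open>g\<close> is positive and, \<open>D\<close> being increasing in \<open>S\<close>, it grows
  as \<open>x\<close> decreases to \<open>\<xi>1\<close>. But \<open>g y\<close> is at most
  \<open>exp (c * y) * h (s1 y)\<close>, which is small wherever \<open>s1 y\<close> is near
  \<open>a\<close>.\<close>

lemma stable_graph_le:
  assumes s1: "\<And>x. \<xi>1 < x \<Longrightarrow> x < x0 \<Longrightarrow> a < s1 x"
    "\<And>x. \<xi>1 < x \<Longrightarrow> x < x0 \<Longrightarrow> DERIV (\<lambda>x. E x (s1 x)) x :> - exp (c * x) * D x (s1 x)"
    and inf: "\<And>x \<eta>. \<xi>1 < x \<Longrightarrow> 0 < \<eta> \<Longrightarrow> \<exists>y. \<xi>1 < y \<and> y < x \<and> s1 y < a + \<eta>"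
    and s2: "\<And>x. \<xi>1 < x \<Longrightarrow> x < x0 \<Longrightarrow> a < s2 x"
    "\<And>x. \<xi>1 < x \<Longrightarrow> x < x0 \<Longrightarrow> DERIV (\<lambda>x. E x (s2 x)) x :> - exp (c * x) * D x (s2 x)"
    and x: "\<xi>1 < x" "x < x0"
  shows "s1 x \<le> s2 x"
proof (rule ccontr)
  assume "\<not> s1 x \<le> s2 x"
  define g where "g y = E y (s1 y) - E y (s2 y)" for y
  have g_eq: "g y = exp (c * y) * (h (s1 y) - h (s2 y))" for y
    by (simp add: g_def E_def algebra_simps)
  have hmono: "h u \<le> h v" if "a \<le> u" "u \<le> v" for u v
    using h_increasing[of u v] that by (cases "u = v") auto
  have dg: "DERIV g y :> - exp (c * y) * (D y (s1 y) - D y (s2 y))" if "\<xi>1 < y" "y < x0" for y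
    unfolding g_def using DERIV_diff[OF s1(2)[OF that] s2(2)[OF that]] by (simp add: algebra_simps)
  have gpos: "s2 y < s1 y" if "0 < g y" "\<xi>1 < y" "y < x0" for y
    using that hmono[of "s1 y" "s2 y"] s1(1)[of y] by (force simp: g_eq zero_less_mult_iff)
  have gx: "0 < g x"
    using h_increasing[of "s2 x" "s1 x"] s2(1)[OF x] \<open>\<not> s1 x \<le> s2 x\<close> by (simp add: g_eq)
  have grow: "g x \<le> g y" if y: "\<xi>1 < y" "y < x" for y
  proof (rule ccontr)
    assume "\<not> g x \<le> g y"
    \<comment> \<open>A positive level below \<open>g x\<close> and not below \<open>g y\<close>.
      Between the last point where \<open>g = m\<close> and \<open>x\<close> the difference stays
      positive, so it must decrease there.\<close>
    define m where "m = max (g y) (g x / 2)"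
    have m: "0 < m" "m < g x" "g y \<le> m" using gx \<open>\<not> g x \<le> g y\<close> by (auto simp: m_def)
    have cont: "continuous_on {y..x} g"
      using dg y x by (intro continuous_at_imp_continuous_on ballI DERIV_isCont[OF dg]) auto
    have "continuous_on {- x..- y} (\<lambda>u. g (- u))"
      by (rule continuous_on_compose2[OF cont]) (auto intro!: continuous_intros)
    from first_hit_from_above[OF this, of m] y m obtain u where u: "- x < u" "u \<le> - y" "g (- u) = m"
      "\<And>v. - x \<le> v \<Longrightarrow> v < u \<Longrightarrow> m < g (- v)" by auto
    have "g x < g (- u)"
    proof (rule DERIV_neg_imp_decreasing_open[of "- u" x g])
      fix v assume v: "- u < v" "v < x"
      have "0 < g v" using u(4)[of "- v"] v m(1) by simp
      moreover have vx: "\<xi>1 < v" "v < x0" using v u(2) y(1) x by auto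
      ultimately have "s2 v < s1 v" by (rule gpos)
      then have "D v (s2 v) < D v (s1 v)" using s2(1)[OF vx] a_pos by (intro D_strict_mono) auto
      then have "- exp (c * v) * (D v (s1 v) - D v (s2 v)) < 0" by (intro mult_neg_pos) auto
      then show "\<exists>z. DERIV g v :> z \<and> z < 0"
        using dg[OF vx] by blast
    qed (use u y in \<open>auto intro: continuous_on_subset[OF cont]\<close>)
    then show False using u(3) m(2) by simp
  qed
  have "isCont h a" using DERIV_isCont[OF h_has_derivative[OF a_pos]] .
  moreover have "0 < g x * exp (- c * x)" using gx by simp
  ultimately obtain e where e: "0 < e" "\<And>u. \<bar>u - a\<bar> < e \<Longrightarrow> \<bar>h u\<bar> < g x * exp (- c * x)"
    unfolding continuous_at_eps_delta h_a dist_real_def by auto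
  obtain y where y: "\<xi>1 < y" "y < x" "s1 y < a + e" using inf[OF x(1) e(1)] by blast
  have "\<bar>s1 y - a\<bar> < e" using y s1(1)[of y] x by auto
  then have h1: "h (s1 y) < g x * exp (- c * x)" using e(2) by (meson abs_le_iff order.refl order_le_less_trans)
  have "g y \<le> exp (c * y) * h (s1 y)"
    using h_nonneg[of "s2 y"] s2(1)[of y] y x a_pos unfolding g_eq by (intro mult_left_mono) auto
  also have "\<dots> \<le> exp (c * x) * h (s1 y)"
    using y s1(1)[of y] x a_pos c_pos by (intro mult_right_mono h_nonneg) auto
  also have "\<dots> < exp (c * x) * (g x * exp (- c * x))" using h1 by (intro mult_strict_left_mono) auto
  also have "\<dots> = g x" by (simp add: exp_minus)
  finally show False using grow[OF y(1,2)] by simp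
qed

text \<open>Comparing both ways makes the two graphs equal at one point, so the orbits meet; as the
  system is autonomous they differ by a time shift, which for \<open>u\<close> is a scaling.\<close>

lemma heteroclinic_unique:
  assumes tr: "\<And>t. trajectory_at \<xi> S t" and gt: "\<And>t. \<xi>1 < \<xi> t" and lim: "(\<xi> \<longlongrightarrow> \<xi>1) at_top"
    and tr': "\<And>t. trajectory_at \<xi>' S' t" and gt': "\<And>t. \<xi>1 < \<xi>' t" and lim': "(\<xi>' \<longlongrightarrow> \<xi>1) at_top"
  obtains \<tau> where "\<And>t. \<xi>' t = \<xi> (t + \<tau>)"
proof -
  show ?thesis
  proof (rule stable_graph[OF tr gt lim], rule stable_graph[OF tr' gt' lim'])
    fix x1 s1 x2 s2
    assume 1: "\<xi>1 < x1" "\<And>x. \<xi>1 < x \<Longrightarrow> x < x1 \<Longrightarrow> a < s1 x \<and> (\<exists>t. \<xi> t = x \<and> S t = s1 x)"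
      "\<And>x. \<xi>1 < x \<Longrightarrow> x < x1 \<Longrightarrow> DERIV (\<lambda>x. E x (s1 x)) x :> - exp (c * x) * D x (s1 x)"
      "\<And>x \<eta>. \<xi>1 < x \<Longrightarrow> 0 < \<eta> \<Longrightarrow> \<exists>y. \<xi>1 < y \<and> y < x \<and> s1 y < a + \<eta>"
    assume 2: "\<xi>1 < x2" "\<And>x. \<xi>1 < x \<Longrightarrow> x < x2 \<Longrightarrow> a < s2 x \<and> (\<exists>t. \<xi>' t = x \<and> S' t = s2 x)"
      "\<And>x. \<xi>1 < x \<Longrightarrow> x < x2 \<Longrightarrow> DERIV (\<lambda>x. E x (s2 x)) x :> - exp (c * x) * D x (s2 x)"
      "\<And>x \<eta>. \<xi>1 < x \<Longrightarrow> 0 < \<eta> \<Longrightarrow> \<exists>y. \<xi>1 < y \<and> y < x \<and> s2 y < a + \<eta>"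
    obtain x where x: "\<xi>1 < x" "x < min x1 x2" using dense[of "\<xi>1" "min x1 x2"] 1(1) 2(1) by auto
    have "s1 x \<le> s2 x"
      by (rule stable_graph_le[OF _ _ 1(4) _ _ x]) (use 1(2,3) 2(2,3) in simp_all)
    moreover have "s2 x \<le> s1 x"
      by (rule stable_graph_le[OF _ _ 2(4) _ _ x]) (use 1(2,3) 2(2,3) in simp_all)
    ultimately have eq: "s1 x = s2 x" by simp
    obtain t1 t2 where t: "\<xi> t1 = x" "S t1 = s1 x" "\<xi>' t2 = x" "S' t2 = s2 x"
      using 1(2)[of x] 2(2)[of x] x by auto
    have "\<xi>' t = \<xi> (t + (t1 - t2))" for t
      using trajectory_unique[OF tr' trajectory_shift[OF tr, of "t1 - t2"], of t2 t] t eq by simp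
  then show thesis by (rule that)
  qed
qed

end

section \<open>Radial solutions\<close>

text \<open>Differential form of Gronwall's inequality, used with a rate of either sign.\<close>

lemma exp_weight_nonincreasing:
  fixes g :: "real \<Rightarrow> real"
  assumes "continuous_on {s..t} g" "s \<le> t"
    and d: "\<And>x. s < x \<Longrightarrow> x < t \<Longrightarrow> DERIV g x :> g' x"
    and le: "\<And>x. s < x \<Longrightarrow> x < t \<Longrightarrow> g' x \<le> C * g x"
  shows "g t * exp (- C * t) \<le> g s * exp (- C * s)"
proof -
  have "- (g s * exp (- C * s)) \<le> - (g t * exp (- C * t))"
  proof (rule DERIV_nonneg_imp_increasing_open[OF assms(2), of "\<lambda>x. - (g x * exp (- C * x))"])
    fix x assume x: "s < x" "x < t"
    have "DERIV (\<lambda>x. exp (- C * x)) x :> exp (- C * x) * - C"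
      by (auto intro!: derivative_eq_intros)
    from DERIV_minus[OF DERIV_mult[OF d[OF x] this]]
    have "DERIV (\<lambda>x. - (g x * exp (- C * x))) x :> (C * g x - g' x) * exp (- C * x)"
      by (rule DERIV_cong) (simp add: algebra_simps)
    then show "\<exists>z. DERIV (\<lambda>x. - (g x * exp (- C * x))) x :> z \<and> 0 \<le> z"
      using le[OF x] by (metis diff_ge_0_iff_ge exp_ge_zero mult_nonneg_nonneg)
  qed (intro continuous_intros assms(1))
  then show ?thesis by simp
qed

section \<open>The change of variables and ground states\<close>

context emden_fowler
begin

lemma E_rhs_eq: "E_rhs p M v dv = \<bar>v\<bar> powr (p - 1) * v + M * \<bar>dv\<bar> powr q"
  by (simp add: E_rhs_def q_def)

text \<open>The scaling identities \<open>a_p\<close> and \<open>a_q\<close> collect the powers of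
  \<open>r\<close> so that both nonlinear terms become those of the radial equation multiplied by
  \<open>r\<^sup>2 / U\<close>.\<close>

lemma emden_exp:
  assumes r: "0 < r" and U: "0 < U" and \<xi>: "\<xi> = ln U + a * ln r"
  shows "exp ((p - 1) * \<xi>) = r\<^sup>2 * U powr (p - 1)"
    and "\<bar>S\<bar> powr q * exp ((q - 1) * \<xi>) = r\<^sup>2 / U * \<bar>S * U / r\<bar> powr q"
proof -
  have "(p - 1) * \<xi> = (p - 1) * ln U + (a * (p - 1)) * ln r" by (simp add: \<xi> algebra_simps)
  also have "\<dots> = (p - 1) * ln U + 2 * ln r" by (simp add: a_p)
  finally show "exp ((p - 1) * \<xi>) = r\<^sup>2 * U powr (p - 1)"
    using r U by (simp add: exp_add powr_def exp_double)
  have "(q - 1) * \<xi> = q * ln U - ln U + (a * (q - 1)) * ln r" by (simp add: \<xi> algebra_simps)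
  also have "a * (q - 1) = 2 - q" using a_q by simp
  also have "q * ln U - ln U + (2 - q) * ln r = q * ln U + 2 * ln r - ln U - q * ln r"
    by (simp add: algebra_simps)
  also have "exp \<dots> = U powr q * r\<^sup>2 / U / r powr q"
    using r U by (simp add: exp_add exp_diff powr_def exp_double)
  finally have "exp ((q - 1) * \<xi>) = U powr q * r\<^sup>2 / U / r powr q" .
  moreover have "\<bar>S * U / r\<bar> powr q = \<bar>S\<bar> powr q * U powr q / r powr q"
    using r U by (simp add: abs_mult powr_mult powr_divide)
  ultimately show "\<bar>S\<bar> powr q * exp ((q - 1) * \<xi>) = r\<^sup>2 / U * \<bar>S * U / r\<bar> powr q" by simp
qed

lemma trajectory_of_solution:
  assumes u: "\<And>r. 0 < r \<Longrightarrow> DERIV u r :> u' r"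
    and u': "\<And>r. 0 < r \<Longrightarrow> DERIV u' r :> u'' r"
    and eq: "\<And>r. 0 < r \<Longrightarrow> - u'' r - (n - 1) / r * u' r = E_rhs p M (u r) (u' r)"
    and pos: "\<And>r. 0 < r \<Longrightarrow> 0 < u r"
  shows "trajectory_at (\<lambda>t. ln (u (exp t)) + a * t) (\<lambda>t. - (exp t * u' (exp t)) / u (exp t)) t"
proof -
  define r where "r = exp t"
  have r: "0 < r" "t = ln r" by (simp_all add: r_def)
  define S where "S = - (r * u' r) / u r"
  define \<xi> where "\<xi> = ln (u r) + a * ln r"
  note U = pos[OF r(1)]
  have du: "DERIV (\<lambda>t. u (exp t)) t :> u' r * r"
    unfolding r_def by (rule DERIV_chain2[OF u DERIV_exp]) simp
  have du': "DERIV (\<lambda>t. u' (exp t)) t :> u'' r * r"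
    unfolding r_def by (rule DERIV_chain2[OF u' DERIV_exp]) simp
  have "DERIV (\<lambda>t. ln (u (exp t)) + a * t) t :> (1 / u (exp t)) * (u' r * r) + a * 1"
    using U by (intro DERIV_add DERIV_chain2[OF DERIV_ln_divide du] DERIV_cmult DERIV_ident) (simp add: r_def)
  then have 1: "DERIV (\<lambda>t. ln (u (exp t)) + a * t) t :> a - S"
    by (elim DERIV_cong) (simp add: S_def r_def)
  have "DERIV (\<lambda>t. - (exp t * u' (exp t)) / u (exp t)) t :>
      ((- (exp t * u' (exp t) + u'' r * r * exp t)) * u (exp t) - (- (exp t * u' (exp t))) * (u' r * r))
        / (u (exp t) * u (exp t))"
    using U by (intro DERIV_divide DERIV_minus DERIV_mult DERIV_exp du du') (simp add: r_def)
  then have 2: "DERIV (\<lambda>t. - (exp t * u' (exp t)) / u (exp t)) t :> R \<xi> S"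
  proof (rule DERIV_cong)
    have SU: "\<bar>S * u r / r\<bar> = \<bar>u' r\<bar>" using U r by (simp add: S_def)
    have R: "R \<xi> S = S\<^sup>2 - (n - 2) * S + r\<^sup>2 / u r * E_rhs p M (u r) (u' r)"
    proof -
      have "M * \<bar>S\<bar> powr q * exp ((q - 1) * \<xi>) = M * (r\<^sup>2 / u r * \<bar>u' r\<bar> powr q)"
        using emden_exp(2)[OF r(1) U \<xi>_def, of S] unfolding SU by (simp only: mult.assoc)
      then show ?thesis
        unfolding R_def emden_exp(1)[OF r(1) U \<xi>_def] E_rhs_eq using U by (simp add: distrib_left)
    qed
    have k: "r\<^sup>2 / u r * ((n - 1) / r * u' r) = - ((n - 1) * S)"
      using r U by (simp add: S_def power2_eq_square)
    have "R \<xi> S = S\<^sup>2 - (n - 2) * S - r\<^sup>2 / u r * u'' r + (n - 1) * S"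
      unfolding R eq[OF r(1), symmetric] right_diff_distrib k by simp
    also have "\<dots> = S\<^sup>2 + S - r\<^sup>2 / u r * u'' r" by (simp add: algebra_simps)
    also have "\<dots> = ((- (r * u' r + u'' r * r * r)) * u r - (- (r * u' r)) * (u' r * r)) / (u r * u r)"
      using U by (simp add: S_def power2_eq_square add_divide_distrib diff_divide_distrib algebra_simps)
    finally show "((- (exp t * u' (exp t) + u'' r * r * exp t)) * u (exp t) - (- (exp t * u' (exp t))) * (u' r * r))
        / (u (exp t) * u (exp t)) = R \<xi> S" by (simp add: r_def)
  qed
  show ?thesis
    unfolding trajectory_at_def using 1 2 r by (simp add: S_def \<xi>_def)
qed

lemma solution_of_trajectory:
  assumes tr: "\<And>t. trajectory_at \<xi> S t" and nN: "n = real N"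
  shows "solves_E N p M (\<lambda>r. r powr (- a) * exp (\<xi> (ln r)))" (is "solves_E N p M ?u")
proof -
  define u' where "u' r = - (?u r * S (ln r) / r)" for r
  define u'' where "u'' r = ?u r / r\<^sup>2 * ((S (ln r))\<^sup>2 - R (\<xi> (ln r)) (S (ln r)) + S (ln r))" for r
  note d = trajectory_deriv[OF tr]
  have dlog: "DERIV (\<lambda>r. \<xi> (ln r)) r :> (a - S (ln r)) * (1 / r)"
    "DERIV (\<lambda>r. S (ln r)) r :> R (\<xi> (ln r)) (S (ln r)) * (1 / r)" if "0 < r" for r
    using DERIV_chain2[OF d(1) DERIV_ln_divide[OF that]] DERIV_chain2[OF d(2) DERIV_ln_divide[OF that]] by auto
  have pos: "0 < ?u r" if "0 < r" for r using that by simp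
  have du: "DERIV ?u r :> u' r" if r: "0 < r" for r
  proof -
    have "DERIV (\<lambda>r. r powr (- a)) r :> - a * r powr (- a - 1)"
      using r by (auto intro!: derivative_eq_intros)
    moreover have "DERIV (\<lambda>r. exp (\<xi> (ln r))) r :> exp (\<xi> (ln r)) * ((a - S (ln r)) * (1 / r))"
      by (rule DERIV_chain2[OF DERIV_exp dlog(1)[OF r]])
    moreover have "r powr (- a - 1) = r powr (- a) / r" using r by (simp add: powr_diff)
    ultimately show ?thesis
      by (auto intro!: DERIV_cong[OF DERIV_mult] simp: u'_def algebra_simps)
  qed
  have du': "DERIV u' r :> u'' r" if r: "0 < r" for r
  proof -
    have "DERIV u' r :>
        - (((u' r * S (ln r) + R (\<xi> (ln r)) (S (ln r)) * (1 / r) * ?u r) * r - ?u r * S (ln r) * 1) / (r * r))"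
      unfolding u'_def[abs_def]
      by (intro DERIV_minus DERIV_divide DERIV_mult DERIV_ident dlog(2)[OF r])
         (use du[OF r] r in \<open>auto simp: u'_def\<close>)
    then show ?thesis
      by (rule DERIV_cong) (use r in \<open>simp add: u'_def u''_def power2_eq_square field_simps\<close>)
  qed
  have eq: "- u'' r - (real N - 1) / r * u' r = E_rhs p M (?u r) (u' r)" if r: "0 < r" for r
  proof -
    have xi: "\<xi> (ln r) = ln (?u r) + a * ln r" using r by (simp add: ln_mult)
    note ex = emden_exp[OF r pos[OF r] xi]
    have abs: "\<bar>S (ln r) * ?u r / r\<bar> = \<bar>u' r\<bar>" unfolding u'_def abs_minus_cancel by (simp add: mult.commute)
    define U where "U = ?u r"
    have U: "0 < U" using pos[OF r] by (simp add: U_def)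
    have Mq: "M * \<bar>S (ln r)\<bar> powr q * exp ((q - 1) * \<xi> (ln r)) = M * (r\<^sup>2 / U * \<bar>u' r\<bar> powr q)"
      using ex(2)[of "S (ln r)"] unfolding abs U_def by (simp only: mult.assoc)
    have "- u'' r - (real N - 1) / r * u' r
        = U / r\<^sup>2 * (R (\<xi> (ln r)) (S (ln r)) - (S (ln r))\<^sup>2 + (n - 2) * S (ln r))"
      unfolding u''_def u'_def U_def[symmetric] nN using r by (simp add: power2_eq_square field_simps)
    also have "R (\<xi> (ln r)) (S (ln r)) - (S (ln r))\<^sup>2 + (n - 2) * S (ln r)
        = r\<^sup>2 * U powr (p - 1) + M * (r\<^sup>2 / U * \<bar>u' r\<bar> powr q)"
      unfolding R_def Mq ex(1) U_def by simp
    also have "U / r\<^sup>2 * \<dots> = E_rhs p M U (u' r)"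
      unfolding E_rhs_eq using U r by (simp add: distrib_left)
    finally show ?thesis by (simp add: U_def)
  qed
  have "continuous_on {0<..} u''"
  proof -
    have c: "continuous_on {0<..} (\<lambda>r. \<xi> (ln r))" "continuous_on {0<..} (\<lambda>r. S (ln r))"
      using dlog DERIV_isCont by (blast intro: continuous_at_imp_continuous_on)+
    have "continuous_on {0<..} (\<lambda>r. R (\<xi> (ln r)) (S (ln r)))"
      using continuous_on_compose2[OF continuous_on_R[of UNIV] continuous_on_Pair[OF c]] by simp
    then show ?thesis unfolding u''_def
      by (intro continuous_intros c) auto
  qed
  then show ?thesis unfolding solves_E_def using du du' eq by blast
qed

text \<open>On bounded intervals \<open>q > 1\<close> gives
  \<open>\<bar>u'\<bar> powr q \<le> B powr (q - 1) * \<bar>u'\<bar>\<close>, so the gradient term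
  costs only a multiple of \<open>u'\<close> and linear Gronwall estimates replace a maximum
  principle: forwards from a zero of \<open>u'\<close> to exclude growth, backwards from a zero of
  \<open>u\<close> to exclude touching 0.\<close>

lemma ground_state_signs:
  assumes u: "\<And>r. 0 \<le> r \<Longrightarrow> (u has_real_derivative u' r) (at r within {0..})"
    and u': "\<And>r. 0 \<le> r \<Longrightarrow> (u' has_real_derivative u'' r) (at r within {0..})"
    and eq: "\<And>r. 0 < r \<Longrightarrow> - u'' r - (n - 1) / r * u' r = E_rhs p M (u r) (u' r)"
    and u'0: "u' 0 = 0" and nonneg: "\<And>r. 0 \<le> r \<Longrightarrow> 0 \<le> u r" and nz: "\<exists>r\<ge>0. u r \<noteq> 0"
  shows "0 \<le> r \<Longrightarrow> 0 < u r" "0 < r \<Longrightarrow> u' r < 0"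
proof -
  have du: "DERIV u r :> u' r" "DERIV u' r :> u'' r" if "0 < r" for r
    using u[of r] u'[of r] that at_within_interior[of r "{0..}"] by auto
  have cu: "continuous_on {0..} u" "continuous_on {0..} u'"
    using u u' by (auto simp: continuous_on_eq_continuous_within intro: DERIV_continuous)
  have u'_bound: "\<exists>B>0. \<forall>x\<in>{s..t}. \<bar>u' x\<bar> \<le> B" if "0 \<le> s" for s t
  proof -
    have "bounded (u' ` {s..t})"
      using that by (intro compact_imp_bounded compact_continuous_image continuous_on_subset[OF cu(2)]) auto
    then show ?thesis unfolding bounded_pos by auto
  qed
  have powq: "\<bar>x\<bar> powr q \<le> B powr (q - 1) * \<bar>x\<bar>" if "\<bar>x\<bar> \<le> B" for x B :: real
  proof (cases "x = 0")
    case False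
    then have "\<bar>x\<bar> powr q = \<bar>x\<bar> powr (q - 1) * \<bar>x\<bar>" using powr_add[of "\<bar>x\<bar>" "q - 1" 1] by simp
    also have "\<dots> \<le> B powr (q - 1) * \<bar>x\<bar>" using that q_bounds by (intro mult_right_mono powr_mono2) auto
    finally show ?thesis .
  qed simp
  have u'_le: "u' r \<le> 0" if "0 \<le> r" for r
  proof (rule ccontr)
    assume "\<not> u' r \<le> 0"
    have "continuous_on {- r..0} (\<lambda>x. u' (- x))"
      by (rule continuous_on_compose2[OF cu(2)]) (auto intro!: continuous_intros)
    from first_hit_from_above[OF this, of 0] that \<open>\<not> u' r \<le> 0\<close> u'0
    obtain y where y: "- r < y" "y \<le> 0" "u' (- y) = 0" "\<And>x. - r \<le> x \<Longrightarrow> x < y \<Longrightarrow> 0 < u' (- x)" by auto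
    define s where "s = - y"
    have s: "0 \<le> s" "s < r" "u' s = 0" "\<And>x. s < x \<Longrightarrow> x \<le> r \<Longrightarrow> 0 < u' x"
      using y(1-3) y(4)[of "- x" for x] by (auto simp: s_def)
    obtain B where B: "0 < B" "\<And>x. x \<in> {s..r} \<Longrightarrow> \<bar>u' x\<bar> \<le> B" using u'_bound[OF s(1)] by blast
    define C where "C = - M * B powr (q - 1)"
    have "u' r * exp (- C * r) \<le> u' s * exp (- C * s)"
    proof (rule exp_weight_nonincreasing[where g' = u''])
      fix x assume x: "s < x" "x < r"
      then have x0: "0 < x" using s(1) by simp
      show "DERIV u' x :> u'' x" by (rule du(2)[OF x0])
      show "u'' x \<le> C * u' x"
      proof -
        have ux: "0 < u' x" using s(4)[of x] x by simp
        have "u'' x = - ((n - 1) / x * u' x) - \<bar>u x\<bar> powr (p - 1) * u x - M * \<bar>u' x\<bar> powr q"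
          using eq[OF x0] unfolding E_rhs_eq by linarith
        moreover have "(- M) * \<bar>u' x\<bar> powr q = - (M * \<bar>u' x\<bar> powr q)" by simp
        moreover have "0 \<le> (n - 1) / x * u' x" using n x0 ux by simp
        moreover have "0 \<le> \<bar>u x\<bar> powr (p - 1) * u x" using nonneg[of x] x0 by simp
        moreover have "(- M) * \<bar>u' x\<bar> powr q \<le> (- M) * (B powr (q - 1) * \<bar>u' x\<bar>)"
          using M_nonpos B(2)[of x] x by (intro mult_left_mono powq) auto
        moreover have "(- M) * (B powr (q - 1) * \<bar>u' x\<bar>) = C * u' x" using ux by (simp add: C_def)
        ultimately show ?thesis by linarith
      qed
    qed (use s in \<open>auto intro: continuous_on_subset[OF cu(2)]\<close>)
    then show False using s(3) \<open>\<not> u' r \<le> 0\<close> by (simp add: mult_le_0_iff)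
  qed
  have "u r \<le> u 0" if "0 \<le> r" for r
  proof -
    have "- u 0 \<le> - u r"
    proof (rule DERIV_nonneg_imp_increasing_open[OF that, of "\<lambda>x. - u x"])
      fix x :: real assume "0 < x"
      then show "\<exists>y. DERIV (\<lambda>x. - u x) x :> y \<and> 0 \<le> y"
        using du(1)[of x] u'_le[of x] by (intro exI[of _ "- u' x"]) (auto intro: DERIV_minus)
    qed (auto intro!: continuous_intros continuous_on_subset[OF cu(1)])
    then show ?thesis by simp
  qed
  then have u0: "0 < u 0" using nz nonneg by (metis order_le_less order_less_le_trans)
  \<comment> \<open>At a zero of \<open>u'\<close> the inequality \<open>u' \<le> 0\<close> makes it
    a maximum of \<open>u'\<close>, so \<open>u''\<close> vanishes and the equation leaves only the
    power of \<open>u\<close>.\<close>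
  have neg: "u' x < 0" if x: "0 < x" and ux: "0 < u x" for x
  proof (rule ccontr)
    assume "\<not> u' x < 0"
    then have z: "u' x = 0" using u'_le[of x] x by simp
    have "u'' x = 0"
      by (rule DERIV_local_max[OF du(2)[OF x] x]) (use u'_le x z in \<open>auto simp: abs_if split: if_splits\<close>)
    then have "\<bar>u x\<bar> powr (p - 1) * u x = 0"
      using eq[OF x] z q_bounds by (simp add: E_rhs_eq)
    then show False using ux by simp
  qed
  show pos: "0 < u r" if "0 \<le> r" for r
  proof (rule ccontr)
    assume "\<not> 0 < u r"
    have "continuous_on {0..r} u" by (rule continuous_on_subset[OF cu(1)]) auto
    then obtain r0 where r0: "0 < r0" "u r0 = 0" "\<And>x. 0 \<le> x \<Longrightarrow> x < r0 \<Longrightarrow> 0 < u x"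
      using first_hit_from_above[OF _ \<open>0 \<le> r\<close> u0 leI[OF \<open>\<not> 0 < u r\<close>]] by metis
    \<comment> \<open>Touching 0 from above is a minimum. The Gronwall estimate between
      \<open>s\<close> and \<open>r0\<close> then yields \<open>0 \<le> u' s\<close>, against the
      strict decrease before \<open>r0\<close>.\<close>
    have z: "u' r0 = 0"
      by (rule DERIV_local_min[OF du(1)[OF r0(1)] r0(1)])
         (use nonneg r0 in \<open>auto simp: abs_if split: if_splits\<close>)
    define s where "s = r0 / 2"
    have s: "0 < s" "s < r0" using r0(1) by (auto simp: s_def)
    obtain B where B: "0 < B" "\<And>x. x \<in> {s..r0} \<Longrightarrow> \<bar>u' x\<bar> \<le> B" using u'_bound[of s r0] s by auto
    define C where "C = (n - 1) / s + - M * B powr (q - 1)"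
    have "u' r0 * exp (- (- C) * r0) \<le> u' s * exp (- (- C) * s)"
    proof (rule exp_weight_nonincreasing[where g' = u''])
      fix x assume x: "s < x" "x < r0"
      then have x0: "0 < x" using s by simp
      show "DERIV u' x :> u'' x" by (rule du(2)[OF x0])
      show "u'' x \<le> - C * u' x"
      proof -
        have ux: "u' x < 0" using neg[OF x0] r0(3)[of x] x x0 by simp
        have "- u'' x = (n - 1) / x * u' x + \<bar>u x\<bar> powr (p - 1) * u x + M * \<bar>u' x\<bar> powr q"
          using eq[OF x0] unfolding E_rhs_eq by linarith
        moreover have "(- M) * \<bar>u' x\<bar> powr q = - (M * \<bar>u' x\<bar> powr q)" by simp
        moreover have "(n - 1) / s * u' x \<le> (n - 1) / x * u' x"
          using n x s ux by (intro mult_right_mono_neg divide_left_mono) auto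
        moreover have "0 \<le> \<bar>u x\<bar> powr (p - 1) * u x" using nonneg[of x] x0 by simp
        moreover have "(- M) * \<bar>u' x\<bar> powr q \<le> (- M) * (B powr (q - 1) * \<bar>u' x\<bar>)"
          using M_nonpos B(2)[of x] x by (intro mult_left_mono powq) auto
        moreover have "(- M) * (B powr (q - 1) * \<bar>u' x\<bar>) = - ((- M * B powr (q - 1)) * u' x)" using ux by simp
        moreover have "C * u' x = (n - 1) / s * u' x + (- M * B powr (q - 1)) * u' x"
          unfolding C_def by (simp only: distrib_right)
        ultimately have "u'' x \<le> - (C * u' x)" by linarith
        then show ?thesis by simp
      qed
    qed (use s in \<open>auto intro: continuous_on_subset[OF cu(2)]\<close>)
    then have "0 \<le> u' s" using z by (simp add: zero_le_mult_iff)
    then show False using neg[OF s(1)] r0(3)[of s] s by simp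
  qed
  show "0 < r \<Longrightarrow> u' r < 0" using neg pos by simp
qed

text \<open>As \<open>r\<close> tends to 0, \<open>u\<close> tends to \<open>u 0 > 0\<close> and
  \<open>u'\<close> to 0 from below. Up to a constant \<zeta> is
  \<open>(1 + a) * ln u - a * ln (- u')\<close>, hence tends to infinity, which is the start
  required by the barrier.\<close>

lemma no_ground_state:
  assumes nN: "n = real N"
  shows "\<not> ground_state N p M u"
proof
  assume "ground_state N p M u"
  then obtain u' u'' where u'0: "u' 0 = 0"
    and u: "\<And>r. 0 \<le> r \<Longrightarrow> (u has_real_derivative u' r) (at r within {0..})"
    and u': "\<And>r. 0 \<le> r \<Longrightarrow> (u' has_real_derivative u'' r) (at r within {0..})"
    and eq: "\<And>r. 0 < r \<Longrightarrow> - u'' r - (n - 1) / r * u' r = E_rhs p M (u r) (u' r)"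
    and nonneg: "\<And>r. 0 \<le> r \<Longrightarrow> 0 \<le> u r" and nz: "\<exists>r\<ge>0. u r \<noteq> 0"
    unfolding ground_state_def regular_solution_E_def nN by blast
  note sg = ground_state_signs[OF u u' eq u'0 nonneg nz]
  have du: "DERIV u r :> u' r" "DERIV u' r :> u'' r" if "0 < r" for r
    using u[of r] u'[of r] that at_within_interior[of r "{0..}"] by auto
  define \<xi> where "\<xi> t = ln (u (exp t)) + a * t" for t
  define S where "S t = - (exp t * u' (exp t)) / u (exp t)" for t
  have tr: "trajectory_at \<xi> S t" for t
    unfolding \<xi>_def S_def by (rule trajectory_of_solution[OF du(1) du(2) eq]) (use sg in auto)
  have Spos: "0 < S t" for t 
    unfolding S_def using sg(1)[of "exp t"] sg(2)[of "exp t"] by (intro divide_pos_pos) (auto simp: mult_pos_neg)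
  have e0: "filterlim exp (at 0 within {0..}) (at_bot :: real filter)"
    using exp_at_bot by (auto simp: filterlim_at)
  have cu: "(u \<longlongrightarrow> u 0) (at 0 within {0..})" "(u' \<longlongrightarrow> 0) (at 0 within {0..})"
    using DERIV_continuous[OF u[of 0]] DERIV_continuous[OF u'[of 0]] u'0 by (auto simp: continuous_within)
  have lu: "((\<lambda>t. u (exp t)) \<longlongrightarrow> u 0) at_bot" "((\<lambda>t. u' (exp t)) \<longlongrightarrow> 0) at_bot"
    using filterlim_compose[OF cu(1) e0] filterlim_compose[OF cu(2) e0] by auto
  have u0: "0 < u 0" using sg(1) by simp
  have lln: "((\<lambda>t. ln (u (exp t))) \<longlongrightarrow> ln (u 0)) at_bot" using lu(1) u0 by (intro tendsto_ln) auto
  have at: "filterlim (\<lambda>t. a * t) at_bot at_bot"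
    by (rule filterlim_tendsto_pos_mult_at_bot[OF tendsto_const a_pos filterlim_ident])
  have "filterlim \<xi> at_bot at_bot"
    unfolding \<xi>_def filterlim_uminus_at_bot minus_add_distrib
    using at by (intro filterlim_tendsto_add_at_top[OF tendsto_minus[OF lln]]) (simp add: filterlim_uminus_at_bot)
  moreover have "(S \<longlongrightarrow> 0) at_bot"
  proof -
    have "((\<lambda>t. - (exp t * u' (exp t)) / u (exp t)) \<longlongrightarrow> - (0 * 0) / u 0) at_bot"
      using u0 by (intro tendsto_intros lu exp_at_bot) auto
    then show ?thesis by (simp add: S_def[abs_def])
  qed
  moreover have "filterlim (\<lambda>t. \<zeta> (\<xi> t) (S t)) at_top at_bot"
  proof -
    have "filterlim (\<lambda>t. - u' (exp t)) (at_right 0) at_bot"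
    proof -
      have "u' (exp t) < 0" for t using sg(2)[of "exp t"] by simp
      then show ?thesis
        using tendsto_minus[OF lu(2)] by (auto simp: filterlim_at intro!: always_eventually less_imp_neq)
    qed
    then have "filterlim (\<lambda>t. ln (- u' (exp t))) at_bot at_bot" by (rule filterlim_compose[OF ln_at_0])
    then have "filterlim (\<lambda>t. a * ln (- u' (exp t))) at_bot at_bot"
      by (rule filterlim_tendsto_pos_mult_at_bot[OF tendsto_const a_pos])
    then have "filterlim (\<lambda>t. - a * ln (- u' (exp t))) at_top at_bot"
      by (simp add: filterlim_uminus_at_bot)
    moreover have "((\<lambda>t. (1 + a) * ln (u (exp t)) + a * ln a) \<longlongrightarrow> (1 + a) * ln (u 0) + a * ln a) at_bot"
      by (intro tendsto_intros lln)
    ultimately have "filterlim (\<lambda>t. ((1 + a) * ln (u (exp t)) + a * ln a) + - a * ln (- u' (exp t))) at_top at_bot"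
      using filterlim_tendsto_add_at_top by blast
    moreover have "\<zeta> (\<xi> t) (S t) = ((1 + a) * ln (u (exp t)) + a * ln a) + - a * ln (- u' (exp t))" for t
    proof -
      have pos: "0 < u (exp t)" "0 < - u' (exp t)" using sg(1)[of "exp t"] sg(2)[of "exp t"] by auto
      have lnS: "ln (S t / a) = t + ln (- u' (exp t)) - ln (u (exp t)) - ln a"
      proof -
        have "S t / a = exp t * (- u' (exp t)) / u (exp t) / a" by (simp add: S_def)
        then show ?thesis using pos a_pos by (simp only: ln_mult ln_div) (simp add: ln_mult ln_div)
      qed
      show ?thesis unfolding \<zeta>_def lnS \<xi>_def by (simp add: algebra_simps)
    qed
    ultimately show ?thesis by simp
  qed
  ultimately show False using no_regular_trajectory[OF tr Spos] by blast
qed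

text \<open>Substituting \<open>X = exp \<xi>\<close> turns the root equation into
  \<open>f \<xi> = 0\<close>, because \<open>K_const N p\<close> is
  \<open>- \<kappa>\<close>.\<close>

lemma X_roots_eq:
  assumes nN: "n = real N"
  shows "X_roots N p M = {X. 0 < X \<and> f (ln X) = 0}"
proof -
  have K: "- (2 * K_const N p / (p - 1)) = a * \<kappa>"
  proof -
    have "(n - 2) * p - n = - \<kappa> * (p - 1)"
      using a_p by (simp add: \<kappa>_def algebra_simps)
    then have "K_const N p = - \<kappa>" using p by (simp add: K_const_def nN)
    then show ?thesis by (simp add: a_def)
  qed
  have "X powr (p - 1) + M * (2 / (p - 1)) powr (2 * p / (p + 1)) * X powr ((p - 1) / (p + 1))
       - 2 * K_const N p / (p - 1) = f (ln X)" if "0 < X" for X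
  proof -
    have "X powr (p - 1) = exp ((p - 1) * ln X)" "X powr ((p - 1) / (p + 1)) = exp ((q - 1) * ln X)"
      using that by (simp_all add: powr_def q_minus_1)
    then show ?thesis unfolding f_eq a_def[symmetric] q_def[symmetric] using K by simp
  qed
  then show ?thesis unfolding X_roots_def by (intro Collect_cong conj_cong refl) (simp only:)
qed

lemma mu_star_eq: "n = real N \<Longrightarrow> mu_star N p = \<mu>"
proof -
  assume nN: "n = real N"
  have "2 * \<theta> = (n - 2) * (p - 1)" by (simp add: \<theta>_def)
  then have "n - (n - 2) * p = 2 * (1 - \<theta>)" by (simp add: algebra_simps)
  then have "(n - (n - 2) * p) / (2 * p) = (2 * (1 - \<theta>)) / (2 * p)" by (simp only:)
  also have "\<dots> = (1 - \<theta>) / p" by (rule mult_divide_mult_cancel_left) simp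
  finally show ?thesis by (simp add: mu_star_def \<mu>_def flip: nN)
qed

end

section \<open>The singular solution\<close>

context two_equilibria
begin

lemma X12:
  assumes nN: "n = real N" and f_left: "\<And>\<xi>. \<xi> < \<xi>1 \<Longrightarrow> 0 < f \<xi>"
  shows "X1 N p M = exp \<xi>1" "X2 N p M = exp \<xi>2"
proof -
  have "f \<xi> = 0 \<longleftrightarrow> \<xi> = \<xi>1 \<or> \<xi> = \<xi>2" for \<xi>
    using roots f_neg[of \<xi>] f_pos[of \<xi>] f_left[of \<xi>] by (metis less_irrefl neqE)
  then have "X_roots N p M = {X. 0 < X \<and> (ln X = \<xi>1 \<or> ln X = \<xi>2)}" by (simp add: X_roots_eq[OF nN])
  also have "\<dots> = {exp \<xi>1, exp \<xi>2}" by (auto simp: ln_unique)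
  finally have "X_roots N p M = {exp \<xi>1, exp \<xi>2}" .
  then show "X1 N p M = exp \<xi>1" "X2 N p M = exp \<xi>2"
    using roots(1) by (simp_all add: X1_def X2_def)
qed


lemma singular_solution_exists:
  assumes nN: "n = real N" and f_left: "\<And>\<xi>. \<xi> < \<xi>1 \<Longrightarrow> 0 < f \<xi>"
  obtains u where "solves_E N p M u" "singular_solution_E N p M u" "\<And>r. 0 < r \<Longrightarrow> 0 < u r"
    "u \<sim>[at_right 0] U2 N p M" "u \<sim>[at_top] U1 N p M" "\<And>r. 0 < r \<Longrightarrow> U1 N p M r < u r"
    "\<And>w. solves_E N p M w \<Longrightarrow> (\<And>r. 0 < r \<Longrightarrow> U1 N p M r < w r) \<Longrightarrow> w \<sim>[at_top] U1 N p M \<Longrightarrow>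
      \<exists>k>0. \<forall>r>0. w r = k powr (2 / (p - 1)) * u (k * r)"
proof -
  note X = X12[OF nN f_left]
  have U1: "U1 N p M r = exp \<xi>1 * r powr (- a)" and U2: "U2 N p M r = exp \<xi>2 * r powr (- a)" for r
    by (simp_all add: U1_def U2_def X a_def)
  obtain \<xi> S where tr: "\<And>t. trajectory_at \<xi> S t" and gt: "\<And>t. \<xi>1 < \<xi> t"
    and top: "(\<xi> \<longlongrightarrow> \<xi>1) at_top" and bot: "(\<xi> \<longlongrightarrow> \<xi>2) at_bot"
    using heteroclinic_exists by metis
  define u where "u r = r powr (- a) * exp (\<xi> (ln r))" for r
  have ratio: "u r / (exp x * r powr (- a)) = exp (\<xi> (ln r) - x)" if "0 < r" for r x
    using that by (simp add: u_def exp_diff)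
  have sol: "solves_E N p M u"
    unfolding u_def[abs_def] by (rule solution_of_trajectory[OF tr nN])
  have u_pos: "0 < u r" if "0 < r" for r using that by (simp add: u_def)
  have u2: "u \<sim>[at_right 0] U2 N p M"
  proof (rule asymp_equivI')
    have "((\<lambda>r. exp (\<xi> (ln r) - \<xi>2)) \<longlongrightarrow> exp (\<xi>2 - \<xi>2)) (at_right 0)"
      by (intro tendsto_intros filterlim_compose[OF bot ln_at_0])
    moreover have "\<forall>\<^sub>F r in at_right 0. exp (\<xi> (ln r) - \<xi>2) = u r / U2 N p M r"
      using eventually_at_right_less[of "0 :: real"] by eventually_elim (simp add: U2 ratio)
    ultimately show "((\<lambda>r. u r / U2 N p M r) \<longlongrightarrow> 1) (at_right 0)"
      by (simp add: tendsto_cong)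
  qed
  have u1: "u \<sim>[at_top] U1 N p M"
  proof (rule asymp_equivI')
    have "((\<lambda>r. exp (\<xi> (ln r) - \<xi>1)) \<longlongrightarrow> exp (\<xi>1 - \<xi>1)) at_top"
      by (intro tendsto_intros filterlim_compose[OF top ln_at_top])
    moreover have "\<forall>\<^sub>F r in at_top. exp (\<xi> (ln r) - \<xi>1) = u r / U1 N p M r"
      using eventually_gt_at_top[of "0 :: real"] by eventually_elim (simp add: U1 ratio)
    ultimately show "((\<lambda>r. u r / U1 N p M r) \<longlongrightarrow> 1) at_top"
      by (simp add: tendsto_cong)
  qed
  have ugt: "U1 N p M r < u r" if "0 < r" for r
    using that gt[of "ln r"] by (simp add: U1 u_def mult.commute)
  \<comment> \<open>\<xi> has a finite limit at minus infinity, so \<open>u\<close> blows up like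
    \<open>r powr (- a)\<close> at 0, while a regular extension would be continuous there.\<close>
  have sing: "singular_solution_E N p M u"
    unfolding singular_solution_E_def
  proof (intro conjI sol notI)
    assume "\<exists>v. regular_solution_E N p M v \<and> (\<forall>r>0. v r = u r)"
    then obtain v where reg: "regular_solution_E N p M v" and v2: "\<forall>r>0. v r = u r" by blast
    obtain v' v'' where "\<forall>r\<ge>0. (v has_real_derivative v' r) (at r within {0..}) \<and>
        (v' has_real_derivative v'' r) (at r within {0..})"
      using reg unfolding regular_solution_E_def by blast
    then have v1: "(v has_real_derivative v' 0) (at 0 within {0..})" by simp
    have e0: "filterlim exp (at 0 within {0..}) (at_bot :: real filter)"
      using exp_at_bot by (auto simp: filterlim_at)
    have "(v \<longlongrightarrow> v 0) (at 0 within {0..})" using DERIV_continuous[OF v1] by (simp add: continuous_within)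
    from filterlim_compose[OF this e0] have lim: "((\<lambda>t. u (exp t)) \<longlongrightarrow> v 0) at_bot" by (simp add: v2)
    have "filterlim (\<lambda>t. a * t) at_bot at_bot"
      by (rule filterlim_tendsto_pos_mult_at_bot[OF tendsto_const a_pos filterlim_ident])
    then have "filterlim (\<lambda>t. - a * t) at_top at_bot" by (simp add: filterlim_uminus_at_bot)
    then have "filterlim (\<lambda>t. \<xi> t + - a * t) at_top at_bot" by (rule filterlim_tendsto_add_at_top[OF bot])
    then have "filterlim (\<lambda>t. exp (\<xi> t + - a * t)) at_top at_bot" by (rule filterlim_compose[OF exp_at_top])
    moreover have "exp (\<xi> t + - a * t) = u (exp t)" for t
      by (simp add: u_def powr_def exp_add exp_diff exp_minus field_simps)
    ultimately have "filterlim (\<lambda>t. u (exp t)) at_infinity at_bot" by (simp add: filterlim_at_top_imp_at_infinity)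
    then show False using not_tendsto_and_filterlim_at_infinity[OF _ lim] trivial_limit_at_bot_linorder by blast
  qed
  have unique: "\<exists>k>0. \<forall>r>0. w r = k powr (2 / (p - 1)) * u (k * r)"
    if w: "solves_E N p M w" and wgt: "\<And>r. 0 < r \<Longrightarrow> U1 N p M r < w r" and w1: "w \<sim>[at_top] U1 N p M" for w
  proof -
    have wpos: "0 < w r" if "0 < r" for r
    proof -
      have "0 < U1 N p M r" using that by (simp add: U1)
      then show ?thesis using wgt[OF that] by simp
    qed
    obtain w' w'' where w': "\<And>r. 0 < r \<Longrightarrow> DERIV w r :> w' r"
      "\<And>r. 0 < r \<Longrightarrow> DERIV w' r :> w'' r"
      "\<And>r. 0 < r \<Longrightarrow> - w'' r - (n - 1) / r * w' r = E_rhs p M (w r) (w' r)"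
      using w unfolding solves_E_def nN by blast
    define \<eta> where "\<eta> t = ln (w (exp t)) + a * t" for t
    define Q where "Q t = - (exp t * w' (exp t)) / w (exp t)" for t
    have trw: "trajectory_at \<eta> Q t" for t
      unfolding \<eta>_def Q_def by (rule trajectory_of_solution[OF w' wpos])
    have e\<eta>: "w r / U1 N p M r = exp (\<eta> (ln r) - \<xi>1)" if "0 < r" for r
      using that wpos[OF that] by (simp add: \<eta>_def U1 exp_diff exp_add powr_def exp_minus field_simps)
    have w\<eta>: "w r = r powr (- a) * exp (\<eta> (ln r))" if "0 < r" for r
      using that wpos[OF that] by (simp add: \<eta>_def exp_add powr_def exp_minus field_simps)
    have gtw: "\<xi>1 < \<eta> t" for t
      using wgt[of "exp t"] w\<eta>[of "exp t"] by (simp add: U1 mult.commute)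
    have "((\<lambda>r. exp (\<eta> (ln r) - \<xi>1)) \<longlongrightarrow> 1) at_top"
    proof -
      \<comment> \<open>\<open>asymp_equiv\<close> assigns the quotient the value 1 where both
        functions vanish; positivity of \<open>w\<close> rules that branch out.\<close>
      have "((\<lambda>r. if w r = 0 \<and> U1 N p M r = 0 then 1 else w r / U1 N p M r) \<longlongrightarrow> 1) at_top"
        using w1 by (simp add: asymp_equiv_def)
      moreover have "\<forall>\<^sub>F r in at_top. (if w r = 0 \<and> U1 N p M r = 0 then 1 else w r / U1 N p M r) = exp (\<eta> (ln r) - \<xi>1)"
        using eventually_gt_at_top[of "0 :: real"] by eventually_elim (use wpos e\<eta> in force)
      ultimately show ?thesis by (simp add: tendsto_cong)
    qed
    from filterlim_compose[OF this exp_at_top] have "((\<lambda>t. exp (\<eta> t - \<xi>1)) \<longlongrightarrow> 1) at_top" by simp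
    then have "((\<lambda>t. ln (exp (\<eta> t - \<xi>1))) \<longlongrightarrow> ln 1) at_top" by (rule tendsto_ln) simp
    then have "((\<lambda>t. \<eta> t - \<xi>1) \<longlongrightarrow> 0) at_top" by simp
    then have limw: "(\<eta> \<longlongrightarrow> \<xi>1) at_top" using LIM_zero_iff by blast
    obtain \<tau> where \<tau>: "\<And>t. \<eta> t = \<xi> (t + \<tau>)"
      using heteroclinic_unique[OF tr gt top trw gtw limw] by blast
    have "w r = exp \<tau> powr (2 / (p - 1)) * u (exp \<tau> * r)" if r: "0 < r" for r
    proof -
      have "ln (exp \<tau> * r) = ln r + \<tau>" using r by (simp add: ln_mult)
      then have "exp \<tau> powr a * u (exp \<tau> * r) = exp \<tau> powr a * exp \<tau> powr (- a) * (r powr (- a) * exp (\<xi> (ln r + \<tau>)))"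
        using r by (simp add: u_def powr_mult)
      also have "exp \<tau> powr a * exp \<tau> powr (- a) = 1" by (simp add: powr_minus)
      finally show ?thesis using w\<eta>[OF r] by (simp add: \<tau> a_def)
    qed
    then show ?thesis by (intro exI[of _ "exp \<tau>"]) auto
  qed
  from sol sing u_pos u2 u1 ugt unique show ?thesis by (rule that)
qed

end

theorem theorem4p15:
  fixes N :: nat and p M :: real
  assumes "N \<ge> 3" and "1 < p" and "p < real N / (real N - 2)"
  shows "(M_bar N p \<le> M \<and> M \<le> 0 \<longrightarrow> \<not> (\<exists>u. ground_state N p M u))
       \<and> (M_bar N p \<le> M \<and> M < - mu_star N p \<longrightarrow>
           (\<exists>u. solves_E N p M u \<and> singular_solution_E N p M u \<and> (\<forall>r>0. u r > 0)
              \<and> (u \<sim>[at_right 0] U2 N p M) \<and> (u \<sim>[at_top] U1 N p M)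
              \<and> (\<forall>r>0. u r > U1 N p M r)
              \<and> (\<forall>w. solves_E N p M w \<and> (\<forall>r>0. w r > 0)
                    \<and> (w \<sim>[at_right 0] U2 N p M) \<and> (w \<sim>[at_top] U1 N p M)
                    \<and> (\<forall>r>0. w r > U1 N p M r)
                   \<longrightarrow> (\<exists>k>0. \<forall>r>0. w r = k powr (2 / (p - 1)) * u (k * r)))))"
proof -
  have np: "(real N - 2) * (p - 1) < 2"
  proof -
    have "p * (real N - 2) < real N" using assms by (simp add: less_divide_eq)
    then show ?thesis by (simp add: algebra_simps)
  qed
  have loc: "emden_fowler (real N) p M" if "M_bar N p \<le> M" "M \<le> 0"
    using assms np that by unfold_locales (auto simp: M_bar_def)
  show ?thesis
  proof ((rule conjI; rule impI), goal_cases)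
    case 1
    then show ?case using emden_fowler.no_ground_state[OF loc] by blast
  next
    case M: 2
    \<comment> \<open>Gives \<open>M \<le> 0\<close>, which the locale asks for, from
      \<open>M < - mu_star N p\<close>.\<close>
    have "0 \<le> mu_star N p" using assms by (simp add: mu_star_def)
    then interpret emden_fowler "real N" p M using loc M by simp
    have "M < - \<mu>" using M by (simp add: mu_star_eq[OF refl])
    then obtain \<xi>1 \<xi>2 where r: "\<xi>1 < \<xi>m" "\<xi>m < \<xi>2" "f \<xi>1 = 0" "f \<xi>2 = 0"
      "\<And>\<xi>. \<xi> < \<xi>1 \<Longrightarrow> 0 < f \<xi>" "\<And>\<xi>. \<xi>1 < \<xi> \<Longrightarrow> \<xi> < \<xi>2 \<Longrightarrow> f \<xi> < 0" "\<And>\<xi>. \<xi>2 < \<xi> \<Longrightarrow> 0 < f \<xi>"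
      by (rule f_two_roots) (rule that; blast)
    interpret two_equilibria "real N" p M \<xi>1 \<xi>2
      using r by unfold_locales auto
    obtain u where u: "solves_E N p M u" "singular_solution_E N p M u" "\<And>r. 0 < r \<Longrightarrow> 0 < u r"
      "u \<sim>[at_right 0] U2 N p M" "u \<sim>[at_top] U1 N p M" "\<And>r. 0 < r \<Longrightarrow> U1 N p M r < u r"
      and uniq: "\<And>w. solves_E N p M w \<Longrightarrow> (\<And>r. 0 < r \<Longrightarrow> U1 N p M r < w r) \<Longrightarrow> w \<sim>[at_top] U1 N p M \<Longrightarrow>
        \<exists>k>0. \<forall>r>0. w r = k powr (2 / (p - 1)) * u (k * r)"
      using singular_solution_exists[OF refl r(5)] by metis
    show ?case
      using u uniq by (intro exI[of _ u]) simp
  qed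
qed

end
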